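(* Let $\mathbb{K}$ be a class of logics. The following conditions are equivalent: (i) $\mathbb{K}$ is a Leibniz class. (ii) $\mathbb{K}$ is closed under term-equivalence, compatible expansions, and non-indexed products of sets of logics. (iii) The collection $\mathbb{K}^{\dagger} := \{ \llbracket \vdash \rrbracket : {\vdash} \in \mathbb{K}\}$ is a set-complete filter of $\mathsf{Log}$, and $\mathbb{K} = \{ {\vdash} : {\vdash} \text{ is a logic and } \llbracket \vdash \rrbracket \in \mathbb{K}^{\dagger}\}$.
   Context: Languages and logics. An algebraic language is a set of function symbols of positive finite arity (constants are treated as unary symbols). For a language $\mathcal{L}$ and an infinite cardinal $\kappa$, $Fm_{\mathcal{L}}(\kappa)$ is the set (and absolutely free algebra) of $\mathcal{L}$-terms, called formulas, over variables $\{x_\alpha : \alpha<\kappa\}$. A logic $\vdash$ is a consequence relation on $Fm_{\mathcal L}(\kappa)$, for some $\mathcal L$ and some infinite $\kappa$ (a relation between sets of formulas and formulas such that $\Gamma\vdash\gamma$ for $\gamma\in\Gamma$, and if $\Gamma\vdash\delta$ for all $\delta\in\Delta$ and $\Delta\vdash\varphi$ then $\Gamma\vdash\varphi$) that is substitution invariant ($\Gamma\vdash\varphi$ implies $\sigma[\Gamma]\vdash\sigma(\varphi)$ for every endomorphism $\sigma$ of the formula algebra). Finitarity is not assumed. Its language is $\mathcal L_\vdash$ and its set of formulas is $Fm(\vdash)$. Matrices. A matrix is a pair $\langle \boldsymbol A,F\rangle$ with $\boldsymbol A$ an algebra and $F\subseteq A$. A model of $\vdash$ is a matrix $\langle \boldsymbol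 A,F\rangle$ with $\boldsymbol A$ an $\mathcal L_\vdash$-algebra such that, whenever $\Gamma\vdash\varphi$ and $h$ is a homomorphism from the formula algebra of $\vdash$ to $\boldsymbol A$ with $h[\Gamma]\subseteq F$, then $h(\varphi)\in F$; in this case $F$ is called a deductive filter of $\vdash$ on $\boldsymbol A$. $\mathsf{Mod}(\vdash)$ is the class of models. A congruence $\theta$ is compatible with $F$ if $a\in F$ and $\langle a,b\rangle\in\theta$ imply $b\in F$; the Leibniz congruence $\boldsymbol\Omega^{\boldsymbol A}F$ is the largest congruence of $\boldsymbol A$ compatible with $F$. The Suszko congruence $\widetilde{\boldsymbol\Omega}{}^{\boldsymbol A}_{\vdash}F$ is the intersection of all $\boldsymbol\Omega^{\boldsymbol A}G$, where $G\supseteq F$ is a deductive filter of $\vdash$ on $\boldsymbol A$. $\mathsf{Mod}^{\equiv}(\vdash)$ is the class of models $\langle\boldsymbol A,F\rangle$ of $\vdash$ such that $\widetilde{\boldsymbol\Omega}{}^{\boldsymbol A}_{\vdash}F$ is the identity relation. The logic on $Fm_{\mathcal L}(\kappa)$ induced by a class $\mathsf M$ of $\mathcal L$-matrices is defined by: $\Gamma\vdash\varphi$ iff for all $\langle\boldsymbol A,F\rangle\in\mathsf M$ and all homomorphisms $h$ into $\boldsymbol A$, $h[\Gamma]\subseteq F$ implies $h(\varphi)\in F$. Interpretability. A translation $\boldsymbol\tau$ of $\mathcal L$ into $\mathcal L'$ maps each $n$-ary symbol $\ast\in\mathcal L$ to an $\mathcal L'$-term $\boldsymbol\tau(\ast)(x_1,\dots,x_n)$.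 For an $\mathcal L'$-algebra $\boldsymbol A$, $\boldsymbol A^{\boldsymbol\tau}$ is the $\mathcal L$-algebra on $A$ in which $\ast$ is interpreted as the term-function $\boldsymbol\tau(\ast)^{\boldsymbol A}$. An interpretation of $\vdash$ into $\vdash'$ is a translation $\boldsymbol\tau$ of $\mathcal L_\vdash$ into $\mathcal L_{\vdash'}$ such that $\langle\boldsymbol A^{\boldsymbol\tau},F\rangle\in\mathsf{Mod}^{\equiv}(\vdash)$ for all $\langle\boldsymbol A,F\rangle\in\mathsf{Mod}^{\equiv}(\vdash')$. Write ${\vdash}\leq{\vdash'}$ if there is one. This is a preorder; $\llbracket\vdash\rrbracket$ denotes the class of logics equi-interpretable with $\vdash$, and $\mathsf{Log}$ is the induced partial order on these classes. Infima of (set-sized) families exist in $\mathsf{Log}$. A set-complete filter of $\mathsf{Log}$ is a non-empty upset closed under infima of sets. Leibniz classes. A Leibniz condition is a class $\Phi=\{\vdash_{\Phi_\alpha} : \alpha \text{ an ordinal}\}$ of logics such that $\alpha\leq\beta$ implies ${\vdash_{\Phi_\beta}}\leq{\vdash_{\Phi_\alpha}}$; $\mathrm{Log}(\Phi)$ is the class of logics $\vdash$ with ${\vdash_{\Phi_\alpha}}\leq{\vdash}$ for some ordinal $\alpha$. A Leibniz class is a class of logics of the form $\mathrm{Log}(\Phi)$ for some Leibniz condition $\Phi$. Closure operations. Logics $\vdash,\vdash'$ are term-equivalent if there are interpretations $\boldsymbol\tau$ of $\vdash$ into $\vdash'$ and $\boldsymbol\rho$ of $\vdash'$ into $\vdash$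 such that $(\boldsymbol A^{\boldsymbol\rho})^{\boldsymbol\tau}=\boldsymbol A$ for all $\langle\boldsymbol A,F\rangle\in\mathsf{Mod}^{\equiv}(\vdash)$ and $(\boldsymbol B^{\boldsymbol\tau})^{\boldsymbol\rho}=\boldsymbol B$ for all $\langle\boldsymbol B,G\rangle\in\mathsf{Mod}^{\equiv}(\vdash')$. A logic $\vdash'$ is a compatible expansion of $\vdash$ if $\mathcal L_\vdash\subseteq\mathcal L_{\vdash'}$ and the $\mathcal L_\vdash$-reducts of the matrices in $\mathsf{Mod}^{\equiv}(\vdash')$ belong to $\mathsf{Mod}^{\equiv}(\vdash)$. For a set $\{\vdash_i : i\in I\}$ of logics, with $\vdash_i$ formulated in $\kappa_i$ variables, let $\bigotimes_i\mathcal L_{\vdash_i}$ be the language whose $n$-ary symbols ($n\geq1$) are the sequences $\langle\varphi_i(x_1,\dots,x_n):i\in I\rangle$ with $\varphi_i$ an $\mathcal L_{\vdash_i}$-term in variables among $x_1,\dots,x_n$. For $\mathcal L_{\vdash_i}$-algebras $\boldsymbol A_i$, $\bigotimes_i\boldsymbol A_i$ has universe $\prod_iA_i$, and $\langle\varphi_i\rangle_i$ acts coordinatewise as $\varphi_i^{\boldsymbol A_i}$; and $\bigotimes_i\langle\boldsymbol A_i,F_i\rangle=\langle\bigotimes_i\boldsymbol A_i,\prod_iF_i\rangle$. The non-indexed product $\bigotimes_{i\in I}\vdash_i$ is the logic in language $\bigotimes_i\mathcal L_{\vdash_i}$ with $\max\{\omega,|I|,\sup_i\kappa_i\}$ variables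 induced by $\{\bigotimes_i\langle\boldsymbol A_i,F_i\rangle : \langle\boldsymbol A_i,F_i\rangle\in\mathsf{Mod}^{\equiv}(\vdash_i)\}$. For $I=\emptyset$ it is, by convention, the inconsistent logic (every formula follows from every set of formulas) in the empty language over $\omega$ variables; closure under non-indexed products of sets includes the empty set. *)

theory Defs
  imports "HOL-Algebra.Order" "HOL-Library.Equipollence"
begin

section \<open>The set-theoretic universe\<close>

text \<open>
  The theorem is about proper classes: logics over arbitrary sets of symbols, matrices on arbitrary
  sets, and sequences indexed by all ordinals.  A type of class \<open>zfc\<close> is a universe of all sets:
  the axioms are those of ZF in their second-order form (separation and replacement for arbitrary
  HOL predicates and functions); choice comes from HOL.  A value of type \<open>'v set\<close> is a class of
  elements of the universe, and it is a set in the sense of ZFC exactly if it is \<open>small\<close>.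
\<close>

class zfc =
  fixes elts :: "'a \<Rightarrow> 'a set"
  assumes zfc_extensionality: "elts x = elts y \<Longrightarrow> x = y"
    and zfc_separation: "Y \<subseteq> elts x \<Longrightarrow> \<exists>z. elts z = Y"
    and zfc_union: "\<exists>z. elts z = \<Union> (elts ` elts x)"
    and zfc_powerset: "\<exists>z. elts z = {y. elts y \<subseteq> elts x}"
    and zfc_replacement: "\<exists>z. elts z = f ` elts x"
    and zfc_infinity: "\<exists>z. elts z = range (g :: nat \<Rightarrow> 'a)"
    and zfc_foundation: "wf {(x, y). x \<in> elts y}"

definition small :: "'v::zfc set \<Rightarrow> bool"
  where "small X \<longleftrightarrow> X \<in> range elts"

definition vset :: "'v::zfc set \<Rightarrow> 'v"
  where "vset X = inv elts X"

definition vpair :: "'v::zfc \<Rightarrow> 'v \<Rightarrow> 'v"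
  where "vpair a b = vset {vset {a}, vset {a, b}}"

primrec vnat :: "nat \<Rightarrow> 'v::zfc" where
  "vnat 0 = vset {}"
| "vnat (Suc n) = vset (insert (vnat n) (elts (vnat n)))"

definition omega :: "'v::zfc"
  where "omega = vset (range vnat)"

primrec vlist :: "'v::zfc list \<Rightarrow> 'v" where
  "vlist [] = vset {}"
| "vlist (x # xs) = vpair x (vlist xs)"

text \<open>The family \<open>\<langle>f i : i \<in> I\<rangle>\<close> as an element of the universe, and its components.\<close>

definition vlam :: "'v::zfc set \<Rightarrow> ('v \<Rightarrow> 'v) \<Rightarrow> 'v"
  where "vlam I f = vset ((\<lambda>i. vpair i (f i)) ` I)"

definition vapp :: "'v::zfc \<Rightarrow> 'v \<Rightarrow> 'v"
  where "vapp s i = (THE y. vpair i y \<in> elts s)"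

definition Ord :: "'v::zfc \<Rightarrow> bool"
  where "Ord a \<longleftrightarrow> (\<forall>x\<in>elts a. elts x \<subseteq> elts a) \<and> (\<forall>x\<in>elts a. \<forall>y\<in>elts x. elts y \<subseteq> elts x)"

definition Cardinal :: "'v::zfc \<Rightarrow> bool"
  where "Cardinal k \<longleftrightarrow> Ord k \<and> (\<forall>a\<in>elts k. elts a \<prec> elts k)"

definition vcard :: "'v::zfc set \<Rightarrow> 'v"
  where "vcard X = (THE k. Cardinal k \<and> elts k \<approx> X)"


section \<open>Languages, formulas, algebras\<close>

text \<open>A symbol carries its arity as its second component.\<close>

type_synonym 'v sym = "'v \<times> nat"

definition language :: "'v::zfc sym set \<Rightarrow> bool"
  where "language L \<longleftrightarrow> small (fst ` L) \<and> (\<forall>s\<in>L. snd s \<ge> 1)"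

datatype 'v fm = Var 'v | App "'v sym" "'v fm list"

inductive_set Fm :: "'v sym set \<Rightarrow> 'v set \<Rightarrow> 'v fm set"
  for L :: "'v sym set" and X :: "'v set" where
  Var: "x \<in> X \<Longrightarrow> Var x \<in> Fm L X"
| App: "s \<in> L \<Longrightarrow> length ts = snd s \<Longrightarrow> ts \<in> lists (Fm L X) \<Longrightarrow> App s ts \<in> Fm L X"

text \<open>The variables \<open>x\<^sub>1, \<dots>, x\<^sub>n\<close>; in general \<open>x\<^sub>\<alpha>\<close> is \<open>Var \<alpha>\<close>.\<close>

definition vars_upto :: "nat \<Rightarrow> 'v::zfc set"
  where "vars_upto n = vnat ` {1..n}"

text \<open>
  The operations are total functions; only their values at symbols of the language under
  consideration, on tuples of the right length over the carrier, matter.  In particular the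
  \<open>L\<close>-reduct of an algebra \<open>A\<close> for a larger language is \<open>A\<close> itself, regarded as an \<open>L\<close>-algebra,
  and equality of \<open>L\<close>-algebras is the relation \<open>alg_eq L\<close>.
\<close>

record ('v, 'a) alg = "'a partial_object" +
  oper :: "'v sym \<Rightarrow> 'a list \<Rightarrow> 'a"

definition algebra :: "'v sym set \<Rightarrow> ('v, 'a) alg \<Rightarrow> bool"
  where "algebra L A \<longleftrightarrow> carrier A \<noteq> {} \<and>
    (\<forall>s\<in>L. \<forall>as\<in>lists (carrier A). length as = snd s \<longrightarrow> oper A s as \<in> carrier A)"

definition alg_eq :: "'v sym set \<Rightarrow> ('v, 'a) alg \<Rightarrow> ('v, 'a) alg \<Rightarrow> bool"
  where "alg_eq L A B \<longleftrightarrow> carrier A = carrier B \<and>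
    (\<forall>s\<in>L. \<forall>as\<in>lists (carrier A). length as = snd s \<longrightarrow> oper A s as = oper B s as)"

definition fm_alg :: "'v sym set \<Rightarrow> 'v set \<Rightarrow> ('v, 'v fm) alg"
  where "fm_alg L X = \<lparr>carrier = Fm L X, oper = App\<rparr>"

definition homs :: "'v sym set \<Rightarrow> ('v, 'a) alg \<Rightarrow> ('v, 'b) alg \<Rightarrow> ('a \<Rightarrow> 'b) set"
  where "homs L A B = {h \<in> carrier A \<rightarrow> carrier B.
    \<forall>s\<in>L. \<forall>as\<in>lists (carrier A). length as = snd s \<longrightarrow> h (oper A s as) = oper B s (map h as)}"

primrec eval :: "('v, 'a) alg \<Rightarrow> ('v \<Rightarrow> 'a) \<Rightarrow> 'v fm \<Rightarrow> 'a" where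
  "eval A v (Var x) = v x"
| "eval A v (App s ts) = oper A s (map (eval A v) ts)"

text \<open>The term function of \<open>t(x\<^sub>1, \<dots>, x\<^sub>n)\<close>: the \<open>j\<close>-th argument is the value of \<open>x\<^sub>j\<close>.\<close>

definition term_fun :: "('v::zfc, 'a) alg \<Rightarrow> 'v fm \<Rightarrow> 'a list \<Rightarrow> 'a"
  where "term_fun A t as = eval A (\<lambda>x. as ! (inv vnat x - 1)) t"


section \<open>Logics and their models\<close>

text \<open>The formulas of a logic have the variables \<open>x\<^sub>\<alpha>\<close> for \<open>\<alpha> < nvars\<close>, where \<open>nvars\<close> is an
  infinite cardinal.\<close>

record 'v logic =
  lang :: "'v sym set"
  nvars :: 'v
  entails :: "'v fm set \<Rightarrow> 'v fm \<Rightarrow> bool"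

definition FmL :: "'v::zfc logic \<Rightarrow> 'v fm set"
  where "FmL l = Fm (lang l) (elts (nvars l))"

definition fmL_alg :: "'v::zfc logic \<Rightarrow> ('v, 'v fm) alg"
  where "fmL_alg l = fm_alg (lang l) (elts (nvars l))"

definition is_logic :: "'v::zfc logic \<Rightarrow> bool"
  where "is_logic l \<longleftrightarrow>
    language (lang l) \<and> Cardinal (nvars l) \<and> infinite (elts (nvars l)) \<and>
    (\<forall>\<Gamma> \<phi>. entails l \<Gamma> \<phi> \<longrightarrow> \<Gamma> \<subseteq> FmL l \<and> \<phi> \<in> FmL l) \<and>
    (\<forall>\<Gamma> \<gamma>. \<Gamma> \<subseteq> FmL l \<and> \<gamma> \<in> \<Gamma> \<longrightarrow> entails l \<Gamma> \<gamma>) \<and>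
    (\<forall>\<Gamma> \<Delta> \<phi>. \<Gamma> \<subseteq> FmL l \<and> (\<forall>\<delta>\<in>\<Delta>. entails l \<Gamma> \<delta>) \<and> entails l \<Delta> \<phi> \<longrightarrow> entails l \<Gamma> \<phi>) \<and>
    (\<forall>\<Gamma> \<phi>. \<forall>\<sigma> \<in> homs (lang l) (fmL_alg l) (fmL_alg l).
       entails l \<Gamma> \<phi> \<longrightarrow> entails l (\<sigma> ` \<Gamma>) (\<sigma> \<phi>))"

type_synonym 'v mtrx = "('v, 'v) alg \<times> 'v set"

definition matrix :: "'v::zfc sym set \<Rightarrow> 'v mtrx \<Rightarrow> bool"
  where "matrix L M \<longleftrightarrow> (case M of (A, F) \<Rightarrow> small (carrier A) \<and> algebra L A \<and> F \<subseteq> carrier A)"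

definition Mod :: "'v::zfc logic \<Rightarrow> 'v mtrx set"
  where "Mod l = {(A, F). matrix (lang l) (A, F) \<and>
    (\<forall>\<Gamma> \<phi>. entails l \<Gamma> \<phi> \<longrightarrow>
      (\<forall>h \<in> homs (lang l) (fmL_alg l) A. h ` \<Gamma> \<subseteq> F \<longrightarrow> h \<phi> \<in> F))}"

definition deductive_filter :: "'v::zfc logic \<Rightarrow> ('v, 'v) alg \<Rightarrow> 'v set \<Rightarrow> bool"
  where "deductive_filter l A F \<longleftrightarrow> (A, F) \<in> Mod l"

definition congruence :: "'v sym set \<Rightarrow> ('v, 'a) alg \<Rightarrow> ('a \<times> 'a) set \<Rightarrow> bool"
  where "congruence L A \<theta> \<longleftrightarrow> equiv (carrier A) \<theta> \<and>
    (\<forall>s\<in>L. \<forall>as bs. length as = snd s \<and> list_all2 (\<lambda>a b. (a, b) \<in> \<theta>) as bs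
       \<longrightarrow> (oper A s as, oper A s bs) \<in> \<theta>)"

definition compatible :: "('a \<times> 'a) set \<Rightarrow> 'a set \<Rightarrow> bool"
  where "compatible \<theta> F \<longleftrightarrow> (\<forall>a b. a \<in> F \<and> (a, b) \<in> \<theta> \<longrightarrow> b \<in> F)"

definition Leibniz :: "'v sym set \<Rightarrow> ('v, 'a) alg \<Rightarrow> 'a set \<Rightarrow> ('a \<times> 'a) set"
  where "Leibniz L A F = (GREATEST \<theta>. congruence L A \<theta> \<and> compatible \<theta> F)"

definition Suszko :: "'v::zfc logic \<Rightarrow> ('v, 'v) alg \<Rightarrow> 'v set \<Rightarrow> ('v \<times> 'v) set"
  where "Suszko l A F = \<Inter> {Leibniz (lang l) A G | G. deductive_filter l A G \<and> F \<subseteq> G}"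

definition Mod_eqv :: "'v::zfc logic \<Rightarrow> 'v mtrx set"
  where "Mod_eqv l = {(A, F) \<in> Mod l. Suszko l A F = Id_on (carrier A)}"

definition induced_logic :: "'v::zfc sym set \<Rightarrow> 'v \<Rightarrow> 'v mtrx set \<Rightarrow> 'v logic"
  where "induced_logic L k M = \<lparr>lang = L, nvars = k,
    entails = (\<lambda>\<Gamma> \<phi>. \<Gamma> \<subseteq> Fm L (elts k) \<and> \<phi> \<in> Fm L (elts k) \<and>
      (\<forall>(A, F) \<in> M. \<forall>h \<in> homs L (fm_alg L (elts k)) A. h ` \<Gamma> \<subseteq> F \<longrightarrow> h \<phi> \<in> F))\<rparr>"


section \<open>Interpretability\<close>

definition translation :: "('v sym \<Rightarrow> 'v fm) \<Rightarrow> 'v::zfc sym set \<Rightarrow> 'v sym set \<Rightarrow> bool"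
  where "translation \<tau> L L' \<longleftrightarrow> (\<forall>s\<in>L. \<tau> s \<in> Fm L' (vars_upto (snd s)))"

definition trans_alg :: "('v::zfc, 'a) alg \<Rightarrow> ('v sym \<Rightarrow> 'v fm) \<Rightarrow> ('v, 'a) alg"
  where "trans_alg A \<tau> = \<lparr>carrier = carrier A, oper = (\<lambda>s. term_fun A (\<tau> s))\<rparr>"

definition interpretation_of :: "('v sym \<Rightarrow> 'v fm) \<Rightarrow> 'v::zfc logic \<Rightarrow> 'v logic \<Rightarrow> bool"
  where "interpretation_of \<tau> l l' \<longleftrightarrow> translation \<tau> (lang l) (lang l') \<and>
    (\<forall>(A, F) \<in> Mod_eqv l'. (trans_alg A \<tau>, F) \<in> Mod_eqv l)"

definition interpretable :: "'v::zfc logic \<Rightarrow> 'v logic \<Rightarrow> bool"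
  where "interpretable l l' \<longleftrightarrow> (\<exists>\<tau>. interpretation_of \<tau> l l')"

definition equi_class :: "'v::zfc logic \<Rightarrow> 'v logic set"
  where "equi_class l = {l'. is_logic l' \<and> interpretable l l' \<and> interpretable l' l}"

definition Log :: "'v::zfc logic set gorder"
  where "Log = \<lparr>carrier = equi_class ` {l. is_logic l}, eq = (=),
    le = (\<lambda>P Q. \<exists>l\<in>P. \<exists>l'\<in>Q. interpretable l l')\<rparr>"

definition set_complete_filter :: "'v::zfc logic set set \<Rightarrow> bool"
  where "set_complete_filter \<F> \<longleftrightarrow> \<F> \<subseteq> carrier Log \<and> \<F> \<noteq> {} \<and>
    (\<forall>P\<in>\<F>. \<forall>Q\<in>carrier Log. P \<sqsubseteq>\<^bsub>Log\<^esub> Q \<longrightarrow> Q \<in> \<F>) \<and>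
    (\<forall>(I :: 'v set) f. small I \<and> f ` I \<subseteq> \<F> \<longrightarrow> (\<exists>P\<in>\<F>. is_glb Log P (f ` I)))"


section \<open>Leibniz classes\<close>

definition Leibniz_condition :: "('v::zfc \<Rightarrow> 'v logic) \<Rightarrow> bool"
  where "Leibniz_condition \<Phi> \<longleftrightarrow> (\<forall>\<alpha>. Ord \<alpha> \<longrightarrow> is_logic (\<Phi> \<alpha>)) \<and>
    (\<forall>\<alpha> \<beta>. Ord \<alpha> \<and> Ord \<beta> \<and> elts \<alpha> \<subseteq> elts \<beta> \<longrightarrow> interpretable (\<Phi> \<beta>) (\<Phi> \<alpha>))"

definition Log_of :: "('v::zfc \<Rightarrow> 'v logic) \<Rightarrow> 'v logic set"
  where "Log_of \<Phi> = {l. is_logic l \<and> (\<exists>\<alpha>. Ord \<alpha> \<and> interpretable (\<Phi> \<alpha>) l)}"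

definition Leibniz_class :: "'v::zfc logic set \<Rightarrow> bool"
  where "Leibniz_class K \<longleftrightarrow> (\<exists>\<Phi>. Leibniz_condition \<Phi> \<and> K = Log_of \<Phi>)"


section \<open>Term-equivalence, compatible expansions, non-indexed products\<close>

definition term_equivalent :: "'v::zfc logic \<Rightarrow> 'v logic \<Rightarrow> bool"
  where "term_equivalent l l' \<longleftrightarrow> (\<exists>\<tau> \<rho>. interpretation_of \<tau> l l' \<and> interpretation_of \<rho> l' l \<and>
    (\<forall>(A, F) \<in> Mod_eqv l. alg_eq (lang l) (trans_alg (trans_alg A \<rho>) \<tau>) A) \<and>
    (\<forall>(B, G) \<in> Mod_eqv l'. alg_eq (lang l') (trans_alg (trans_alg B \<tau>) \<rho>) B))"

definition compatible_expansion :: "'v::zfc logic \<Rightarrow> 'v logic \<Rightarrow> bool"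
  where "compatible_expansion l l' \<longleftrightarrow> lang l \<subseteq> lang l' \<and>
    \<comment> \<open>\<open>(A, F)\<close> on the right is the reduct, see the remark on reducts above\<close>
    (\<forall>(A, F) \<in> Mod_eqv l'. (A, F) \<in> Mod_eqv l)"

text \<open>Terms and sequences of terms are coded as elements of the universe, so that they can serve as
  symbols of a language.\<close>

primrec fm_code :: "'v::zfc fm \<Rightarrow> 'v" where
  "fm_code (Var x) = vpair (vnat 0) x"
| "fm_code (App s ts) =
    vpair (vnat 1) (vpair (fst s) (vpair (vnat (snd s)) (vlist (map fm_code ts))))"

text \<open>The arity component keeps apart the \<open>n\<close>-ary symbols, for different \<open>n\<close>, given by one and the
  same sequence of terms.\<close>

definition prod_lang :: "'v::zfc set \<Rightarrow> ('v \<Rightarrow> 'v sym set) \<Rightarrow> 'v sym set"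
  where "prod_lang I L = {(vlam I (\<lambda>i. fm_code (\<phi> i)), n) | \<phi> n.
    n \<ge> 1 \<and> (\<forall>i\<in>I. \<phi> i \<in> Fm (L i) (vars_upto n))}"

definition vprod :: "'v::zfc set \<Rightarrow> ('v \<Rightarrow> 'v set) \<Rightarrow> 'v set"
  where "vprod I A = {vlam I a | a. \<forall>i\<in>I. a i \<in> A i}"

text \<open>In the second component, \<open>inv fm_code (vapp (fst s) i)\<close> is the \<open>i\<close>-th term \<open>\<phi>\<^sub>i\<close> of the
  sequence \<open>s\<close>.\<close>

definition prod_alg :: "'v::zfc set \<Rightarrow> ('v \<Rightarrow> ('v, 'v) alg) \<Rightarrow> ('v, 'v) alg"
  where "prod_alg I A = \<lparr>carrier = vprod I (\<lambda>i. carrier (A i)),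
    oper = (\<lambda>s as. vlam I (\<lambda>i.
      term_fun (A i) (inv fm_code (vapp (fst s) i)) (map (\<lambda>a. vapp a i) as)))\<rparr>"

definition prod_matrix :: "'v::zfc set \<Rightarrow> ('v \<Rightarrow> 'v mtrx) \<Rightarrow> 'v mtrx"
  where "prod_matrix I M = (prod_alg I (\<lambda>i. fst (M i)), vprod I (\<lambda>i. snd (M i)))"

text \<open>For von Neumann cardinals, suprema and maxima are unions.\<close>

definition prod_nvars :: "'v::zfc set \<Rightarrow> ('v \<Rightarrow> 'v) \<Rightarrow> 'v"
  where "prod_nvars I \<kappa> = vset (elts omega \<union> elts (vcard I) \<union> (\<Union>i\<in>I. elts (\<kappa> i)))"

definition inconsistent_logic :: "'v::zfc logic"
  where "inconsistent_logic = \<lparr>lang = {}, nvars = omega,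
    entails = (\<lambda>\<Gamma> \<phi>. \<Gamma> \<subseteq> Fm {} (elts omega) \<and> \<phi> \<in> Fm {} (elts omega))\<rparr>"

definition nonindexed_product :: "'v::zfc set \<Rightarrow> ('v \<Rightarrow> 'v logic) \<Rightarrow> 'v logic"
  where "nonindexed_product I l =
    (if I = {} then inconsistent_logic
     else induced_logic (prod_lang I (\<lambda>i. lang (l i))) (prod_nvars I (\<lambda>i. nvars (l i)))
       {prod_matrix I M | M. \<forall>i\<in>I. M i \<in> Mod_eqv (l i)})"

definition closed_term_equivalence :: "'v::zfc logic set \<Rightarrow> bool"
  where "closed_term_equivalence K \<longleftrightarrow>
    (\<forall>l\<in>K. \<forall>l'. is_logic l' \<and> term_equivalent l l' \<longrightarrow> l' \<in> K)"

definition closed_compatible_expansions :: "'v::zfc logic set \<Rightarrow> bool"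
  where "closed_compatible_expansions K \<longleftrightarrow>
    (\<forall>l\<in>K. \<forall>l'. is_logic l' \<and> compatible_expansion l l' \<longrightarrow> l' \<in> K)"

definition closed_nonindexed_products :: "'v::zfc logic set \<Rightarrow> bool"
  where "closed_nonindexed_products K \<longleftrightarrow>
    (\<forall>(I :: 'v set) l. small I \<and> l ` I \<subseteq> K \<longrightarrow> nonindexed_product I l \<in> K)"

end

theory Submission
  imports Defs
begin

text \<open>
  All three conditions say the same thing: \<open>K\<close> is closed upwards under interpretability and contains
  an infimum of each set-sized family of its members.

  Upward closure amounts to closure under term-equivalence and compatible expansions, because an
  interpretation \<open>\<tau>\<close> of \<open>l\<close> into \<open>l'\<close> factors through such steps: add to a disjoint copy of the
  language of \<open>l'\<close> the symbols of \<open>l\<close>, to be read as their \<open>\<tau>\<close>-translations.  The resulting logic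
  is a compatible expansion of \<open>l\<close> and term-equivalent to \<open>l'\<close> (\<open>interpretable_imp_expansion\<close>).

  Infima are given by non-indexed products.  The product is a lower bound of its factors, because a
  factor is interpreted in it by filling the other coordinates with trivial matrices
  (\<open>product_lower\<close>).  It is the greatest one, because the Suszko-reduced models of a product still
  decompose along the binary operations that take one coordinate from the first argument and all
  others from the second: each non-empty filter on such a model is an intersection of preimages of
  filters of reduced models of the factors, under homomorphisms onto them (\<open>decomposition\<close>).
  Interpretations into the factors therefore combine to one into the product
  (\<open>product_greatest\<close>).

  Given closure under interpretability and products, a Leibniz condition for \<open>K\<close> maps an ordinal
  \<open>\<alpha>\<close> to the product of the members of \<open>K\<close> that appear in the level \<open>\<alpha>\<close> of the cumulative
  hierarchy (\<open>closed_imp_Leibniz_class\<close>).  Conversely, the members of any subset of a Leibniz class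
  lie above a common \<open>\<Phi> \<alpha>\<close>, where \<open>\<alpha>\<close> is the supremum of the ordinals that witness their
  membership, and hence so does their product (\<open>Leibniz_class_imp_closed\<close>).

  What carries these arguments is a supply of facts about models: Malcev's description of Leibniz
  congruences by polynomials, the Suszko reduction of a model, and the lemma that an identity whose
  instances are interderivable in every context holds in all Suszko-reduced models
  (\<open>Mod_eqv_identity\<close>).
\<close>


section \<open>Sets of the universe\<close>

lemma elts_inj: "elts x = elts y \<longleftrightarrow> x = y"
  using zfc_extensionality by blast

lemma small_elts [simp, intro]: "small (elts x)"
  unfolding small_def by blast

lemma smallI: "elts x = X \<Longrightarrow> small X"
  by blast

lemma elts_vset: "small X \<Longrightarrow> elts (vset X) = X"
  unfolding small_def vset_def by (simp add: f_inv_into_f)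

lemma vset_inj: "small X \<Longrightarrow> small Y \<Longrightarrow> vset X = vset Y \<Longrightarrow> X = Y"
  by (metis elts_vset)

lemma small_subset: "small X \<Longrightarrow> Y \<subseteq> X \<Longrightarrow> small Y"
  unfolding small_def using zfc_separation[of Y] by (auto simp: image_iff eq_commute)

lemma small_image [intro]: "small X \<Longrightarrow> small (f ` (X :: 'v::zfc set) :: 'v set)"
  unfolding small_def using zfc_replacement[of f] by (auto simp: image_iff eq_commute)

lemma small_UN:
  fixes I :: "'v::zfc set" and f :: "'v \<Rightarrow> 'v set"
  assumes "small I" "\<And>i. i \<in> I \<Longrightarrow> small (f i)"
  shows "small (\<Union>i\<in>I. f i)"
proof -
  have "small ((\<lambda>i. vset (f i)) ` I)"
    using assms(1) by blast
  then obtain x where x: "elts x = (\<lambda>i. vset (f i)) ` I"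
    unfolding small_def by (auto simp: image_iff)
  obtain z where "elts z = \<Union> (elts ` elts x)"
    using zfc_union by blast
  then have "elts z = (\<Union>i\<in>I. f i)"
    using x assms(2) by (simp add: elts_vset)
  then show ?thesis
    by (rule smallI)
qed

lemma small_range_nat: "small (range (g :: nat \<Rightarrow> 'v::zfc))"
  using zfc_infinity[of g] smallI by blast

lemma small_empty [simp, intro]: "small {}"
  using small_range_nat small_subset by blast

lemma small_doubleton: "small {a, b}"
proof -
  have "{a, b} \<subseteq> range (\<lambda>n::nat. if n = 0 then a else b)"
    by (auto simp: image_iff intro: exI[of _ "1::nat"])
  then show ?thesis
    using small_range_nat small_subset by blast
qed

lemma small_singleton [simp, intro]: "small {a}"
  using small_doubleton[of a a] by simp

lemma small_Un [intro]: 
  fixes X :: "'v::zfc set"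
  assumes "small X" "small Y" shows "small (X \<union> Y)"
proof -
  have "small (\<Union>z\<in>{vset X, vset Y}. elts z)"
    by (intro small_UN small_doubleton) simp
  then show ?thesis
    using assms by (simp add: elts_vset)
qed

lemma small_insert [simp, intro]: "small X \<Longrightarrow> small (insert a X)"
  using small_Un[of "{a}" X] by simp

lemma small_Pow:
  assumes "small X" shows "small {y. elts y \<subseteq> X}"
  using assms zfc_powerset unfolding small_def by (auto simp: image_iff eq_commute)

lemma small_vset_Pow:
  assumes "small X" shows "small (vset ` Pow X)"
proof -
  have "vset ` Pow X \<subseteq> {y. elts y \<subseteq> X}"
    using assms by (auto simp: elts_vset[OF small_subset[OF assms]])
  then show ?thesis
    using small_Pow[OF assms] small_subset by blast
qed

lemma mem_irrefl: "x \<notin> elts (x :: 'v::zfc)"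
  using wf_not_refl[OF zfc_foundation, of x] by simp

lemma ex_not_in_small: "small X \<Longrightarrow> \<exists>x :: 'v::zfc. x \<notin> X"
  using elts_vset[of X] mem_irrefl[of "vset X"] by auto

lemma vset_doubleton_eq_iff: "vset {a, b} = vset {c, d} \<longleftrightarrow> a = c \<and> b = d \<or> a = d \<and> b = (c :: 'v::zfc)"
proof -
  have "vset {a, b} = vset {c, d} \<longleftrightarrow> {a, b} = {c, d}"
    using vset_inj[OF small_doubleton small_doubleton, of a b c d] by auto
  then show ?thesis by (simp add: doubleton_eq_iff)
qed

lemma vpair_inject [simp]: "vpair a b = vpair c d \<longleftrightarrow> a = c \<and> b = (d :: 'v::zfc)"
proof -
  have "vpair x y = vset {vset {x, x}, vset {x, y}}" for x y :: 'v
    by (simp add: vpair_def)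
  then show ?thesis by (auto simp: vset_doubleton_eq_iff simp del: insert_absorb2)
qed

lemma vpair_nonempty: "vpair a b \<noteq> vset {}"
  unfolding vpair_def using vset_inj[OF small_doubleton small_empty] by blast

lemma small_vpairs: "small X \<Longrightarrow> (\<And>x. x \<in> X \<Longrightarrow> small (Y x)) \<Longrightarrow>
    small {vpair x y | x y. x \<in> X \<and> y \<in> Y x}"
proof -
  assume "small X" "\<And>x. x \<in> X \<Longrightarrow> small (Y x)"
  then have "small (\<Union>x\<in>X. vpair x ` Y x)"
    by (intro small_UN) auto
  moreover have "(\<Union>x\<in>X. vpair x ` Y x) = {vpair x y | x y. x \<in> X \<and> y \<in> Y x}"
    by blast
  ultimately show ?thesis by simp
qed

lemma vapp_vlam: "small I \<Longrightarrow> i \<in> I \<Longrightarrow> vapp (vlam I f) i = f i"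
  unfolding vapp_def vlam_def by (subst elts_vset) (auto intro!: the_equality)

lemma vlam_cong: "(\<And>i. i \<in> I \<Longrightarrow> f i = g i) \<Longrightarrow> vlam I f = vlam I g"
  unfolding vlam_def by (metis (mono_tags, lifting) image_cong)

lemma vlam_eq_iff: "small I \<Longrightarrow> vlam I f = vlam I g \<longleftrightarrow> (\<forall>i\<in>I. f i = g i)"
  by (metis vapp_vlam vlam_cong)

lemma vprod_eqI:
  assumes "small I" "x \<in> vprod I A" "y \<in> vprod I A" "\<And>i. i \<in> I \<Longrightarrow> vapp x i = vapp y i"
  shows "x = y"
  using assms unfolding vprod_def by (auto simp: vapp_vlam vlam_eq_iff)

lemma vlam_in_vprod: "small I \<Longrightarrow> vlam I a \<in> vprod I A \<longleftrightarrow> (\<forall>i\<in>I. a i \<in> A i)"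
  unfolding vprod_def by (auto simp: vlam_eq_iff)

lemma vapp_in: "small I \<Longrightarrow> x \<in> vprod I A \<Longrightarrow> i \<in> I \<Longrightarrow> vapp x i \<in> A i"
  unfolding vprod_def by (auto simp: vapp_vlam)

lemma vprod_iff:
  assumes "small I" "x \<in> vprod I B"
  shows "x \<in> vprod I H \<longleftrightarrow> (\<forall>k\<in>I. vapp x k \<in> H k)"
  using assms(2) unfolding vprod_def by (auto simp: vapp_vlam[OF assms(1)])

text \<open>A family is coded by the set of its pairs, so all families with entries in given sets lie in one
  power set.\<close>

lemma small_vprod:
  assumes "small I" "\<And>i. i \<in> I \<Longrightarrow> small (A i)"
  shows "small (vprod I A)"
proof -
  have "vprod I A \<subseteq> vset ` Pow {vpair i y | i y. i \<in> I \<and> y \<in> A i}"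
    unfolding vprod_def vlam_def by auto
  then show ?thesis
    using small_vset_Pow[OF small_vpairs[of I A]] assms small_subset by blast
qed


section \<open>Ordinals and cardinals\<close>

lemma elts_vnat_0 [simp]: "elts (vnat 0) = {}"
  by (simp add: elts_vset)

lemma elts_vnat_Suc [simp]: "elts (vnat (Suc n)) = insert (vnat n) (elts (vnat n))"
  by (simp add: elts_vset)

declare vnat.simps [simp del]

lemma elts_vnat: "elts (vnat n) = vnat ` {..<n}"
  by (induction n) (auto simp: lessThan_Suc)

lemma inj_vnat: "inj (vnat :: nat \<Rightarrow> 'v::zfc)"
proof (rule linorder_inj_onI)
  fix m n :: nat assume "m < n"
  then have "vnat m \<in> elts (vnat n :: 'v)"
    by (auto simp: elts_vnat)
  then show "(vnat m :: 'v) \<noteq> vnat n"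
    using mem_irrefl by metis
qed auto

lemma inv_vnat [simp]: "inv vnat (vnat n) = n"
  by (simp add: inj_vnat)

lemma vnat_eq_iff [simp]: "vnat m = (vnat n :: 'v::zfc) \<longleftrightarrow> m = n"
  using inj_vnat by (auto dest: injD)

lemma elts_omega: "elts omega = range vnat"
  unfolding omega_def by (simp add: elts_vset small_range_nat)

lemma Ord_mem: "Ord a \<Longrightarrow> x \<in> elts a \<Longrightarrow> Ord x"
  unfolding Ord_def by blast

lemma Ord_mem_subset: "Ord a \<Longrightarrow> x \<in> elts a \<Longrightarrow> elts x \<subseteq> elts a"
  unfolding Ord_def by blast

lemma OrdI: "(\<And>x. x \<in> elts a \<Longrightarrow> Ord x) \<Longrightarrow> (\<And>x. x \<in> elts a \<Longrightarrow> elts x \<subseteq> elts a) \<Longrightarrow> Ord a"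
  unfolding Ord_def by blast

lemma Ord_vnat: "Ord (vnat n)"
  unfolding Ord_def by (auto simp: elts_vnat)

lemma Ord_omega: "Ord omega"
  by (rule OrdI) (auto simp: elts_omega Ord_vnat elts_vnat)

lemma Ord_union:
  fixes X :: "'v::zfc set" and f :: "'v \<Rightarrow> 'v"
  assumes "small X" "\<And>x. x \<in> X \<Longrightarrow> Ord (f x)"
  shows "Ord (vset (\<Union>x\<in>X. elts (f x)))" "elts (vset (\<Union>x\<in>X. elts (f x))) = (\<Union>x\<in>X. elts (f x))"
proof -
  show e: "elts (vset (\<Union>x\<in>X. elts (f x))) = (\<Union>x\<in>X. elts (f x))"
    by (intro elts_vset small_UN assms(1)) simp
  show "Ord (vset (\<Union>x\<in>X. elts (f x)))"
    by (rule OrdI) (use assms(2) Ord_mem Ord_mem_subset e in fastforce)+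
qed

lemma Ord_succ:
  assumes "Ord a" shows "Ord (vset (insert a (elts a)))"
  by (rule OrdI) (use assms Ord_mem[OF assms] Ord_mem_subset[OF assms] in \<open>auto simp: elts_vset\<close>)

lemma wf_mem: "wf {(x, y :: 'v::zfc). x \<in> elts y}"
  by (rule zfc_foundation)

lemma mem_minimal:
  assumes "P (a :: 'v::zfc)"
  obtains m where "P m" "\<And>y. y \<in> elts m \<Longrightarrow> \<not> P y"
  using wfE_min[OF wf_mem, of a "{x. P x}"] assms by auto

text \<open>The induction is on both ordinals.  If all elements of \<open>a\<close> are comparable to \<open>b\<close>, and \<open>a\<close> to all
  elements of \<open>b\<close>, then either one of \<open>a\<close> and \<open>b\<close> is an element of the other, or they have the same
  elements.\<close>

lemma Ord_linear:
  assumes "Ord a" "Ord b"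
  shows "a \<in> elts b \<or> a = b \<or> b \<in> elts (a :: 'v::zfc)"
  using wf_mem assms
proof (induction a arbitrary: b rule: wf_induct_rule)
  case (less a)
  note IHa = less.IH and Oa = less.prems(1)
  show ?case
    using wf_mem less.prems(2)
  proof (induction b rule: wf_induct_rule)
    case (less b)
    show ?case
    proof (rule ccontr)
      assume n: "\<not> ?case"
      have "x \<in> elts b" if "x \<in> elts a" for x
        using IHa[of x b] that Oa less.prems n Ord_mem Ord_mem_subset by blast
      moreover have "y \<in> elts a" if "y \<in> elts b" for y
        using less.IH[of y] that less.prems n Ord_mem Ord_mem_subset by blast
      ultimately have "elts a = elts b" by blast
      then show False using n by (simp add: elts_inj)
    qed
  qed
qed

text \<open>The Mostowski collapse of a well-order of \<open>X\<close> is an ordinal of the size of \<open>X\<close>.\<close>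

lemma ex_Ord_eqpoll:
  assumes "small (X :: 'v::zfc set)"
  shows "\<exists>a :: 'v. Ord a \<and> elts a \<approx> X"
proof -
  obtain r where r: "well_order_on X r"
    using well_order_on by blast
  define s where "s = r - Id"
  have wfs: "wf s" and tot: "total_on X s" and tr: "trans r" and an: "antisym r"
    using r unfolding s_def well_order_on_def linear_order_on_def partial_order_on_def preorder_on_def
    by (auto simp: total_on_def)
  have sX: "s \<subseteq> X \<times> X"
    using r unfolding s_def well_order_on_def linear_order_on_def partial_order_on_def preorder_on_def
    by auto
  have trs: "trans s"
    using tr an unfolding s_def by (rule trans_diff_Id)
  define c :: "'v \<Rightarrow> 'v" where "c = wfrec s (\<lambda>f x. vset (f ` {y. (y, x) \<in> s}))"
  have sm: "small {y. (y, x) \<in> s}" for x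
    by (rule small_subset[OF assms]) (use sX in auto)
  have c: "elts (c x) = c ` {y. (y, x) \<in> s}" for x
  proof -
    have "c x = vset (cut c s x ` {y. (y, x) \<in> s})"
      unfolding c_def by (subst wfrec[OF wfs]) simp
    moreover have "cut c s x ` {y. (y, x) \<in> s} = c ` {y. (y, x) \<in> s}"
      by (rule image_cong) (auto simp: cut_def)
    ultimately show ?thesis by (simp add: elts_vset[OF small_image[OF sm]])
  qed
  have sub: "elts z \<subseteq> elts (c x)" if "z \<in> elts (c x)" for z x
    using that transD[OF trs] by (fastforce simp: c)
  have O: "Ord (c x)" for x
    using wfs
  proof (induction x rule: wf_induct_rule)
    case (less x)
    show ?case by (rule OrdI) (use less sub in \<open>auto simp: c\<close>)
  qed
  have inj: "inj_on c X"
  proof (rule inj_onI, rule ccontr)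
    fix x y assume xy: "x \<in> X" "y \<in> X" "c x = c y" "x \<noteq> y"
    then have "(x, y) \<in> s \<or> (y, x) \<in> s" using tot by (auto simp: total_on_def)
    then have "c x \<in> elts (c y) \<or> c y \<in> elts (c x)" by (auto simp: c)
    then show False using xy(3) mem_irrefl by metis
  qed
  let ?a = "vset (c ` X)"
  have e: "elts ?a = c ` X" using assms elts_vset by blast
  have "Ord ?a" by (rule OrdI) (use O sX in \<open>fastforce simp: e c\<close>)+
  moreover have "elts ?a \<approx> X" unfolding e using inj by (simp add: inj_on_image_eqpoll_self)
  ultimately show ?thesis by blast
qed

lemma Cardinal_unique:
  assumes "Cardinal k" "Cardinal k'" "elts k \<approx> elts k'"
  shows "k = k'"
  using assms Ord_linear[of k k'] eqpoll_sym
  unfolding Cardinal_def lesspoll_def by blast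

text \<open>A well-order of \<open>X\<close> yields an ordinal of its size, and an \<open>\<in>\<close>-minimal such ordinal is a
  cardinal.  Comparability of ordinals makes it unique, so that the description in the definition of
  \<open>vcard\<close> denotes it.\<close>

lemma Cardinal_vcard:
  assumes "small (X :: 'v::zfc set)"
  shows "Cardinal (vcard X)" 
proof -
  obtain a :: 'v where "Ord a \<and> elts a \<approx> X" using ex_Ord_eqpoll[OF assms] by blast
  then obtain k :: 'v where k: "Ord k \<and> elts k \<approx> X" "\<And>y. y \<in> elts k \<Longrightarrow> \<not> (Ord y \<and> elts y \<approx> X)"
    using mem_minimal[of "\<lambda>a. Ord a \<and> elts a \<approx> X" a] by metis
  have "Cardinal k" unfolding Cardinal_def
  proof (intro conjI ballI)
    show "Ord k" using k by simp
    fix a assume a: "a \<in> elts k"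
    then have "Ord a" "elts a \<subseteq> elts k" using k Ord_mem Ord_mem_subset by blast+
    then have "elts a \<lesssim> elts k" by (simp add: subset_imp_lepoll)
    moreover have "\<not> elts a \<approx> elts k" using k a \<open>Ord a\<close> eqpoll_trans by blast
    ultimately show "elts a \<prec> elts k" by (simp add: lesspoll_def)
  qed
  then have "\<exists>!k :: 'v. Cardinal k \<and> elts k \<approx> X"
    using k Cardinal_unique eqpoll_trans eqpoll_sym by blast
  then show ?thesis unfolding vcard_def by (metis (mono_tags, lifting) theI')
qed

lemma infinite_omega: "infinite (elts (omega :: 'v::zfc))"
  by (simp add: elts_omega inj_vnat range_inj_infinite)

lemma Cardinal_omega: "Cardinal (omega :: 'v::zfc)"
  unfolding Cardinal_def
proof (intro conjI ballI)
  show "Ord (omega :: 'v)" by (rule Ord_omega)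
  fix a :: 'v assume "a \<in> elts omega"
  then have "finite (elts a)" by (auto simp: elts_omega elts_vnat)
  then show "elts a \<prec> elts (omega :: 'v)"
    by (rule finite_lesspoll_infinite[OF infinite_omega])
qed

lemma Cardinal_union:
  assumes "small X" "\<And>k. k \<in> X \<Longrightarrow> Cardinal k"
  shows "Cardinal (vset (\<Union>k\<in>X. elts k))"
proof -
  have O: "Ord (vset (\<Union>k\<in>X. elts k))" and e: "elts (vset (\<Union>k\<in>X. elts k)) = (\<Union>k\<in>X. elts k)"
    using Ord_union[of X "\<lambda>k. k"] assms unfolding Cardinal_def by auto
  show ?thesis unfolding Cardinal_def e
  proof (intro conjI ballI O)
    fix a assume "a \<in> (\<Union>k\<in>X. elts k)"
    then obtain k where k: "k \<in> X" "a \<in> elts k" by blast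
    then have "elts a \<prec> elts k" using assms(2) unfolding Cardinal_def by blast
    moreover have "elts k \<lesssim> (\<Union>k\<in>X. elts k)" by (rule subset_imp_lepoll) (use k in blast)
    ultimately show "elts a \<prec> (\<Union>k\<in>X. elts k)" by (rule lesspoll_trans2)
  qed
qed

lemma prod_nvars:
  assumes "small I" "\<And>i. i \<in> I \<Longrightarrow> Cardinal (\<kappa> i)"
  shows Cardinal_prod_nvars: "Cardinal (prod_nvars I \<kappa>)"
    and infinite_prod_nvars: "infinite (elts (prod_nvars I \<kappa>))"
    and prod_nvars_ge: "i \<in> I \<Longrightarrow> elts (\<kappa> i) \<subseteq> elts (prod_nvars I \<kappa>)"
proof -
  let ?X = "insert omega (insert (vcard I) (\<kappa> ` I))"
  have sm: "small ?X" using assms by blast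
  have eq: "prod_nvars I \<kappa> = vset (\<Union>k\<in>?X. elts k)"
    unfolding prod_nvars_def by (simp add: Un_assoc)
  show "Cardinal (prod_nvars I \<kappa>)" unfolding eq
    by (rule Cardinal_union[OF sm]) (use assms Cardinal_omega Cardinal_vcard in auto)
  have e: "elts (prod_nvars I \<kappa>) = (\<Union>k\<in>?X. elts k)" unfolding eq
    by (rule elts_vset, rule small_UN[OF sm]) simp
  show "infinite (elts (prod_nvars I \<kappa>))"
    unfolding e using infinite_omega by auto
  show "i \<in> I \<Longrightarrow> elts (\<kappa> i) \<subseteq> elts (prod_nvars I \<kappa>)"
    unfolding e by auto
qed


section \<open>The cumulative hierarchy\<close>

text \<open>The levels of the von Neumann hierarchy.\<close>

definition stage :: "'v::zfc \<Rightarrow> 'v set"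
  where "stage = wfrec {(x, y). x \<in> elts y} (\<lambda>f a. \<Union>b\<in>elts a. {x. elts x \<subseteq> f b})"

lemma stage: "stage a = (\<Union>b\<in>elts a. {x. elts x \<subseteq> stage b})"
  unfolding stage_def by (subst wfrec[OF wf_mem]) (auto simp: cut_def)

lemma small_stage: "small (stage a)"
  using wf_mem
proof (induction a rule: wf_induct_rule)
  case (less a)
  then show ?case by (subst stage) (auto intro!: small_UN small_Pow)
qed

lemma stage_mono: "elts a \<subseteq> elts b \<Longrightarrow> stage a \<subseteq> stage b"
  by (subst (1 2) stage) blast

lemma ex_stage: "\<exists>a. Ord a \<and> x \<in> stage (a :: 'v::zfc)"
  using wf_mem
proof (induction x rule: wf_induct_rule)
  case (less x)
  then have "\<exists>a. Ord a \<and> y \<in> stage a" if "y \<in> elts x" for y using that by simp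
  then obtain f where f: "\<And>y. y \<in> elts x \<Longrightarrow> Ord (f y) \<and> y \<in> stage (f y)" by metis
  define a where "a = vset (\<Union>y\<in>elts x. elts (f y))"
  have a: "Ord a" "elts a = (\<Union>y\<in>elts x. elts (f y))"
    unfolding a_def using Ord_union[of "elts x" f] f by auto
  have "elts x \<subseteq> stage a"
  proof
    fix y assume y: "y \<in> elts x"
    then have "stage (f y) \<subseteq> stage a" using a by (intro stage_mono) auto
    then show "y \<in> stage a" using f[OF y] by blast
  qed
  then have "x \<in> stage (vset (insert a (elts a)))"
    by (subst stage) (auto simp: elts_vset)
  then show ?case using Ord_succ a by blast
qed


section \<open>Codes of formulas\<close>

text \<open>Codes of formulas and lists are iterated pairs.  They therefore stay in the closure under pairing of
  the set of their ingredients, which is a set because it is reached in \<open>\<omega>\<close> steps.\<close>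

lemma ex_vpair_closed:
  assumes "small (X :: 'v::zfc set)"
  obtains W where "small W" "X \<subseteq> W" "\<And>x y. x \<in> W \<Longrightarrow> y \<in> W \<Longrightarrow> vpair x y \<in> W"
proof -
  define P where "P = rec_nat X (\<lambda>_ Y. Y \<union> {vpair x y | x y. x \<in> Y \<and> y \<in> Y})"
  have P0: "P 0 = X" and PS: "P (Suc n) = P n \<union> {vpair x y | x y. x \<in> P n \<and> y \<in> P n}" for n
    by (simp_all add: P_def)
  have sm: "small (P n)" for n
  proof (induction n)
    case (Suc n)
    then show ?case unfolding PS by (intro small_Un small_vpairs)
  qed (simp add: P0 assms)
  have mono: "m \<le> n \<Longrightarrow> P m \<subseteq> P n" for m n
    by (rule lift_Suc_mono_le[of P]) (auto simp: PS)
  show thesis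
  proof
    have "small (\<Union>x\<in>elts (omega :: 'v). P (inv vnat x))"
      by (intro small_UN sm) simp
    then show "small (\<Union>n. P n)"
      by (simp add: elts_omega)
    show "X \<subseteq> (\<Union>n. P n)"
      using P0 by blast
    fix x y assume "x \<in> (\<Union>n. P n)" "y \<in> (\<Union>n. P n)"
    then obtain m n where mn: "x \<in> P m" "y \<in> P n" by blast
    then have "x \<in> P (max m n)" "y \<in> P (max m n)"
      using mono[of m "max m n"] mono[of n "max m n"] by auto
    then have "vpair x y \<in> P (Suc (max m n))" by (auto simp: PS)
    then show "vpair x y \<in> (\<Union>n. P n)" by blast
  qed
qed

lemma vlist_inject: "vlist xs = vlist ys \<Longrightarrow> xs = (ys :: 'v::zfc list)"
proof (induction xs arbitrary: ys)
  case Nil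
  then show ?case by (cases ys) (auto simp: vpair_nonempty dest: sym)
next
  case (Cons x xs)
  then show ?case by (cases ys) (auto simp: vpair_nonempty)
qed

lemma fm_code_inject: "fm_code \<phi> = fm_code \<psi> \<Longrightarrow> \<phi> = (\<psi> :: 'v::zfc fm)"
proof (induction \<phi> arbitrary: \<psi>)
  case (Var x)
  then show ?case by (cases \<psi>) auto
next
  case (App s ts)
  show ?case
  proof (cases \<psi>)
    case (Var x)
    then show ?thesis using App.prems by auto
  next
    case (App s' ts')
    then have "s = s'" "vlist (map fm_code ts) = vlist (map fm_code ts')"
      using App.prems by (auto simp: prod_eq_iff)
    moreover have "map fm_code ts = map fm_code us \<Longrightarrow> ts = us" for us
      using App.IH
    proof (induction ts arbitrary: us)
      case (Cons t ts)
      then show ?case by (cases us) auto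
    qed simp
    ultimately show ?thesis using App vlist_inject by blast
  qed
qed

lemma inj_fm_code: "inj fm_code"
  by (rule injI) (rule fm_code_inject)

lemma inv_fm_code [simp]: "inv fm_code (fm_code \<phi>) = \<phi>"
  by (simp add: inj_fm_code)

lemma Fm_mono: "t \<in> Fm L X \<Longrightarrow> L \<subseteq> L' \<Longrightarrow> X \<subseteq> X' \<Longrightarrow> t \<in> Fm L' X'"
  by (induction rule: Fm.induct) (auto intro!: Fm.intros)

lemma small_Fm:
  assumes "small (fst ` L)" "small (X :: 'v::zfc set)"
  shows "small (fm_code ` Fm L X)"
proof -
  have "small (elts omega \<union> (X \<union> fst ` L))"
    using assms by (intro small_Un) simp_all
  then obtain W where W: "small W" "elts omega \<union> (X \<union> fst ` L) \<subseteq> W"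
    "\<And>x y. x \<in> W \<Longrightarrow> y \<in> W \<Longrightarrow> vpair x y \<in> W"
    by (rule ex_vpair_closed) blast
  have nat: "vnat n \<in> W" for n
    using W(2) by (auto simp: elts_omega)
  have list: "set xs \<subseteq> W \<Longrightarrow> vlist xs \<in> W" for xs
    by (induction xs) (use W(3) nat[of 0] in \<open>auto simp: vnat.simps\<close>)
  have "fm_code t \<in> W" if "t \<in> Fm L X" for t
    using that
  proof (induction rule: Fm.induct)
    case (App s ts)
    then have "vlist (map fm_code ts) \<in> W" by (intro list) auto
    moreover have "fst s \<in> W" using App.hyps(1) W(2) by auto
    ultimately show ?case by (auto intro!: W(3) nat)
  qed (use W nat in auto)
  then show ?thesis using small_subset[OF W(1)] by blast
qed


section \<open>Terms and translations\<close>

text \<open>The valuation behind \<open>term_fun\<close>: it sends \<open>x\<^sub>j\<close>, coded by \<open>vnat j\<close>, to the \<open>j\<close>-th entry, where entries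
  are counted from \<open>0\<close>.\<close>

definition arg :: "'a list \<Rightarrow> 'v::zfc \<Rightarrow> 'a"
  where "arg as x = as ! (inv vnat x - 1)"

lemma term_fun_eq: "term_fun A t as = eval A (arg as) t"
  by (simp add: term_fun_def arg_def[abs_def])

lemma arg_in: "x \<in> vars_upto n \<Longrightarrow> length as = n \<Longrightarrow> arg as x \<in> set as"
  by (auto simp: vars_upto_def arg_def)

lemma arg_map: "x \<in> vars_upto n \<Longrightarrow> length as = n \<Longrightarrow> arg (map f as) x = f (arg as x)"
  by (auto simp: vars_upto_def arg_def)

lemma arg_vnat [simp]: "arg as (vnat n) = as ! (n - 1)"
  by (simp add: arg_def)

primrec subst :: "('v \<Rightarrow> 'v fm) \<Rightarrow> 'v fm \<Rightarrow> 'v fm" where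
  "subst \<sigma> (Var x) = \<sigma> x"
| "subst \<sigma> (App s ts) = App s (map (subst \<sigma>) ts)"

primrec vars :: "'v fm \<Rightarrow> 'v set" where
  "vars (Var x) = {x}"
| "vars (App s ts) = \<Union> (set (map vars ts))"

text \<open>The extension of a translation from symbols to formulas.  It is made so that the value of \<open>tr \<tau> t\<close>
  in \<open>A\<close> is the value of \<open>t\<close> in \<open>trans_alg A \<tau>\<close>.\<close>

primrec tr :: "('v sym \<Rightarrow> 'v fm) \<Rightarrow> 'v::zfc fm \<Rightarrow> 'v fm" where
  "tr \<tau> (Var x) = Var x"
| "tr \<tau> (App s ts) = subst (arg (map (tr \<tau>) ts)) (\<tau> s)"

lemma fm_alg_simps [simp]: "carrier (fm_alg L X) = Fm L X" "oper (fm_alg L X) = App"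
  by (simp_all add: fm_alg_def)

lemma trans_alg_simps [simp]:
  "carrier (trans_alg A \<tau>) = carrier A" "oper (trans_alg A \<tau>) s = term_fun A (\<tau> s)"
  by (simp_all add: trans_alg_def)

lemma Fm_App_iff: "App s ts \<in> Fm L X \<longleftrightarrow> s \<in> L \<and> length ts = snd s \<and> set ts \<subseteq> Fm L X"
  by (subst Fm.simps) auto

lemma Fm_Var_iff [simp]: "Var x \<in> Fm L X \<longleftrightarrow> x \<in> X"
  by (subst Fm.simps) auto

lemma finite_vars: "finite (vars t)"
  by (induction t) auto

lemma Fm_vars: "t \<in> Fm L X \<Longrightarrow> vars t \<subseteq> X \<and> t \<in> Fm L (vars t)"
  by (induction t) (auto simp: Fm_App_iff intro: Fm_mono)

lemma subst_eq_eval: "eval (fm_alg L X) \<sigma> t = subst \<sigma> t"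
  by (induction t) auto

lemma algebra_oper:
  "algebra L A \<Longrightarrow> s \<in> L \<Longrightarrow> length as = snd s \<Longrightarrow> set as \<subseteq> carrier A \<Longrightarrow> oper A s as \<in> carrier A"
  unfolding algebra_def by (auto simp: lists_eq_set)

lemma homs_oper:
  "h \<in> homs L A B \<Longrightarrow> s \<in> L \<Longrightarrow> length as = snd s \<Longrightarrow> set as \<subseteq> carrier A \<Longrightarrow>
    h (oper A s as) = oper B s (map h as)"
  unfolding homs_def by (auto simp: lists_eq_set)

lemma homs_in: "h \<in> homs L A B \<Longrightarrow> a \<in> carrier A \<Longrightarrow> h a \<in> carrier B"
  unfolding homs_def by auto

lemma homsI:
  assumes "\<And>a. a \<in> carrier A \<Longrightarrow> h a \<in> carrier B"
    and "\<And>s as. s \<in> L \<Longrightarrow> length as = snd s \<Longrightarrow> set as \<subseteq> carrier A \<Longrightarrow>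
      h (oper A s as) = oper B s (map h as)"
  shows "h \<in> homs L A B"
  using assms unfolding homs_def by (auto simp: lists_eq_set)

lemma algebraI:
  assumes "carrier A \<noteq> {}"
    and "\<And>s as. s \<in> L \<Longrightarrow> length as = snd s \<Longrightarrow> set as \<subseteq> carrier A \<Longrightarrow> oper A s as \<in> carrier A"
  shows "algebra L A"
  using assms unfolding algebra_def by (auto simp: lists_eq_set)

lemma eval_cong_vars: "(\<And>x. x \<in> vars t \<Longrightarrow> v x = w x) \<Longrightarrow> eval A v t = eval A w t"
  by (induction t) (auto intro!: arg_cong[of _ _ "oper A _"] map_cong)

lemma eval_cong: "t \<in> Fm L X \<Longrightarrow> (\<And>x. x \<in> X \<Longrightarrow> v x = w x) \<Longrightarrow> eval A v t = eval A w t"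
  using Fm_vars by (blast intro: eval_cong_vars)

lemma subst_cong: "t \<in> Fm L X \<Longrightarrow> (\<And>x. x \<in> X \<Longrightarrow> \<sigma> x = \<rho> x) \<Longrightarrow> subst \<sigma> t = subst \<rho> t"
  using eval_cong[of t L X \<sigma> \<rho> "fm_alg {} {}"] by (simp add: subst_eq_eval)

lemma eval_closed:
  assumes "t \<in> Fm L X" "algebra L A" "\<And>x. x \<in> X \<Longrightarrow> v x \<in> carrier A"
  shows "eval A v t \<in> carrier A"
  using assms(1) by induction (use assms in \<open>auto intro!: algebra_oper\<close>)

lemma eval_subst: "eval A v (subst \<sigma> t) = eval A (\<lambda>x. eval A v (\<sigma> x)) t"
  by (induction t) (auto intro!: arg_cong[of _ _ "oper A _"])

lemma subst_subst: "subst \<sigma> (subst \<rho> t) = subst (\<lambda>x. subst \<sigma> (\<rho> x)) t"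
  by (induction t) auto

lemma subst_closed: "t \<in> Fm L X \<Longrightarrow> (\<And>x. x \<in> X \<Longrightarrow> \<sigma> x \<in> Fm L Y) \<Longrightarrow> subst \<sigma> t \<in> Fm L Y"
  by (induction rule: Fm.induct) (auto simp: Fm_App_iff)

lemma context_closed:
  assumes "t \<in> Fm L X" "\<And>y. \<delta> y \<in> Fm L Y" "\<And>y. \<gamma> y \<in> Fm L Y" "\<chi> \<in> Fm L Z"
  shows "subst (\<gamma>(z := subst \<delta> t)) \<chi> \<in> Fm L Y"
proof -
  have "subst \<delta> t \<in> Fm L Y" by (rule subst_closed[OF assms(1,2)])
  then show ?thesis using assms(3) by (intro subst_closed[OF assms(4)]) simp
qed

lemma hom_eval:
  assumes "t \<in> Fm L X" "h \<in> homs L A B" "algebra L A" "\<And>x. x \<in> X \<Longrightarrow> v x \<in> carrier A"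
  shows "h (eval A v t) = eval B (\<lambda>x. h (v x)) t"
  using assms(1)
proof induction
  case (App s ts)
  have "set (map (eval A v) ts) \<subseteq> carrier A"
    using App assms eval_closed by fastforce
  then have "h (oper A s (map (eval A v) ts)) = oper B s (map h (map (eval A v) ts))"
    using App assms(2) by (intro homs_oper) auto
  also have "map h (map (eval A v) ts) = map (eval B (\<lambda>x. h (v x))) ts"
    using App.IH by auto
  finally show ?case by simp
qed simp

lemma eval_in_homs:
  assumes "algebra L A" "\<And>x. x \<in> X \<Longrightarrow> v x \<in> carrier A"
  shows "eval A v \<in> homs L (fm_alg L X) A"
  using assms by (intro homsI) (auto intro: eval_closed)

lemma hom_fm_eq_eval:
  assumes "h \<in> homs L (fm_alg L X) A" "t \<in> Fm L X"
  shows "h t = eval A (\<lambda>x. h (Var x)) t"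
  using assms(2)
proof induction
  case (App s ts)
  then show ?case
    using homs_oper[OF assms(1), of s ts] by (auto intro!: arg_cong[of _ _ "oper A _"] simp: subset_iff)
qed simp

lemma alg_eq_eval:
  assumes "t \<in> Fm L X" "alg_eq L A B" "algebra L A" "\<And>x. x \<in> X \<Longrightarrow> v x \<in> carrier A"
  shows "eval B v t = eval A v t"
proof -
  have "id \<in> homs L A B"
    using assms(2) by (intro homsI) (auto simp: alg_eq_def lists_eq_set)
  then show ?thesis
    using hom_eval[OF assms(1) _ assms(3,4), where h = id] by simp
qed

lemma homs_alg_eq:
  assumes "h \<in> homs L A B" "alg_eq L B C"
  shows "h \<in> homs L A C"
proof (rule homsI)
  show "h a \<in> carrier C" if "a \<in> carrier A" for a
    using homs_in[OF assms(1) that] assms(2) by (simp add: alg_eq_def)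
  fix s as assume s: "s \<in> L" "length as = snd s" "set as \<subseteq> carrier A"
  have "set (map h as) \<subseteq> carrier B" using s(3) homs_in[OF assms(1)] by auto
  then have "oper B s (map h as) = oper C s (map h as)"
    using assms(2) s unfolding alg_eq_def lists_eq_set by simp
  then show "h (oper A s as) = oper C s (map h as)" using homs_oper[OF assms(1) s] by simp
qed

lemma translation_Fm: "translation \<tau> L L' \<Longrightarrow> s \<in> L \<Longrightarrow> \<tau> s \<in> Fm L' (vars_upto (snd s))"
  unfolding translation_def by blast

lemma eval_arg_map:
  assumes "t \<in> Fm L (vars_upto n)" "length as = n"
  shows "eval A (arg (map f as)) t = eval A (\<lambda>x. f (arg as x)) t"
  by (rule eval_cong[OF assms(1)]) (simp add: arg_map[OF _ assms(2)])

lemma eval_tr: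
  assumes "translation \<tau> L L'" "t \<in> Fm L X"
  shows "eval A v (tr \<tau> t) = eval (trans_alg A \<tau>) v t"
  using assms(2)
proof induction
  case (App s ts)
  have "eval A v (tr \<tau> (App s ts)) = eval A (\<lambda>x. eval A v (arg (map (tr \<tau>) ts) x)) (\<tau> s)"
    by (simp add: eval_subst)
  also have "\<dots> = eval A (arg (map (eval A v) (map (tr \<tau>) ts))) (\<tau> s)"
    using App by (intro eval_arg_map[OF translation_Fm[OF assms(1) App.hyps(1)], symmetric]) simp
  also have "map (eval A v) (map (tr \<tau>) ts) = map (eval (trans_alg A \<tau>) v) ts"
    using App.IH by auto
  finally show ?case by (simp add: term_fun_eq)
qed simp

lemma tr_closed:
  assumes "translation \<tau> L L'" "t \<in> Fm L X"
  shows "tr \<tau> t \<in> Fm L' X"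
  using assms(2)
proof induction
  case (App s ts)
  have "arg (map (tr \<tau>) ts) x \<in> Fm L' X" if "x \<in> vars_upto (snd s)" for x
    using arg_in[OF that, of "map (tr \<tau>) ts"] App by auto
  then show ?case
    using subst_closed[OF translation_Fm[OF assms(1) App.hyps(1)]] by auto
qed simp

lemma tr_subst:
  assumes "translation \<tau> L L'" "t \<in> Fm L X"
  shows "tr \<tau> (subst \<sigma> t) = subst (\<lambda>x. tr \<tau> (\<sigma> x)) (tr \<tau> t)"
  using assms(2)
proof induction
  case (App s ts)
  have *: "map (tr \<tau>) (map (subst \<sigma>) ts) = map (subst (\<lambda>x. tr \<tau> (\<sigma> x))) (map (tr \<tau>) ts)"
    using App.IH by auto
  have "tr \<tau> (subst \<sigma> (App s ts)) = subst (arg (map (tr \<tau>) (map (subst \<sigma>) ts))) (\<tau> s)"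
    by simp
  also have "\<dots> = subst (\<lambda>x. subst (\<lambda>x. tr \<tau> (\<sigma> x)) (arg (map (tr \<tau>) ts) x)) (\<tau> s)"
    unfolding *
  proof (rule subst_cong[OF translation_Fm[OF assms(1) App.hyps(1)]])
    show "arg (map (subst (\<lambda>x. tr \<tau> (\<sigma> x))) (map (tr \<tau>) ts)) x
        = subst (\<lambda>x. tr \<tau> (\<sigma> x)) (arg (map (tr \<tau>) ts) x)" if "x \<in> vars_upto (snd s)" for x
      by (rule arg_map[OF that]) (simp add: App.hyps)
  qed
  finally show ?case by (simp add: subst_subst)
qed simp

lemma term_fun_closed:
  assumes "t \<in> Fm L (vars_upto n)" "algebra L A" "length as = n" "set as \<subseteq> carrier A"
  shows "term_fun A t as \<in> carrier A"
  unfolding term_fun_eq using assms arg_in by (blast intro: eval_closed)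

lemma hom_term_fun:
  assumes "t \<in> Fm L (vars_upto n)" "h \<in> homs L A B" "algebra L A" "length as = n" "set as \<subseteq> carrier A"
  shows "h (term_fun A t as) = term_fun B t (map h as)"
proof -
  have "h (eval A (arg as) t) = eval B (\<lambda>x. h (arg as x)) t"
    by (rule hom_eval[OF assms(1-3)]) (use assms arg_in in blast)
  then show ?thesis
    by (simp add: term_fun_eq eval_arg_map[OF assms(1,4)])
qed

lemma algebra_trans:
  assumes "translation \<tau> L L'" "algebra L' A"
  shows "algebra L (trans_alg A \<tau>)"
proof (rule algebraI)
  show "carrier (trans_alg A \<tau>) \<noteq> {}" using assms(2) by (simp add: algebra_def)
qed (simp add: term_fun_closed[OF translation_Fm[OF assms(1)] assms(2)])

lemma homs_trans:
  assumes "translation \<tau> L L'" "algebra L' A" "h \<in> homs L' A B"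
  shows "h \<in> homs L (trans_alg A \<tau>) (trans_alg B \<tau>)"
  by (rule homsI)
    (simp_all add: homs_in[OF assms(3)] hom_term_fun[OF translation_Fm[OF assms(1)] assms(3,2)])

lemma alg_eq_sym: "alg_eq L A B \<Longrightarrow> alg_eq L B A"
  unfolding alg_eq_def by auto

definition tr_comp :: "('v sym \<Rightarrow> 'v fm) \<Rightarrow> ('v sym \<Rightarrow> 'v fm) \<Rightarrow> 'v::zfc sym \<Rightarrow> 'v fm"
  where "tr_comp \<rho> \<tau> s = tr \<rho> (\<tau> s)"

lemma translation_comp:
  "translation \<tau> L L' \<Longrightarrow> translation \<rho> L' L'' \<Longrightarrow> translation (tr_comp \<rho> \<tau>) L L''"
  unfolding translation_def[of _ L] tr_comp_def using tr_closed by blast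

lemma alg_eq_trans_comp:
  assumes "translation \<tau> L L'" "translation \<rho> L' L''"
  shows "alg_eq L (trans_alg (trans_alg A \<rho>) \<tau>) (trans_alg A (tr_comp \<rho> \<tau>))"
  unfolding alg_eq_def
  by (simp add: term_fun_eq tr_comp_def eval_tr[OF assms(2) translation_Fm[OF assms(1)]])

text \<open>The term \<open>s(x\<^sub>1, \<dots>, x\<^sub>n)\<close>.  As a map from symbols to terms it is the identity translation; composed
  with a map of symbols it is the translation that renames symbols.\<close>

definition basic :: "'v::zfc sym \<Rightarrow> 'v fm"
  where "basic s = App s (map (\<lambda>i. Var (vnat i)) [1..<Suc (snd s)])"

lemma basic_Fm: "s \<in> L \<Longrightarrow> basic s \<in> Fm L (vars_upto (snd s))"
  by (auto simp: basic_def Fm_App_iff vars_upto_def)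

lemma map_arg_upto: "length as = n \<Longrightarrow> map (\<lambda>i. arg as (vnat i)) [1..<Suc n] = as"
  by (rule nth_equalityI) (auto simp del: upt_Suc)

lemma term_fun_basic: "length as = snd s \<Longrightarrow> term_fun A (basic s) as = oper A s as"
  unfolding term_fun_eq basic_def using map_arg_upto[of as "snd s"] by (simp add: comp_def)

lemma translation_basic: "translation basic L L"
  unfolding translation_def using basic_Fm by blast

lemma alg_eq_trans_basic: "alg_eq L (trans_alg A basic) A"
  by (simp add: alg_eq_def term_fun_basic)


section \<open>Leibniz congruences\<close>

lemma matrixD:
  "matrix L (A, F) \<Longrightarrow> small (carrier A)" "matrix L (A, F) \<Longrightarrow> algebra L A"
  "matrix L (A, F) \<Longrightarrow> F \<subseteq> carrier A"
  by (auto simp: matrix_def)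

lemma congruenceD:
  assumes "congruence L A \<theta>"
  shows "\<theta> \<subseteq> carrier A \<times> carrier A" "a \<in> carrier A \<Longrightarrow> (a, a) \<in> \<theta>"
    "(a, b) \<in> \<theta> \<Longrightarrow> (b, a) \<in> \<theta>" "(a, b) \<in> \<theta> \<Longrightarrow> (b, c) \<in> \<theta> \<Longrightarrow> (a, c) \<in> \<theta>"
  using assms unfolding congruence_def equiv_def
  by (auto simp: refl_on_def dest: symD transD)

lemma congruence_oper:
  "congruence L A \<theta> \<Longrightarrow> s \<in> L \<Longrightarrow> length as = snd s \<Longrightarrow> list_all2 (\<lambda>a b. (a, b) \<in> \<theta>) as bs \<Longrightarrow>
    (oper A s as, oper A s bs) \<in> \<theta>"
  unfolding congruence_def by blast

text \<open>The arguments can be exchanged one after the other, by transitivity.\<close>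

lemma congruence_unaryI:
  assumes "equiv (carrier A) \<theta>" "algebra L A"
    and un: "\<And>s cs a b ds. s \<in> L \<Longrightarrow> length (cs @ a # ds) = snd s \<Longrightarrow> set cs \<subseteq> carrier A \<Longrightarrow>
      set ds \<subseteq> carrier A \<Longrightarrow> (a, b) \<in> \<theta> \<Longrightarrow> (oper A s (cs @ a # ds), oper A s (cs @ b # ds)) \<in> \<theta>"
  shows "congruence L A \<theta>"
proof -
  have sub: "\<theta> \<subseteq> carrier A \<times> carrier A" and rf: "refl_on (carrier A) \<theta>" and tr: "trans \<theta>"
    using assms(1) by (auto simp: equiv_def)
  have main: "(oper A s (cs @ as), oper A s (cs @ bs)) \<in> \<theta>"
    if "list_all2 (\<lambda>a b. (a, b) \<in> \<theta>) as bs" "set cs \<subseteq> carrier A" "length (cs @ as) = snd s" "s \<in> L"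
    for s cs as bs
    using that
  proof (induction as bs arbitrary: cs rule: list_all2_induct)
    case Nil
    then show ?case using rf algebra_oper[OF assms(2)] by (simp add: refl_on_def)
  next
    case (Cons a as b bs)
    have "set as \<subseteq> carrier A"
      using Cons.hyps(2) sub by (auto simp: list_all2_conv_all_nth set_conv_nth)
    then have "(oper A s (cs @ a # as), oper A s (cs @ b # as)) \<in> \<theta>"
      using Cons un by simp
    moreover have "b \<in> carrier A" using Cons.hyps(1) sub by auto
    then have "(oper A s ((cs @ [b]) @ as), oper A s ((cs @ [b]) @ bs)) \<in> \<theta>"
      using Cons.prems by (intro Cons.IH) auto
    ultimately show ?case using tr by (auto dest: transD)
  qed
  show ?thesis
    unfolding congruence_def using assms(1) main[of _ _ "[]"] by auto
qed

lemma congruence_Id: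
  assumes "algebra L A" shows "congruence L A (Id_on (carrier A))"
proof (rule congruence_unaryI[OF _ assms])
  show "equiv (carrier A) (Id_on (carrier A))"
    by (auto simp: equiv_def refl_on_def sym_def trans_def)
qed (use algebra_oper[OF assms] in auto)

lemma congruence_eval:
  assumes "congruence L A \<theta>" "t \<in> Fm L X" "\<And>x. x \<in> X \<Longrightarrow> (v x, w x) \<in> \<theta>"
  shows "(eval A v t, eval A w t) \<in> \<theta>"
  using assms(2)
proof induction
  case (App s ts)
  then have "list_all2 (\<lambda>a b. (a, b) \<in> \<theta>) (map (eval A v) ts) (map (eval A w) ts)"
    by (auto simp: list_all2_conv_all_nth)
  then show ?case
    using congruence_oper[OF assms(1) App.hyps(1)] App.hyps(2) by simp
qed (use assms in simp)

lemma congruence_vimage: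
  assumes "h \<in> homs L A B" "algebra L A" "congruence L B \<theta>"
  shows "congruence L A {(a, b) \<in> carrier A \<times> carrier A. (h a, h b) \<in> \<theta>}"
proof (rule congruence_unaryI[OF _ assms(2)])
  let ?R = "{(a, b) \<in> carrier A \<times> carrier A. (h a, h b) \<in> \<theta>}"
  show "equiv (carrier A) ?R"
    unfolding equiv_def
  proof (intro conjI)
    show "refl_on (carrier A) ?R"
      using congruenceD(2)[OF assms(3) homs_in[OF assms(1)]] by (simp add: refl_on_def)
    show "sym ?R" using congruenceD(3)[OF assms(3)] by (intro symI) blast
    show "trans ?R" using congruenceD(4)[OF assms(3)] by (intro transI) blast
  qed blast
  fix s cs a b ds
  assume *: "s \<in> L" "length (cs @ a # ds) = snd s" "set cs \<subseteq> carrier A" "set ds \<subseteq> carrier A" "(a, b) \<in> ?R"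
  then have ab: "a \<in> carrier A" "b \<in> carrier A" "(h a, h b) \<in> \<theta>" by auto
  have "list_all2 (\<lambda>a b. (a, b) \<in> \<theta>) (map h xs) (map h xs)" if "set xs \<subseteq> carrier A" for xs
    using that congruenceD(2)[OF assms(3) homs_in[OF assms(1)]]
    by (auto simp: list_all2_same list.rel_map subset_iff)
  then have "list_all2 (\<lambda>a b. (a, b) \<in> \<theta>) (map h (cs @ a # ds)) (map h (cs @ b # ds))"
    using ab(3) *(3,4) by (auto intro!: list_all2_appendI)
  then have "(oper B s (map h (cs @ a # ds)), oper B s (map h (cs @ b # ds))) \<in> \<theta>"
    using * by (intro congruence_oper[OF assms(3)]) auto
  moreover have "set (cs @ a # ds) \<subseteq> carrier A" "set (cs @ b # ds) \<subseteq> carrier A"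
    using * ab by auto
  moreover have "length (cs @ b # ds) = snd s" using * by simp
  ultimately show "(oper A s (cs @ a # ds), oper A s (cs @ b # ds)) \<in> ?R"
    using * algebra_oper[OF assms(2)] homs_oper[OF assms(1)] by simp
qed

lemma congruence_trans_alg:
  assumes "translation \<tau> L L'" "congruence L' A \<theta>"
  shows "congruence L (trans_alg A \<tau>) \<theta>"
  unfolding congruence_def
proof (intro conjI ballI allI impI)
  show "equiv (carrier (trans_alg A \<tau>)) \<theta>"
    using assms(2) by (simp add: congruence_def)
  fix s as bs assume s: "s \<in> L" and *: "length as = snd s \<and> list_all2 (\<lambda>a b. (a, b) \<in> \<theta>) as bs"
  then have "(arg as x, arg bs x) \<in> \<theta>" if "x \<in> vars_upto (snd s)" for x
    using that by (auto simp: vars_upto_def list_all2_conv_all_nth)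
  then show "(oper (trans_alg A \<tau>) s as, oper (trans_alg A \<tau>) s bs) \<in> \<theta>"
    unfolding trans_alg_simps term_fun_eq
    by (rule congruence_eval[OF assms(2) translation_Fm[OF assms(1) s]])
qed

lemma congruence_alg_eq:
  assumes "alg_eq L A B" "congruence L A \<theta>"
  shows "congruence L B \<theta>"
  unfolding congruence_def
proof (intro conjI ballI allI impI)
  show "equiv (carrier B) \<theta>"
    using assms by (simp add: congruence_def alg_eq_def)
  fix s as bs assume s: "s \<in> L" and *: "length as = snd s \<and> list_all2 (\<lambda>a b. (a, b) \<in> \<theta>) as bs"
  then have "as \<in> lists (carrier A)" "bs \<in> lists (carrier A)" "length bs = snd s"
    using congruenceD(1)[OF assms(2)]
    by (auto simp: lists_eq_set list_all2_conv_all_nth set_conv_nth)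
  then show "(oper B s as, oper B s bs) \<in> \<theta>"
    using congruence_oper[OF assms(2) s] * s assms(1) unfolding alg_eq_def by metis
qed

lemma congruence_Inter:
  assumes "S \<noteq> {}" "\<And>\<theta>. \<theta> \<in> S \<Longrightarrow> congruence L A \<theta>"
  shows "congruence L A (\<Inter> S)"
  unfolding congruence_def
proof (intro conjI ballI allI impI)
  show "equiv (carrier A) (\<Inter> S)"
    unfolding equiv_def
  proof (intro conjI)
    show "\<Inter> S \<subseteq> carrier A \<times> carrier A"
      using assms congruenceD(1) by blast
    show "refl_on (carrier A) (\<Inter> S)"
      using congruenceD(2)[OF assms(2)] by (auto simp: refl_on_def)
    show "sym (\<Inter> S)"
      using congruenceD(3)[OF assms(2)] by (intro symI) blast
    show "trans (\<Inter> S)"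
      using congruenceD(4)[OF assms(2)] by (intro transI) blast
  qed
  fix s as bs assume s: "s \<in> L" and *: "length as = snd s \<and> list_all2 (\<lambda>a b. (a, b) \<in> \<Inter> S) as bs"
  show "(oper A s as, oper A s bs) \<in> \<Inter> S"
  proof
    fix \<theta> assume \<theta>: "\<theta> \<in> S"
    have "list_all2 (\<lambda>a b. (a, b) \<in> \<theta>) as bs"
      by (rule list_all2_mono[OF conjunct2[OF *]]) (use \<theta> in blast)
    then show "(oper A s as, oper A s bs) \<in> \<theta>"
      using congruence_oper[OF assms(2)[OF \<theta>] s] * by blast
  qed
qed

text \<open>Malcev's description of the largest compatible congruence: \<open>a\<close> and \<open>b\<close> cannot be told apart
  by a polynomial with values inside and outside of \<open>F\<close>.\<close>

definition indist :: "'v sym set \<Rightarrow> ('v, 'a) alg \<Rightarrow> 'a set \<Rightarrow> ('a \<times> 'a) set"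
  where "indist L A F = {(a, b) \<in> carrier A \<times> carrier A. \<forall>X \<chi> x v.
    \<chi> \<in> Fm L X \<and> (\<forall>y\<in>X. v y \<in> carrier A) \<longrightarrow>
      (eval A (v(x := a)) \<chi> \<in> F \<longleftrightarrow> eval A (v(x := b)) \<chi> \<in> F)}"

lemma indistD:
  assumes "(a, b) \<in> indist L A F"
  shows "a \<in> carrier A" "b \<in> carrier A"
    "\<chi> \<in> Fm L X \<Longrightarrow> (\<And>y. y \<in> X \<Longrightarrow> v y \<in> carrier A) \<Longrightarrow>
      eval A (v(x := a)) \<chi> \<in> F \<longleftrightarrow> eval A (v(x := b)) \<chi> \<in> F"
  using assms unfolding indist_def by blast+

lemma indistI:
  assumes "a \<in> carrier A" "b \<in> carrier A"
    "\<And>X \<chi> x v. \<chi> \<in> Fm L X \<Longrightarrow> (\<And>y. y \<in> X \<Longrightarrow> v y \<in> carrier A) \<Longrightarrow>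
      eval A (v(x := a)) \<chi> \<in> F \<longleftrightarrow> eval A (v(x := b)) \<chi> \<in> F"
  shows "(a, b) \<in> indist L A F"
  using assms unfolding indist_def by blast

lemma congruence_sub_indist:
  assumes "congruence L A \<theta>" "compatible \<theta> F"
  shows "\<theta> \<subseteq> indist L A F"
proof (rule subrelI)
  fix a b assume ab: "(a, b) \<in> \<theta>"
  have "(eval A (v(x := a)) \<chi>, eval A (v(x := b)) \<chi>) \<in> \<theta>"
    if "\<chi> \<in> Fm L X" "\<forall>y\<in>X. v y \<in> carrier A" for X \<chi> x v
    using that ab congruenceD(2)[OF assms(1)] by (intro congruence_eval[OF assms(1) that(1)]) auto
  then show "(a, b) \<in> indist L A F"
    using ab congruenceD(1,3)[OF assms(1)] assms(2) unfolding indist_def compatible_def by blast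
qed

text \<open>It is enough to consider contexts whose parameters are named by themselves: the elements of the
  algebra serve as variables, and only the place \<open>z\<close> of the argument needs a variable outside the
  carrier.  In this form the relation is visibly a congruence, since putting an operation with
  parameters in the place of \<open>z\<close> gives a context again, without any renaming of variables.\<close>

definition indist_at :: "'v \<Rightarrow> 'v sym set \<Rightarrow> ('v, 'v) alg \<Rightarrow> 'v set \<Rightarrow> ('v \<times> 'v) set"
  where "indist_at z L A F = {(a, b) \<in> carrier A \<times> carrier A. \<forall>\<chi> \<in> Fm L (insert z (carrier A)).
      (eval A (id(z := a)) \<chi> \<in> F \<longleftrightarrow> eval A (id(z := b)) \<chi> \<in> F)}"

lemma congruence_indist_at:
  assumes "algebra L A" "z \<notin> carrier A"
  shows "congruence L A (indist_at z L A F)"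
proof (rule congruence_unaryI[OF _ assms(1)])
  show "equiv (carrier A) (indist_at z L A F)"
    unfolding indist_at_def equiv_def refl_on_def sym_def trans_def by blast
  fix s cs a b ds
  assume s: "s \<in> L" and len: "length (cs @ a # ds) = snd s"
    and cd: "set cs \<subseteq> carrier A" "set ds \<subseteq> carrier A" and ab: "(a, b) \<in> indist_at z L A F"
  then have in_A: "a \<in> carrier A" "b \<in> carrier A" by (auto simp: indist_at_def)
  define \<delta> where "\<delta> = App s (map Var (cs @ z # ds))"
  have ev: "eval A (id(z := c)) \<delta> = oper A s (cs @ c # ds)" for c
  proof -
    have "map (id(z := c)) cs = cs" "map (id(z := c)) ds = ds"
      using cd assms(2) by (auto intro!: map_idI)
    moreover have "eval A (id(z := c)) \<delta> = oper A s (map (id(z := c)) cs @ c # map (id(z := c)) ds)"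
      by (simp add: \<delta>_def comp_def fun_upd_def)
    ultimately show ?thesis by simp
  qed
  have \<delta>: "\<delta> \<in> Fm L (insert z (carrier A))"
    using s len cd by (auto simp: \<delta>_def Fm_App_iff)
  show "(oper A s (cs @ a # ds), oper A s (cs @ b # ds)) \<in> indist_at z L A F"
    unfolding indist_at_def
  proof (intro CollectI case_prodI conjI ballI)
    show "(oper A s (cs @ a # ds), oper A s (cs @ b # ds)) \<in> carrier A \<times> carrier A"
      using in_A cd len algebra_oper[OF assms(1) s] by auto
    fix \<chi> assume \<chi>: "\<chi> \<in> Fm L (insert z (carrier A))"
    define \<chi>' where "\<chi>' = subst (Var(z := \<delta>)) \<chi>"
    have "\<chi>' \<in> Fm L (insert z (carrier A))"
      unfolding \<chi>'_def using \<chi> \<delta> by (auto intro!: subst_closed)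
    moreover have "eval A (id(z := c)) \<chi>' = eval A (id(z := oper A s (cs @ c # ds))) \<chi>" for c
      unfolding \<chi>'_def eval_subst by (rule arg_cong[of _ _ "\<lambda>v. eval A v \<chi>"]) (auto simp: ev)
    ultimately show "eval A (id(z := oper A s (cs @ a # ds))) \<chi> \<in> F \<longleftrightarrow>
        eval A (id(z := oper A s (cs @ b # ds))) \<chi> \<in> F"
      using ab unfolding indist_at_def by fastforce
  qed
qed

lemma compatible_indist_at: "compatible (indist_at z L A F) F"
  unfolding compatible_def
proof (intro allI impI)
  fix a b assume "a \<in> F \<and> (a, b) \<in> indist_at z L A F"
  then show "b \<in> F"
    unfolding indist_at_def by (auto dest: bspec[of _ _ "Var z"])
qed

lemma
  assumes "matrix L (A, F)"
  shows Leibniz_eq_indist: "Leibniz L A F = indist L A F"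
    and Leibniz_eq_indist_at: "z \<notin> carrier A \<Longrightarrow> Leibniz L A F = indist_at z L A F"
    and Leibniz_congruence: "congruence L A (Leibniz L A F)"
    and Leibniz_compatible: "compatible (Leibniz L A F) F"
    and Leibniz_greatest: "congruence L A \<theta> \<Longrightarrow> compatible \<theta> F \<Longrightarrow> \<theta> \<subseteq> Leibniz L A F"
proof -
  note A = matrixD[OF assms]
  have eq: "indist_at z L A F = indist L A F" if "z \<notin> carrier A" for z
  proof
    show "indist_at z L A F \<subseteq> indist L A F"
      by (rule congruence_sub_indist[OF congruence_indist_at[OF A(2) that] compatible_indist_at])
    show "indist L A F \<subseteq> indist_at z L A F"
    proof (rule subrelI)
      fix a b assume *: "(a, b) \<in> indist L A F"
      note ab = indistD(1,2)[OF *]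
      have "eval A (id(z := a)) \<chi> \<in> F \<longleftrightarrow> eval A (id(z := b)) \<chi> \<in> F"
        if "\<chi> \<in> Fm L (insert z (carrier A))" for \<chi>
      proof -
        have "(id(z := a)) y \<in> carrier A" if "y \<in> insert z (carrier A)" for y
          using that ab by auto
        from indistD(3)[OF * that, where x = z and v = "id(z := a)", OF this] show ?thesis by simp
      qed
      then show "(a, b) \<in> indist_at z L A F"
        using ab by (auto simp: indist_at_def)
    qed
  qed
  obtain z where z: "z \<notin> carrier A" using ex_not_in_small[OF A(1)] by blast
  have c: "congruence L A (indist L A F)" "compatible (indist L A F) F"
    using congruence_indist_at[OF A(2) z, of F] compatible_indist_at[of z L A F] unfolding eq[OF z] by auto
  show L: "Leibniz L A F = indist L A F"
    unfolding Leibniz_def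
    by (rule Greatest_equality) (use c in blast, elim conjE, rule congruence_sub_indist)
  show "z \<notin> carrier A \<Longrightarrow> Leibniz L A F = indist_at z L A F" for z
    using eq L by simp
  show "congruence L A (Leibniz L A F)" "compatible (Leibniz L A F) F"
    using c L by auto
  show "congruence L A \<theta> \<Longrightarrow> compatible \<theta> F \<Longrightarrow> \<theta> \<subseteq> Leibniz L A F"
    unfolding L by (rule congruence_sub_indist)
qed

text \<open>Homomorphisms commute with the evaluation of contexts, and by surjectivity the parameters of a context
  over \<open>B\<close> can be lifted to \<open>A\<close>.\<close>

lemma Leibniz_vimage:
  assumes "matrix L (A, {a \<in> carrier A. h a \<in> H})" "matrix L (B, H)"
    and h: "h \<in> homs L A B" "h ` carrier A = carrier B" and ab: "a \<in> carrier A" "b \<in> carrier A"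
  shows "(a, b) \<in> Leibniz L A {a \<in> carrier A. h a \<in> H} \<longleftrightarrow> (h a, h b) \<in> Leibniz L B H"
proof -
  let ?F = "{a \<in> carrier A. h a \<in> H}"
  note A = matrixD(2)[OF assms(1)]
  have tr: "eval A (v(x := c)) \<chi> \<in> ?F \<longleftrightarrow> eval B ((\<lambda>y. h (v y))(x := h c)) \<chi> \<in> H"
    if "\<chi> \<in> Fm L X" "\<forall>y\<in>X. v y \<in> carrier A" "c \<in> carrier A" for X \<chi> x v c
  proof -
    have v: "(v(x := c)) y \<in> carrier A" if "y \<in> X" for y
      using that \<open>\<forall>y\<in>X. v y \<in> carrier A\<close> \<open>c \<in> carrier A\<close> by simp
    have "(\<lambda>y. h ((v(x := c)) y)) = (\<lambda>y. h (v y))(x := h c)" by auto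
    then have "h (eval A (v(x := c)) \<chi>) = eval B ((\<lambda>y. h (v y))(x := h c)) \<chi>"
      using hom_eval[OF that(1) h(1) A, of "v(x := c)"] v by simp
    moreover have "eval A (v(x := c)) \<chi> \<in> carrier A" by (rule eval_closed[OF that(1) A v])
    ultimately show ?thesis by simp
  qed
  have "(a, b) \<in> indist L A ?F \<longleftrightarrow> (h a, h b) \<in> indist L B H" (is "?l \<longleftrightarrow> ?r")
  proof
    assume l: ?l
    have "eval B (w(x := h a)) \<chi> \<in> H \<longleftrightarrow> eval B (w(x := h b)) \<chi> \<in> H"
      if \<chi>: "\<chi> \<in> Fm L X" and w: "\<forall>y\<in>X. w y \<in> carrier B" for X \<chi> x w
    proof -
      define v where "v y = inv_into (carrier A) h (w y)" for y
      have v: "\<forall>y\<in>X. v y \<in> carrier A" "\<And>y. y \<in> X \<Longrightarrow> h (v y) = w y"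
        using w h(2) by (auto simp: v_def inv_into_into f_inv_into_f)
      have "eval B (w(x := h c)) \<chi> = eval B ((\<lambda>y. h (v y))(x := h c)) \<chi>" for c
        by (rule eval_cong[OF \<chi>]) (use v in auto)
      then show ?thesis
        using indistD(3)[OF l \<chi>, of v x] tr[OF \<chi> v(1) ab(1), of x] tr[OF \<chi> v(1) ab(2), of x] v(1) by simp
    qed
    then show ?r using ab homs_in[OF h(1)] by (intro indistI) auto
  next
    assume r: ?r
    have "eval A (v(x := a)) \<chi> \<in> ?F \<longleftrightarrow> eval A (v(x := b)) \<chi> \<in> ?F"
      if \<chi>: "\<chi> \<in> Fm L X" and v: "\<forall>y\<in>X. v y \<in> carrier A" for X \<chi> x v
    proof -
      have hv: "h (v y) \<in> carrier B" if "y \<in> X" for y using v that homs_in[OF h(1)] by blast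
      from indistD(3)[OF r \<chi>, where x = x and v = "\<lambda>y. h (v y)", OF hv] have "eval B ((\<lambda>y. h (v y))(x := h a)) \<chi> \<in> H \<longleftrightarrow> eval B ((\<lambda>y. h (v y))(x := h b)) \<chi> \<in> H"
        .
      then show ?thesis
        using tr[OF \<chi> v ab(1), of x] tr[OF \<chi> v ab(2), of x] by blast
    qed
    then show ?l using ab by (intro indistI) auto
  qed
  then show ?thesis
    using Leibniz_eq_indist[OF assms(1)] Leibniz_eq_indist[OF assms(2)] by simp
qed

lemma matrix_trans: "translation \<tau> L L' \<Longrightarrow> matrix L' (A, F) \<Longrightarrow> matrix L (trans_alg A \<tau>, F)"
  using algebra_trans by (auto simp: matrix_def)

text \<open>The operations of the translated algebra are term functions, so it has at least the congruences of
  the original one.\<close>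

lemma Leibniz_trans:
  assumes "translation \<tau> L L'" "matrix L' (A, F)"
  shows "Leibniz L' A F \<subseteq> Leibniz L (trans_alg A \<tau>) F"
  using Leibniz_greatest[OF matrix_trans[OF assms]] congruence_trans_alg[OF assms(1)]
    Leibniz_congruence[OF assms(2)] Leibniz_compatible[OF assms(2)] by blast

lemma Leibniz_alg_eq: "alg_eq L A B \<Longrightarrow> Leibniz L A F = Leibniz L B F"
proof -
  assume "alg_eq L A B"
  then have "congruence L A = congruence L B"
    using congruence_alg_eq alg_eq_sym by (intro ext iffI) blast+
  then show ?thesis unfolding Leibniz_def by simp
qed


section \<open>Models and Suszko-reduced models\<close>

lemma is_logicD:
  assumes "is_logic l"
  shows "language (lang l)" "Cardinal (nvars l)" "infinite (elts (nvars l))"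
    "entails l \<Gamma> \<phi> \<Longrightarrow> \<Gamma> \<subseteq> Fm (lang l) (elts (nvars l))"
    "entails l \<Gamma> \<phi> \<Longrightarrow> \<phi> \<in> Fm (lang l) (elts (nvars l))"
proof -
  show "language (lang l)" using assms unfolding is_logic_def by (elim conjE)
  show "Cardinal (nvars l)" using assms unfolding is_logic_def by (elim conjE)
  show "infinite (elts (nvars l))" using assms unfolding is_logic_def by (elim conjE)
  have "\<forall>\<Gamma> \<phi>. entails l \<Gamma> \<phi> \<longrightarrow> \<Gamma> \<subseteq> FmL l \<and> \<phi> \<in> FmL l"
    using assms unfolding is_logic_def by (elim conjE)
  then show "entails l \<Gamma> \<phi> \<Longrightarrow> \<Gamma> \<subseteq> Fm (lang l) (elts (nvars l))"
    "entails l \<Gamma> \<phi> \<Longrightarrow> \<phi> \<in> Fm (lang l) (elts (nvars l))"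
    unfolding FmL_def by blast+
qed

lemma Mod_matrix: "(A, F) \<in> Mod l \<Longrightarrow> matrix (lang l) (A, F)"
  unfolding Mod_def by blast

lemma ModD:
  assumes "(A, F) \<in> Mod l" "entails l \<Gamma> \<phi>" "\<And>x. x \<in> elts (nvars l) \<Longrightarrow> v x \<in> carrier A"
    "\<And>\<gamma>. \<gamma> \<in> \<Gamma> \<Longrightarrow> eval A v \<gamma> \<in> F"
  shows "eval A v \<phi> \<in> F"
proof -
  have "eval A v \<in> homs (lang l) (fmL_alg l) A"
    unfolding fmL_alg_def using assms(3) matrixD(2)[OF Mod_matrix[OF assms(1)]] by (intro eval_in_homs)
  then show ?thesis
    using assms unfolding Mod_def by blast
qed

lemma ModI:
  assumes "is_logic l" "matrix (lang l) (A, F)"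
    "\<And>\<Gamma> \<phi> v. entails l \<Gamma> \<phi> \<Longrightarrow> (\<And>x. x \<in> elts (nvars l) \<Longrightarrow> v x \<in> carrier A) \<Longrightarrow>
      (\<And>\<gamma>. \<gamma> \<in> \<Gamma> \<Longrightarrow> eval A v \<gamma> \<in> F) \<Longrightarrow> eval A v \<phi> \<in> F"
  shows "(A, F) \<in> Mod l"
proof -
  have "h \<phi> \<in> F" if e: "entails l \<Gamma> \<phi>" and h: "h \<in> homs (lang l) (fmL_alg l) A" "h ` \<Gamma> \<subseteq> F" for \<Gamma> \<phi> h
  proof -
    have eq: "t \<in> Fm (lang l) (elts (nvars l)) \<Longrightarrow> h t = eval A (\<lambda>x. h (Var x)) t" for t
      using h(1) hom_fm_eq_eval unfolding fmL_alg_def by blast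
    have "eval A (\<lambda>x. h (Var x)) \<phi> \<in> F"
    proof (rule assms(3)[OF e])
      show "h (Var x) \<in> carrier A" if "x \<in> elts (nvars l)" for x
        using homs_in[OF h(1)] that by (simp add: fmL_alg_def)
      show "eval A (\<lambda>x. h (Var x)) \<gamma> \<in> F" if "\<gamma> \<in> \<Gamma>" for \<gamma>
      proof -
        have "\<gamma> \<in> Fm (lang l) (elts (nvars l))" using is_logicD(4)[OF assms(1) e] that by blast
        then show ?thesis using eq that h(2) by (metis image_subset_iff)
      qed
    qed
    then show ?thesis using eq is_logicD(5)[OF assms(1) e] by simp
  qed
  then show ?thesis using assms(2) unfolding Mod_def by blast
qed

lemma matrix_alg_eq: "alg_eq L A B \<Longrightarrow> matrix L (A, F) \<Longrightarrow> matrix L (B, F)"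
  unfolding matrix_def alg_eq_def algebra_def by auto

lemma Mod_alg_eq:
  assumes "is_logic l" "alg_eq (lang l) A B" "(A, F) \<in> Mod l"
  shows "(B, F) \<in> Mod l"
proof (rule ModI[OF assms(1) matrix_alg_eq[OF assms(2) Mod_matrix[OF assms(3)]]])
  fix \<Gamma> \<phi> v
  assume e: "entails l \<Gamma> \<phi>" and v: "\<And>x. x \<in> elts (nvars l) \<Longrightarrow> v x \<in> carrier B"
    and \<Gamma>: "\<And>\<gamma>. \<gamma> \<in> \<Gamma> \<Longrightarrow> eval B v \<gamma> \<in> F"
  have v': "x \<in> elts (nvars l) \<Longrightarrow> v x \<in> carrier A" for x
    using v assms(2) by (auto simp: alg_eq_def)
  have eq: "t \<in> Fm (lang l) (elts (nvars l)) \<Longrightarrow> eval B v t = eval A v t" for t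
    using alg_eq_eval[OF _ assms(2) matrixD(2)[OF Mod_matrix[OF assms(3)]]] v' by blast
  have "eval A v \<phi> \<in> F"
    by (rule ModD[OF assms(3) e v']) (use \<Gamma> eq is_logicD(4)[OF assms(1) e] in force)+
  then show "eval B v \<phi> \<in> F" using eq is_logicD(5)[OF assms(1) e] by simp
qed

text \<open>Deductive filters are closed under preimages along homomorphisms and under intersections.  Both are
  combined here, as the homomorphisms may lead to different models.\<close>

lemma Mod_vimage_family:
  assumes "is_logic l" "matrix (lang l) (A, {a \<in> carrier A. \<forall>i\<in>I. h i a \<in> H i})"
    and h: "\<And>i. i \<in> I \<Longrightarrow> h i \<in> homs (lang l) A (B i)" "\<And>i. i \<in> I \<Longrightarrow> (B i, H i) \<in> Mod l"
  shows "(A, {a \<in> carrier A. \<forall>i\<in>I. h i a \<in> H i}) \<in> Mod l"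
proof (rule ModI[OF assms(1,2)])
  let ?F = "{a \<in> carrier A. \<forall>i\<in>I. h i a \<in> H i}"
  fix \<Gamma> \<phi> v
  assume e: "entails l \<Gamma> \<phi>" and v: "\<And>x. x \<in> elts (nvars l) \<Longrightarrow> v x \<in> carrier A"
    and \<Gamma>: "\<And>\<gamma>. \<gamma> \<in> \<Gamma> \<Longrightarrow> eval A v \<gamma> \<in> ?F"
  note A = matrixD(2)[OF assms(2)]
  have "h i (eval A v \<phi>) \<in> H i" if i: "i \<in> I" for i
  proof -
    have eq: "t \<in> Fm (lang l) (elts (nvars l)) \<Longrightarrow> h i (eval A v t) = eval (B i) (\<lambda>x. h i (v x)) t" for t
      by (rule hom_eval[OF _ h(1)[OF i] A]) (use v in auto)
    have "eval (B i) (\<lambda>x. h i (v x)) \<phi> \<in> H i"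
    proof (rule ModD[OF h(2)[OF i] e])
      show "h i (v x) \<in> carrier (B i)" if "x \<in> elts (nvars l)" for x
        using homs_in[OF h(1)[OF i] v[OF that]] .
      show "eval (B i) (\<lambda>x. h i (v x)) \<gamma> \<in> H i" if "\<gamma> \<in> \<Gamma>" for \<gamma>
      proof -
        have "\<gamma> \<in> Fm (lang l) (elts (nvars l))" using is_logicD(4)[OF assms(1) e] that by blast
        from eq[OF this] show ?thesis using \<Gamma>[OF that] i by auto
      qed
    qed
    then show ?thesis using eq is_logicD(5)[OF assms(1) e] by simp
  qed
  then show "eval A v \<phi> \<in> ?F" using eval_closed[OF is_logicD(5)[OF assms(1) e] A v] by simp
qed

lemma Mod_vimage:
  assumes "is_logic l" "small (carrier A)" "algebra (lang l) A"
    and "h \<in> homs (lang l) A B" "(B, H) \<in> Mod l"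
  shows "(A, {a \<in> carrier A. h a \<in> H}) \<in> Mod l"
  using Mod_vimage_family[of l A "{()}" "\<lambda>_. h" "\<lambda>_. H" "\<lambda>_. B"] assms
  by (auto simp: matrix_def)

text \<open>A valuation in the image of a surjective homomorphism lifts to the domain.\<close>

lemma Mod_image:
  assumes "is_logic l" "matrix (lang l) (B, H)" "h \<in> homs (lang l) A B" "h ` carrier A = carrier B"
    and M: "(A, {a \<in> carrier A. h a \<in> H}) \<in> Mod l"
  shows "(B, H) \<in> Mod l"
proof (rule ModI[OF assms(1,2)])
  fix \<Gamma> \<phi> w
  assume e: "entails l \<Gamma> \<phi>" and w: "\<And>x. x \<in> elts (nvars l) \<Longrightarrow> w x \<in> carrier B"
    and \<Gamma>: "\<And>\<gamma>. \<gamma> \<in> \<Gamma> \<Longrightarrow> eval B w \<gamma> \<in> H"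
  note A = matrixD(2)[OF Mod_matrix[OF M]]
  define v where "v y = inv_into (carrier A) h (w y)" for y
  have v: "y \<in> elts (nvars l) \<Longrightarrow> v y \<in> carrier A" "y \<in> elts (nvars l) \<Longrightarrow> h (v y) = w y" for y
    using w assms(4) by (auto simp: v_def inv_into_into f_inv_into_f)
  have eq: "h (eval A v t) = eval B w t" "eval A v t \<in> carrier A"
    if t: "t \<in> Fm (lang l) (elts (nvars l))" for t
  proof -
    have "h (eval A v t) = eval B (\<lambda>x. h (v x)) t"
      by (rule hom_eval[OF t assms(3) A v(1)])
    also have "\<dots> = eval B w t" by (rule eval_cong[OF t]) (rule v)
    finally show "h (eval A v t) = eval B w t" .
    show "eval A v t \<in> carrier A" using eval_closed[OF t A v(1)] .
  qed
  have "eval A v \<phi> \<in> {a \<in> carrier A. h a \<in> H}"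
    by (rule ModD[OF M e v(1)]) (use \<Gamma> eq is_logicD(4)[OF assms(1) e] in force)+
  then show "eval B w \<phi> \<in> H" using eq is_logicD(5)[OF assms(1) e] by simp
qed

lemma Suszko_iff:
  "(a, b) \<in> Suszko l A F \<longleftrightarrow> (\<forall>G. (A, G) \<in> Mod l \<longrightarrow> F \<subseteq> G \<longrightarrow> (a, b) \<in> Leibniz (lang l) A G)"
  unfolding Suszko_def deductive_filter_def by blast

lemma SuszkoD:
  "(a, b) \<in> Suszko l A F \<Longrightarrow> (A, G) \<in> Mod l \<Longrightarrow> F \<subseteq> G \<Longrightarrow> (a, b) \<in> Leibniz (lang l) A G"
  unfolding Suszko_iff by blast

lemma Suszko_congruence:
  assumes "(A, F) \<in> Mod l"
  shows "congruence (lang l) A (Suszko l A F)"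
  unfolding Suszko_def deductive_filter_def
  by (rule congruence_Inter) (use assms Leibniz_congruence Mod_matrix in blast)+

lemma Mod_eqv_Mod: "(A, F) \<in> Mod_eqv l \<Longrightarrow> (A, F) \<in> Mod l"
  unfolding Mod_eqv_def by blast

lemma Mod_eqv_matrix: "(A, F) \<in> Mod_eqv l \<Longrightarrow> matrix (lang l) (A, F)"
  using Mod_eqv_Mod Mod_matrix by blast

lemma Mod_eqvI:
  assumes "(A, F) \<in> Mod l"
    "\<And>a b. a \<in> carrier A \<Longrightarrow> b \<in> carrier A \<Longrightarrow> (a, b) \<in> Suszko l A F \<Longrightarrow> a = b"
  shows "(A, F) \<in> Mod_eqv l"
  using assms congruenceD(1,2)[OF Suszko_congruence[OF assms(1)]] unfolding Mod_eqv_def by fastforce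

lemma Mod_eqvD:
  assumes "(A, F) \<in> Mod_eqv l" "(a, b) \<in> Suszko l A F"
  shows "a = b"
  using assms unfolding Mod_eqv_def by auto

lemma Mod_eqv_alg_eq:
  assumes "is_logic l" "alg_eq (lang l) A B" "(A, F) \<in> Mod_eqv l"
  shows "(B, F) \<in> Mod_eqv l"
proof (rule Mod_eqvI)
  show "(B, F) \<in> Mod l" using assms Mod_alg_eq Mod_eqv_Mod by blast
  fix a b assume "(a, b) \<in> Suszko l B F"
  then have "(a, b) \<in> Suszko l A F"
    unfolding Suszko_iff using Mod_alg_eq[OF assms(1,2)] Leibniz_alg_eq[OF assms(2)] by blast
  then show "a = b" using Mod_eqvD assms(3) by blast
qed

text \<open>The filters above \<open>H\<close> have preimages above \<open>F\<close>, so a pair in the Suszko congruence of \<open>F\<close> is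
  identified by the Leibniz congruences of all these preimages.\<close>

lemma Suszko_vimage:
  assumes "is_logic l" "matrix (lang l) (A, F)" "h \<in> homs (lang l) A B" "h ` carrier A = carrier B"
    and B: "matrix (lang l) (B, H)" "F \<subseteq> {a \<in> carrier A. h a \<in> H}"
    and ab: "(a, b) \<in> Suszko l A F" "a \<in> carrier A" "b \<in> carrier A"
  shows "(h a, h b) \<in> Suszko l B H"
  unfolding Suszko_iff
proof (intro allI impI)
  fix G assume G: "(B, G) \<in> Mod l" "H \<subseteq> G"
  have M: "(A, {a \<in> carrier A. h a \<in> G}) \<in> Mod l"
    using Mod_vimage[OF assms(1) matrixD(1,2)[OF assms(2)] assms(3) G(1)] .
  have "F \<subseteq> {a \<in> carrier A. h a \<in> G}" using B(2) G(2) by blast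
  then have "(a, b) \<in> Leibniz (lang l) A {a \<in> carrier A. h a \<in> G}"
    using SuszkoD[OF ab(1) M] by blast
  then show "(h a, h b) \<in> Leibniz (lang l) B G"
    using Leibniz_vimage[OF Mod_matrix[OF M] Mod_matrix[OF G(1)] assms(3,4) ab(2,3)] by blast
qed

text \<open>Every model is a strict preimage of a Suszko-reduced one, namely of its quotient by the Suszko
  congruence: all deductive filters above the given one are unions of classes, so the quotient map
  induces a bijection of these filters with the deductive filters above the quotient.  The quotient
  lives on a set of representatives.\<close>

lemma Suszko_reduction:
  assumes l: "is_logic l" and A: "(A, F) \<in> Mod l"
  obtains q B H where "(B, H) \<in> Mod_eqv l" "q \<in> homs (lang l) A B" "q ` carrier A = carrier B"
    "F = {a \<in> carrier A. q a \<in> H}"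
proof -
  let ?\<theta> = "Suszko l A F"
  note c = Suszko_congruence[OF A] and m = Mod_matrix[OF A]
  note cD = congruenceD[OF c]
  define q where "q a = (SOME b. (a, b) \<in> ?\<theta>)" for a
  define B :: "('a, 'a) alg" where "B = \<lparr>carrier = q ` carrier A, oper = (\<lambda>s as. q (oper A s as))\<rparr>"
  have q: "(a, q a) \<in> ?\<theta>" if "a \<in> carrier A" for a
    unfolding q_def by (rule someI, rule cD(2)[OF that])
  have q_eq: "q a = q b \<longleftrightarrow> (a, b) \<in> ?\<theta>" if ab: "a \<in> carrier A" "b \<in> carrier A" for a b
  proof
    assume "q a = q b"
    then show "(a, b) \<in> ?\<theta>" using q ab cD by metis
  next
    assume *: "(a, b) \<in> ?\<theta>"
    have "(a, c) \<in> ?\<theta> \<longleftrightarrow> (b, c) \<in> ?\<theta>" for c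
      using cD(3,4) * by blast
    then show "q a = q b" by (simp add: q_def)
  qed
  have q_in: "q a \<in> carrier A" if "a \<in> carrier A" for a
    using q[OF that] cD(1) by blast
  have hom: "q \<in> homs (lang l) A B"
  proof (rule homsI)
    show "q a \<in> carrier B" if "a \<in> carrier A" for a using that by (simp add: B_def)
    fix s as assume s: "s \<in> lang l" "length as = snd s" and as: "set as \<subseteq> carrier A"
    have "list_all2 (\<lambda>a b. (a, b) \<in> ?\<theta>) as (map q as)"
      using as q by (auto simp: list_all2_same list.rel_map subset_iff)
    then have "(oper A s as, oper A s (map q as)) \<in> ?\<theta>"
      by (rule congruence_oper[OF c s])
    moreover have "set (map q as) \<subseteq> carrier A" using as q_in by auto
    ultimately show "q (oper A s as) = oper B s (map q as)"
      using q_eq algebra_oper[OF matrixD(2)[OF m] s(1)] s(2) as by (simp add: B_def)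
  qed
  have onto: "q ` carrier A = carrier B" by (simp add: B_def)
  have algB: "algebra (lang l) B"
  proof (rule algebraI)
    show "carrier B \<noteq> {}" using matrixD(2)[OF m] by (simp add: B_def algebra_def)
    fix s as assume s: "s \<in> lang l" "length as = snd s" and as: "set as \<subseteq> carrier B"
    then have "set as \<subseteq> carrier A" using q_in by (auto simp: B_def)
    then have "oper A s as \<in> carrier A" using algebra_oper[OF matrixD(2)[OF m] s] by blast
    then show "oper B s as \<in> carrier B" by (simp add: B_def)
  qed
  have matB: "matrix (lang l) (B, q ` G)" if "G \<subseteq> carrier A" for G
    unfolding matrix_def using algB small_image[OF matrixD(1)[OF m], of q] image_mono[OF that, of q] onto
    by simp
  have strict: "G = {a \<in> carrier A. q a \<in> q ` G}" if G: "(A, G) \<in> Mod l" "F \<subseteq> G" for G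
  proof -
    have "?\<theta> \<subseteq> Leibniz (lang l) A G" using G unfolding Suszko_def deductive_filter_def by blast
    then have comp: "a \<in> G \<Longrightarrow> (a, b) \<in> ?\<theta> \<Longrightarrow> b \<in> G" for a b
      using Leibniz_compatible[OF Mod_matrix[OF G(1)]] unfolding compatible_def by blast
    have sub: "G \<subseteq> carrier A" by (rule matrixD(3)[OF Mod_matrix[OF G(1)]])
    have "b \<in> G" if "b \<in> carrier A" "q b = q a" "a \<in> G" for a b
      using comp that q_eq sub by (metis subsetD)
    then show ?thesis using sub by auto
  qed
  have ModB: "(B, q ` G) \<in> Mod l" if G: "(A, G) \<in> Mod l" "F \<subseteq> G" for G
    by (rule Mod_image[OF l matB[OF matrixD(3)[OF Mod_matrix[OF G(1)]]] hom onto])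
      (use strict[OF G, symmetric] G(1) in simp)
  have "(B, q ` F) \<in> Mod_eqv l"
  proof (rule Mod_eqvI)
    show "(B, q ` F) \<in> Mod l" using ModB A by blast
    fix x y assume "x \<in> carrier B" "y \<in> carrier B" and xy: "(x, y) \<in> Suszko l B (q ` F)"
    then obtain a b where ab: "a \<in> carrier A" "b \<in> carrier A" "x = q a" "y = q b"
      by (auto simp: B_def)
    have "(a, b) \<in> ?\<theta>"
      unfolding Suszko_iff
    proof (intro allI impI)
      fix G assume G: "(A, G) \<in> Mod l" "F \<subseteq> G"
      have "(q a, q b) \<in> Leibniz (lang l) B (q ` G)"
        using SuszkoD[OF xy ModB[OF G] image_mono[OF G(2)]] ab by simp
      with iffD2[OF Leibniz_vimage[OF _ Mod_matrix[OF ModB[OF G]] hom onto ab(1,2)]]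
        Mod_matrix[OF G(1)]
      show "(a, b) \<in> Leibniz (lang l) A G"
        unfolding strict[OF G, symmetric] by blast
    qed
    then show "x = y" using q_eq ab by simp
  qed
  moreover have "F = {a \<in> carrier A. q a \<in> q ` F}" by (rule strict[OF A order.refl])
  ultimately show thesis using that[OF _ hom onto] by blast
qed

lemma interpretation_ofI:
  assumes "translation \<tau> (lang l) (lang l')"
    "\<And>A F. (A, F) \<in> Mod_eqv l' \<Longrightarrow> (trans_alg A \<tau>, F) \<in> Mod_eqv l"
  shows "interpretation_of \<tau> l l'"
  using assms unfolding interpretation_of_def by blast

lemma interpretation_ofD:
  assumes "interpretation_of \<tau> l l'"
  shows "translation \<tau> (lang l) (lang l')"
    "(A, F) \<in> Mod_eqv l' \<Longrightarrow> (trans_alg A \<tau>, F) \<in> Mod_eqv l"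
  using assms unfolding interpretation_of_def by blast+

text \<open>The definition of an interpretation constrains reduced models only; all other models are strict
  preimages of reduced ones, and translation preserves homomorphisms.\<close>

lemma interpretation_Mod:
  assumes "is_logic l" "is_logic l'" "interpretation_of \<tau> l l'" "(A, F) \<in> Mod l'"
  shows "(trans_alg A \<tau>, F) \<in> Mod l"
proof -
  have t: "translation \<tau> (lang l) (lang l')" using assms(3) by (simp add: interpretation_of_def)
  obtain q B H where q: "(B, H) \<in> Mod_eqv l'" "q \<in> homs (lang l') A B"
    and F: "F = {a \<in> carrier A. q a \<in> H}"
    by (rule Suszko_reduction[OF assms(2,4)])
  note A = Mod_matrix[OF assms(4)]
  have "(trans_alg B \<tau>, H) \<in> Mod l"
    by (rule Mod_eqv_Mod[OF interpretation_ofD(2)[OF assms(3) q(1)]])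
  then have "(trans_alg A \<tau>, {a \<in> carrier (trans_alg A \<tau>). q a \<in> H}) \<in> Mod l"
    using matrixD(1)[OF A] algebra_trans[OF t matrixD(2)[OF A]] homs_trans[OF t matrixD(2)[OF A] q(2)]
    by (intro Mod_vimage[OF assms(1)]) auto
  then show ?thesis unfolding F by simp
qed

text \<open>An identity holds in all Suszko-reduced models as soon as its instances in any context are
  interderivable: two values of its sides are then indistinguishable for every deductive filter.
  The context and its parameters involve only finitely many elements of the algebra, which are
  renamed by an injection into the variables of the logic.\<close>

lemma Mod_eqv_identity:
  assumes l: "is_logic l" and A: "(A, F) \<in> Mod_eqv l"
    and Fm: "\<phi> \<in> Fm (lang l) Y" "\<psi> \<in> Fm (lang l) Y"
    and v: "\<And>y. y \<in> Y \<Longrightarrow> v y \<in> carrier A"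
    and E: "\<And>Z \<delta> \<gamma> \<chi> z. (\<And>y. \<delta> y \<in> Fm (lang l) (elts (nvars l))) \<Longrightarrow>
      (\<And>y. \<gamma> y \<in> Fm (lang l) (elts (nvars l))) \<Longrightarrow> \<chi> \<in> Fm (lang l) Z \<Longrightarrow>
      entails l {subst (\<gamma>(z := subst \<delta> \<phi>)) \<chi>} (subst (\<gamma>(z := subst \<delta> \<psi>)) \<chi>) \<and>
      entails l {subst (\<gamma>(z := subst \<delta> \<psi>)) \<chi>} (subst (\<gamma>(z := subst \<delta> \<phi>)) \<chi>)"
  shows "eval A v \<phi> = eval A v \<psi>"
proof -
  note m = Mod_eqv_matrix[OF A]
  obtain z where z: "z \<notin> carrier A" using ex_not_in_small[OF matrixD(1)[OF m]] by blast
  have in_A: "eval A v \<phi> \<in> carrier A" "eval A v \<psi> \<in> carrier A"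
    using v by (auto intro: eval_closed[OF Fm(1) matrixD(2)[OF m]] eval_closed[OF Fm(2) matrixD(2)[OF m]])
  have "(eval A v \<phi>, eval A v \<psi>) \<in> Leibniz (lang l) A G" if G: "(A, G) \<in> Mod l" for G
  proof -
    have "eval A (id(z := eval A v \<phi>)) \<chi> \<in> G \<longleftrightarrow> eval A (id(z := eval A v \<psi>)) \<chi> \<in> G"
      if \<chi>: "\<chi> \<in> Fm (lang l) (insert z (carrier A))" for \<chi>
    proof -
      define N where "N = v ` vars \<phi> \<union> v ` vars \<psi> \<union> (vars \<chi> - {z})"
      have finN: "finite N" by (simp add: N_def finite_vars)
      have NA: "N \<subseteq> carrier A"
        using v Fm_vars[OF Fm(1)] Fm_vars[OF Fm(2)] Fm_vars[OF \<chi>] by (auto simp: N_def)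
      obtain r where r: "inj_on r N" "r ` N \<subseteq> elts (nvars l)"
        using finite_lepoll_infinite[OF is_logicD(3)[OF l] finN] unfolding lepoll_def by blast
      obtain x0 where x0: "x0 \<in> elts (nvars l)"
        using is_logicD(3)[OF l] by fastforce
      obtain a0 where a0: "a0 \<in> carrier A"
        using matrixD(2)[OF m] by (auto simp: algebra_def)
      define r1 where "r1 a = (if a \<in> N then r a else x0)" for a
      define r2 where "r2 x = (if x \<in> r ` N then inv_into N r x else a0)" for x
      have r1: "r1 a \<in> elts (nvars l)" for a using r x0 by (auto simp: r1_def)
      have r2: "r2 x \<in> carrier A" for x using NA a0 by (auto simp: r2_def inv_into_into)
      have r21: "r2 (r1 a) = a" if "a \<in> N" for a using that r by (simp add: r1_def r2_def)
      \<comment> \<open>rename each element that occurs to its variable; \<open>r2\<close> undoes this\<close>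
      define \<delta> where "\<delta> y = (Var (r1 (v y)) :: 'a fm)" for y
      define \<gamma> where "\<gamma> a = (Var (r1 a) :: 'a fm)" for a
      have ev: "eval A r2 (subst (\<gamma>(z := subst \<delta> \<xi>)) \<chi>) = eval A (id(z := eval A v \<xi>)) \<chi>"
        if \<xi>: "v ` vars \<xi> \<subseteq> N" for \<xi>
      proof -
        have *: "eval A r2 (subst \<delta> \<xi>) = eval A v \<xi>"
          unfolding eval_subst \<delta>_def by (rule eval_cong_vars) (use \<xi> r21 in auto)
        show ?thesis
          unfolding eval_subst by (rule eval_cong_vars) (auto simp: * \<gamma>_def N_def intro!: r21)
      qed
      have "\<delta> y \<in> Fm (lang l) (elts (nvars l))" "\<gamma> y \<in> Fm (lang l) (elts (nvars l))" for y
        using r1 by (simp_all add: \<delta>_def \<gamma>_def)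
      note e = E[of \<delta> \<gamma>, OF this \<chi>, of z]
      have v: "v ` vars \<phi> \<subseteq> N" "v ` vars \<psi> \<subseteq> N" by (auto simp: N_def)
      show ?thesis
        using ModD[OF G conjunct1[OF e], of r2] ModD[OF G conjunct2[OF e], of r2] r2 ev[OF v(1)] ev[OF v(2)]
        by auto
    qed
    then show ?thesis
      using in_A Leibniz_eq_indist_at[OF Mod_matrix[OF G] z] by (simp add: indist_at_def)
  qed
  then have "(eval A v \<phi>, eval A v \<psi>) \<in> Suszko l A F" unfolding Suszko_iff by blast
  then show ?thesis using Mod_eqvD[OF A] by blast
qed


section \<open>Interpretability is a preorder\<close>

text \<open>A translation of models that can be undone by another translation preserves the Suszko
  congruence: every filter remains a filter, and no congruence is added because the original operations are
  term functions of the translated algebra.\<close>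

lemma interpretation_ofI_inverse:
  assumes \<tau>: "translation \<tau> (lang l) (lang l')" and \<sigma>: "translation \<sigma> (lang l') (lang l)"
    and Mod: "\<And>A G. (A, G) \<in> Mod l' \<Longrightarrow> (trans_alg A \<tau>, G) \<in> Mod l"
    and eq: "\<And>A F. (A, F) \<in> Mod_eqv l' \<Longrightarrow> alg_eq (lang l') (trans_alg (trans_alg A \<tau>) \<sigma>) A"
  shows "interpretation_of \<tau> l l'"
proof (rule interpretation_ofI[OF \<tau>])
  fix A F assume A: "(A, F) \<in> Mod_eqv l'"
  show "(trans_alg A \<tau>, F) \<in> Mod_eqv l"
  proof (rule Mod_eqvI[OF Mod[OF Mod_eqv_Mod[OF A]]])
    fix a b assume ab: "(a, b) \<in> Suszko l (trans_alg A \<tau>) F"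
    have "(a, b) \<in> Leibniz (lang l') A G" if G: "(A, G) \<in> Mod l'" "F \<subseteq> G" for G
    proof -
      have "(a, b) \<in> Leibniz (lang l) (trans_alg A \<tau>) G" by (rule SuszkoD[OF ab Mod[OF G(1)] G(2)])
      then have "(a, b) \<in> Leibniz (lang l') (trans_alg (trans_alg A \<tau>) \<sigma>) G"
        using Leibniz_trans[OF \<sigma> matrix_trans[OF \<tau> Mod_matrix[OF G(1)]]] by blast
      then show ?thesis unfolding Leibniz_alg_eq[OF eq[OF A]] .
    qed
    then have "(a, b) \<in> Suszko l' A F" unfolding Suszko_iff by blast
    then show "a = b" by (rule Mod_eqvD[OF A])
  qed
qed

lemma compatible_expansion_interpretable:
  assumes "is_logic l" "compatible_expansion l l'"
  shows "interpretable l l'"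
proof -
  have "interpretation_of basic l l'"
  proof (rule interpretation_ofI)
    show "translation basic (lang l) (lang l')"
      using assms(2) translation_basic[of "lang l"] Fm_mono
      unfolding translation_def compatible_expansion_def by blast
    fix A F assume "(A, F) \<in> Mod_eqv l'"
    then have "(A, F) \<in> Mod_eqv l"
      using assms(2) unfolding compatible_expansion_def by blast
    then show "(trans_alg A basic, F) \<in> Mod_eqv l"
      using Mod_eqv_alg_eq[OF assms(1) alg_eq_sym[OF alg_eq_trans_basic]] by blast
  qed
  then show ?thesis unfolding interpretable_def by blast
qed

lemma interpretable_refl: "is_logic l \<Longrightarrow> interpretable l l"
  by (rule compatible_expansion_interpretable) (auto simp: compatible_expansion_def)

lemma interpretable_trans:
  assumes "is_logic l" "interpretable l l'" "interpretable l' l''"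
  shows "interpretable l l''"
proof -
  obtain \<tau> \<rho> where \<tau>: "interpretation_of \<tau> l l'" and \<rho>: "interpretation_of \<rho> l' l''"
    using assms unfolding interpretable_def by blast
  note t = interpretation_ofD(1)[OF \<tau>] interpretation_ofD(1)[OF \<rho>]
  have "interpretation_of (tr_comp \<rho> \<tau>) l l''"
  proof (rule interpretation_ofI[OF translation_comp[OF t]])
    fix A F assume "(A, F) \<in> Mod_eqv l''"
    then have "(trans_alg (trans_alg A \<rho>) \<tau>, F) \<in> Mod_eqv l"
      using interpretation_ofD(2)[OF \<rho>] interpretation_ofD(2)[OF \<tau>] by blast
    then show "(trans_alg A (tr_comp \<rho> \<tau>), F) \<in> Mod_eqv l"
      by (rule Mod_eqv_alg_eq[OF assms(1) alg_eq_trans_comp[OF t]])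
  qed
  then show ?thesis unfolding interpretable_def by blast
qed


section \<open>Logics induced by classes of matrices\<close>

lemma induced_simps [simp]:
  "lang (induced_logic L k M) = L" "nvars (induced_logic L k M) = k"
  by (simp_all add: induced_logic_def)

lemma entails_induced:
  "entails (induced_logic L k M) \<Gamma> \<phi> \<longleftrightarrow> \<Gamma> \<subseteq> Fm L (elts k) \<and> \<phi> \<in> Fm L (elts k) \<and>
    (\<forall>A F h. (A, F) \<in> M \<longrightarrow> h \<in> homs L (fm_alg L (elts k)) A \<longrightarrow> h ` \<Gamma> \<subseteq> F \<longrightarrow> h \<phi> \<in> F)"
  by (auto simp: induced_logic_def)

lemma entails_inducedI:
  assumes "\<Gamma> \<subseteq> Fm L (elts k)" "\<phi> \<in> Fm L (elts k)"
    and "\<And>A F v. (A, F) \<in> M \<Longrightarrow> (\<And>x. x \<in> elts k \<Longrightarrow> v x \<in> carrier A) \<Longrightarrow>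
      (\<And>\<gamma>. \<gamma> \<in> \<Gamma> \<Longrightarrow> eval A v \<gamma> \<in> F) \<Longrightarrow> eval A v \<phi> \<in> F"
  shows "entails (induced_logic L k M) \<Gamma> \<phi>"
  unfolding entails_induced
proof (intro conjI assms(1,2) allI impI)
  fix A F h assume M: "(A, F) \<in> M" and h: "h \<in> homs L (fm_alg L (elts k)) A" "h ` \<Gamma> \<subseteq> F"
  have "eval A (\<lambda>x. h (Var x)) \<phi> \<in> F"
  proof (rule assms(3)[OF M])
    show "h (Var x) \<in> carrier A" if "x \<in> elts k" for x
      using homs_in[OF h(1)] that by simp
    show "eval A (\<lambda>x. h (Var x)) \<gamma> \<in> F" if "\<gamma> \<in> \<Gamma>" for \<gamma>
    proof -
      have "\<gamma> \<in> Fm L (elts k)" using that assms(1) by blast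
      from hom_fm_eq_eval[OF h(1) this] show ?thesis using h(2) that by auto
    qed
  qed
  then show "h \<phi> \<in> F" using hom_fm_eq_eval[OF h(1) assms(2)] by simp
qed

lemma homs_comp:
  assumes "g \<in> homs L A B" "h \<in> homs L B C" "algebra L A"
  shows "(\<lambda>a. h (g a)) \<in> homs L A C"
proof (rule homsI)
  show "h (g a) \<in> carrier C" if "a \<in> carrier A" for a
    using homs_in[OF assms(2) homs_in[OF assms(1) that]] .
  fix s as assume s: "s \<in> L" "length as = snd s" "set as \<subseteq> carrier A"
  have "set (map g as) \<subseteq> carrier B" using s(3) homs_in[OF assms(1)] by auto
  then show "h (g (oper A s as)) = oper C s (map (\<lambda>a. h (g a)) as)"
    using homs_oper[OF assms(1) s] homs_oper[OF assms(2) s(1), of "map g as"] s(2) by (simp add: comp_def)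
qed

lemma algebra_fm_alg:
  assumes "x \<in> X" shows "algebra L (fm_alg L X)"
proof (rule algebraI)
  have "Var x \<in> carrier (fm_alg L X)" using assms by simp
  then show "carrier (fm_alg L X) \<noteq> {}" by blast
qed (simp add: Fm_App_iff)

lemma is_logic_induced:
  assumes "language L" "Cardinal k" "infinite (elts k)"
  shows "is_logic (induced_logic L k M)"
proof -
  let ?l = "induced_logic L k M"
  let ?T = "fm_alg L (elts k)"
  have T: "fmL_alg ?l = ?T" "FmL ?l = Fm L (elts k)"
    by (simp_all add: fmL_alg_def FmL_def)
  obtain x where "x \<in> elts k" using assms(3) by fastforce
  then have alg: "algebra L ?T" by (rule algebra_fm_alg)
  have mono: "entails ?l \<Gamma> \<gamma>" if "\<Gamma> \<subseteq> Fm L (elts k)" "\<gamma> \<in> \<Gamma>" for \<Gamma> \<gamma>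
    using that unfolding entails_induced by blast
  have cut: "entails ?l \<Gamma> \<phi>"
    if "\<Gamma> \<subseteq> Fm L (elts k)" "\<forall>\<delta>\<in>\<Delta>. entails ?l \<Gamma> \<delta>" "entails ?l \<Delta> \<phi>" for \<Gamma> \<Delta> \<phi>
    unfolding entails_induced
  proof (intro conjI allI impI)
    show "\<Gamma> \<subseteq> Fm L (elts k)" "\<phi> \<in> Fm L (elts k)" using that entails_induced by blast+
    fix A F h assume M: "(A, F) \<in> M" and h: "h \<in> homs L ?T A" "h ` \<Gamma> \<subseteq> F"
    have "h \<delta> \<in> F" if "\<delta> \<in> \<Delta>" for \<delta>
      using \<open>\<forall>\<delta>\<in>\<Delta>. entails ?l \<Gamma> \<delta>\<close> that M h unfolding entails_induced by blast
    then have "h ` \<Delta> \<subseteq> F" by blast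
    then show "h \<phi> \<in> F" using that(3) M h(1) unfolding entails_induced by blast
  qed
  have sub: "entails ?l (\<sigma> ` \<Gamma>) (\<sigma> \<phi>)" if e: "entails ?l \<Gamma> \<phi>" and \<sigma>: "\<sigma> \<in> homs L ?T ?T" for \<Gamma> \<phi> \<sigma>
    unfolding entails_induced
  proof (intro conjI allI impI)
    have \<Gamma>: "\<Gamma> \<subseteq> Fm L (elts k)" "\<phi> \<in> Fm L (elts k)" using e entails_induced by blast+
    then show "\<sigma> ` \<Gamma> \<subseteq> Fm L (elts k)" "\<sigma> \<phi> \<in> Fm L (elts k)"
      using homs_in[OF \<sigma>] by auto
    fix A F h assume M: "(A, F) \<in> M" and h: "h \<in> homs L ?T A" "h ` \<sigma> ` \<Gamma> \<subseteq> F"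
    have "(\<lambda>t. h (\<sigma> t)) \<in> homs L ?T A" by (rule homs_comp[OF \<sigma> h(1) alg])
    moreover have "(\<lambda>t. h (\<sigma> t)) ` \<Gamma> \<subseteq> F" using h(2) by auto
    ultimately show "h (\<sigma> \<phi>) \<in> F" using e M unfolding entails_induced by blast
  qed
  show ?thesis
    unfolding is_logic_def T induced_simps
  proof (intro conjI assms allI impI ballI; (elim conjE)?)
    show "\<Gamma> \<subseteq> Fm L (elts k)" "\<phi> \<in> Fm L (elts k)" if "entails ?l \<Gamma> \<phi>" for \<Gamma> \<phi>
      using that unfolding entails_induced by blast+
    show "entails ?l \<Gamma> \<gamma>" if "\<Gamma> \<subseteq> Fm L (elts k)" "\<gamma> \<in> \<Gamma>" for \<Gamma> \<gamma>
      by (rule mono[OF that])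
    show "entails ?l \<Gamma> \<phi>"
      if "\<Gamma> \<subseteq> Fm L (elts k)" "\<forall>\<delta>\<in>\<Delta>. entails ?l \<Gamma> \<delta>" "entails ?l \<Delta> \<phi>" for \<Gamma> \<Delta> \<phi>
      by (rule cut[OF that])
    show "entails ?l (\<sigma> ` \<Gamma>) (\<sigma> \<phi>)" if "\<sigma> \<in> homs L ?T ?T" "entails ?l \<Gamma> \<phi>" for \<Gamma> \<phi> \<sigma>
      by (rule sub[OF that(2,1)])
  qed
qed

lemma induced_Mod:
  assumes "language L" "Cardinal k" "infinite (elts k)" "matrix L (A, F)" "(A, F) \<in> M"
  shows "(A, F) \<in> Mod (induced_logic L k M)"
  using assms(4,5) unfolding Mod_def entails_induced by (auto simp: fmL_alg_def)

text \<open>Models respect a valid inference in an arbitrary set of variables as long as it is no larger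
  than the set of variables of the logic, into which it can then be renamed.\<close>

lemma induced_Mod_eval:
  assumes A: "(A, G) \<in> Mod (induced_logic L k M)" and X: "X \<lesssim> elts k"
    and Fm: "\<Gamma> \<subseteq> Fm L X" "\<phi> \<in> Fm L X"
    and sound: "\<And>B H w. (B, H) \<in> M \<Longrightarrow> (\<And>x. x \<in> X \<Longrightarrow> w x \<in> carrier B) \<Longrightarrow>
      (\<And>\<gamma>. \<gamma> \<in> \<Gamma> \<Longrightarrow> eval B w \<gamma> \<in> H) \<Longrightarrow> eval B w \<phi> \<in> H"
    and v: "\<And>x. x \<in> X \<Longrightarrow> v x \<in> carrier A" and prem: "\<And>\<gamma>. \<gamma> \<in> \<Gamma> \<Longrightarrow> eval A v \<gamma> \<in> G"
  shows "eval A v \<phi> \<in> G"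
proof -
  obtain r where r: "inj_on r X" "r ` X \<subseteq> elts k" using X unfolding lepoll_def by blast
  have alg: "algebra L A" using matrixD(2)[OF Mod_matrix[OF A]] by simp
  then obtain a0 where a0: "a0 \<in> carrier A" by (auto simp: algebra_def)
  define \<rho> where "\<rho> = subst (\<lambda>x. Var (r x) :: 'a fm)"
  have \<rho>_Fm: "\<rho> t \<in> Fm L (elts k)" if "t \<in> Fm L X" for t
    unfolding \<rho>_def by (rule subst_closed[OF that]) (use r in auto)
  have \<rho>_eval: "eval B w (\<rho> t) = eval B (\<lambda>x. w (r x)) t" for B and w :: "'a \<Rightarrow> 'a" and t
    by (simp add: \<rho>_def eval_subst)
  have "entails (induced_logic L k M) (\<rho> ` \<Gamma>) (\<rho> \<phi>)"
  proof (rule entails_inducedI)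
    show "\<rho> ` \<Gamma> \<subseteq> Fm L (elts k)" "\<rho> \<phi> \<in> Fm L (elts k)" using \<rho>_Fm Fm by auto
    fix B H w assume B: "(B, H) \<in> M" "\<And>x. x \<in> elts k \<Longrightarrow> w x \<in> carrier B"
      "\<And>\<gamma>. \<gamma> \<in> \<rho> ` \<Gamma> \<Longrightarrow> eval B w \<gamma> \<in> H"
    show "eval B w (\<rho> \<phi>) \<in> H"
      unfolding \<rho>_eval
    proof (rule sound[OF B(1)])
      show "w (r x) \<in> carrier B" if "x \<in> X" for x using B(2) r that by blast
      show "eval B (\<lambda>x. w (r x)) \<gamma> \<in> H" if "\<gamma> \<in> \<Gamma>" for \<gamma>
        using B(3)[of "\<rho> \<gamma>"] that by (simp add: \<rho>_eval)
    qed
  qed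
  note e = this
  define w where "w y = (if y \<in> r ` X then v (inv_into X r y) else a0)" for y
  have w: "w y \<in> carrier A" for y using v a0 by (auto simp: w_def inv_into_into)
  have w_eval: "eval A w (\<rho> t) = eval A v t" if "t \<in> Fm L X" for t
    unfolding \<rho>_eval by (rule eval_cong[OF that]) (use r in \<open>simp add: w_def\<close>)
  have "eval A w (\<rho> \<phi>) \<in> G"
    by (rule ModD[OF A e]) (use w w_eval Fm prem in \<open>auto simp: subset_iff\<close>)
  then show ?thesis using w_eval[OF Fm(2)] by simp
qed


section \<open>Trivial matrices\<close>

definition triv_alg :: "'v::zfc \<Rightarrow> ('v, 'v) alg"
  where "triv_alg a = \<lparr>carrier = {a}, oper = (\<lambda>_ _. a)\<rparr>"

lemma triv_simps [simp]: "carrier (triv_alg a) = {a}" "oper (triv_alg a) s as = a"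
  by (simp_all add: triv_alg_def)

lemma algebra_triv: "algebra L (triv_alg a)"
  by (rule algebraI) auto

lemma triv_Mod_eqv:
  assumes "is_logic l" shows "(triv_alg a, {a}) \<in> Mod_eqv l"
proof (rule Mod_eqvI)
  show "(triv_alg a, {a}) \<in> Mod l"
  proof (rule ModI[OF assms])
    show "matrix (lang l) (triv_alg a, {a})" by (simp add: matrix_def algebra_triv)
    fix \<Gamma> \<phi> v
    assume e: "entails l \<Gamma> \<phi>" and v: "\<And>x. x \<in> elts (nvars l) \<Longrightarrow> v x \<in> carrier (triv_alg a)"
    have "eval (triv_alg a) v \<phi> \<in> carrier (triv_alg a)"
      by (rule eval_closed[OF is_logicD(5)[OF assms e] algebra_triv v])
    then show "eval (triv_alg a) v \<phi> \<in> {a}" by simp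
  qed
qed auto


section \<open>Non-indexed products\<close>

text \<open>The empty product is a separate case of the definition and is treated below.\<close>

locale product =
  fixes I :: "'v::zfc set" and l :: "'v \<Rightarrow> 'v logic"
  assumes small_I: "small I" and I_nonempty: "I \<noteq> {}" and logics: "i \<in> I \<Longrightarrow> is_logic (l i)"
begin

abbreviation "PL \<equiv> prod_lang I (\<lambda>i. lang (l i))"
abbreviation "\<kappa> \<equiv> prod_nvars I (\<lambda>i. nvars (l i))"
abbreviation "PM \<equiv> {prod_matrix I M | M. \<forall>i\<in>I. M i \<in> Mod_eqv (l i)}"
abbreviation "P \<equiv> nonindexed_product I l"

lemma P_eq: "P = induced_logic PL \<kappa> PM"
  using I_nonempty by (simp add: nonindexed_product_def)

lemma P_simps [simp]: "lang P = PL" "nvars P = \<kappa>"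
  by (simp_all add: P_eq)

definition tuple_sym :: "('v \<Rightarrow> 'v fm) \<Rightarrow> nat \<Rightarrow> 'v sym"
  where "tuple_sym \<phi> n = (vlam I (\<lambda>i. fm_code (\<phi> i)), n)"

text \<open>The \<open>i\<close>-th term in a symbol of the product.  As a function of the symbol, this is the translation of
  the product language into that of the \<open>i\<close>-th factor for which projections are homomorphisms.\<close>

definition entry :: "'v \<Rightarrow> 'v sym \<Rightarrow> 'v fm"
  where "entry i s = inv fm_code (vapp (fst s) i)"

lemma snd_tuple_sym [simp]: "snd (tuple_sym \<phi> n) = n"
  by (simp add: tuple_sym_def)

lemma entry_tuple_sym: "i \<in> I \<Longrightarrow> entry i (tuple_sym \<phi> n) = \<phi> i"
  by (simp add: entry_def tuple_sym_def vapp_vlam[OF small_I])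

lemma tuple_sym_in: "n \<ge> 1 \<Longrightarrow> (\<And>i. i \<in> I \<Longrightarrow> \<phi> i \<in> Fm (lang (l i)) (vars_upto n)) \<Longrightarrow> tuple_sym \<phi> n \<in> PL"
  unfolding prod_lang_def tuple_sym_def by blast

lemma PL_cases:
  assumes "s \<in> PL"
  obtains \<phi> n where "s = tuple_sym \<phi> n" "n \<ge> 1" "\<And>i. i \<in> I \<Longrightarrow> \<phi> i \<in> Fm (lang (l i)) (vars_upto n)"
  using assms unfolding prod_lang_def tuple_sym_def by blast

lemma translation_entry: "i \<in> I \<Longrightarrow> translation (entry i) PL (lang (l i))"
  unfolding translation_def by (auto elim!: PL_cases simp: entry_tuple_sym)

lemma language_PL: "language PL"
  unfolding language_def
proof (intro conjI ballI)
  have "fst ` PL \<subseteq> vprod I (\<lambda>i. fm_code ` Fm (lang (l i)) (elts omega))"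
  proof
    fix x assume "x \<in> fst ` PL"
    then obtain s where s: "s \<in> PL" "x = fst s" by blast
    from s(1) obtain \<phi> n where "s = tuple_sym \<phi> n"
      and \<phi>: "\<And>i. i \<in> I \<Longrightarrow> \<phi> i \<in> Fm (lang (l i)) (vars_upto n)"
      by (rule PL_cases) blast
    then have x: "x = vlam I (\<lambda>i. fm_code (\<phi> i))" using s(2) by (simp add: tuple_sym_def)
    have "\<phi> i \<in> Fm (lang (l i)) (elts omega)" if "i \<in> I" for i
      using \<phi>[OF that] by (rule Fm_mono) (auto simp: vars_upto_def elts_omega)
    then show "x \<in> vprod I (\<lambda>i. fm_code ` Fm (lang (l i)) (elts omega))"
      unfolding x using vlam_in_vprod[OF small_I] by blast
  qed
  moreover have "small (vprod I (\<lambda>i. fm_code ` Fm (lang (l i)) (elts omega)))"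
    using is_logicD(1)[OF logics] by (intro small_vprod small_I small_Fm) (auto simp: language_def)
  ultimately show "small (fst ` PL)" by (rule small_subset[rotated])
  show "1 \<le> snd s" if "s \<in> PL" for s using that by (auto elim: PL_cases)
qed

lemma Cardinal_nvars: "i \<in> I \<Longrightarrow> Cardinal (nvars (l i))"
  using is_logicD(2) logics by blast

lemma is_logic_P: "is_logic P"
  unfolding P_eq
  by (rule is_logic_induced[OF language_PL Cardinal_prod_nvars[OF small_I Cardinal_nvars]
        infinite_prod_nvars[OF small_I Cardinal_nvars]])

lemma infinite_\<kappa>: "infinite (elts \<kappa>)"
  using is_logicD(3)[OF is_logic_P] by simp

lemma prod_simps [simp]:
  "carrier (prod_alg I A) = vprod I (\<lambda>i. carrier (A i))"
  "oper (prod_alg I A) s as = vlam I (\<lambda>i. term_fun (A i) (entry i s) (map (\<lambda>a. vapp a i) as))"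
  by (simp_all add: prod_alg_def entry_def)

lemma algebra_prod:
  assumes "\<And>i. i \<in> I \<Longrightarrow> algebra (lang (l i)) (A i)"
  shows "algebra PL (prod_alg I A)"
proof (rule algebraI)
  have "\<exists>a. \<forall>i\<in>I. a i \<in> carrier (A i)"
    using assms unfolding algebra_def by (intro bchoice) blast
  then show "carrier (prod_alg I A) \<noteq> {}"
    using vlam_in_vprod[OF small_I, of _ "\<lambda>i. carrier (A i)"] by auto
  fix s as assume s: "s \<in> PL" "length as = snd s" and as: "set as \<subseteq> carrier (prod_alg I A)"
  have "term_fun (A i) (entry i s) (map (\<lambda>a. vapp a i) as) \<in> carrier (A i)" if i: "i \<in> I" for i
    using translation_Fm[OF translation_entry[OF i] s(1)] assms[OF i]
    by (rule term_fun_closed) (use s as i vapp_in[OF small_I] in auto)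
  then show "oper (prod_alg I A) s as \<in> carrier (prod_alg I A)"
    by (simp add: vlam_in_vprod[OF small_I])
qed

lemma proj_hom: "i \<in> I \<Longrightarrow> (\<lambda>x. vapp x i) \<in> homs PL (prod_alg I A) (trans_alg (A i) (entry i))"
  by (rule homsI) (auto simp: vapp_vlam[OF small_I] dest: vapp_in[OF small_I])

lemma proj_eval:
  assumes "i \<in> I" "\<And>i. i \<in> I \<Longrightarrow> algebra (lang (l i)) (A i)" "t \<in> Fm PL X"
    "\<And>x. x \<in> X \<Longrightarrow> w x \<in> vprod I (\<lambda>i. carrier (A i))"
  shows "vapp (eval (prod_alg I A) w t) i = eval (trans_alg (A i) (entry i)) (\<lambda>x. vapp (w x) i) t"
  using assms by (intro hom_eval[OF assms(3) proj_hom algebra_prod]) auto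

lemma PM_cases:
  assumes "(B, H) \<in> PM"
  obtains A F where "B = prod_alg I A" "H = vprod I F" "\<And>i. i \<in> I \<Longrightarrow> (A i, F i) \<in> Mod_eqv (l i)"
    "\<And>i. i \<in> I \<Longrightarrow> algebra (lang (l i)) (A i)"
proof -
  obtain M where M: "(B, H) = prod_matrix I M" "\<forall>i\<in>I. M i \<in> Mod_eqv (l i)" using assms by blast
  have *: "(fst (M i), snd (M i)) \<in> Mod_eqv (l i)" if "i \<in> I" for i using M(2) that by simp
  show thesis
    by (rule that[of "\<lambda>i. fst (M i)" "\<lambda>i. snd (M i)"])
      (use M(1) * matrixD(2)[OF Mod_eqv_matrix[OF *]] in \<open>auto simp: prod_matrix_def\<close>)
qed

lemma product_Mod:
  assumes "\<And>i. i \<in> I \<Longrightarrow> (A i, F i) \<in> Mod_eqv (l i)"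
  shows "(prod_alg I A, vprod I F) \<in> Mod P"
proof -
  have m: "matrix (lang (l i)) (A i, F i)" if "i \<in> I" for i
    using Mod_eqv_matrix[OF assms[OF that]] .
  have "prod_matrix I (\<lambda>i. (A i, F i)) \<in> PM" using assms by blast
  then have "(prod_alg I A, vprod I F) \<in> PM" by (simp add: prod_matrix_def)
  moreover have "matrix PL (prod_alg I A, vprod I F)"
  proof -
    have "small (vprod I (\<lambda>i. carrier (A i)))" by (rule small_vprod[OF small_I]) (rule matrixD(1)[OF m])
    moreover have "vprod I F \<subseteq> vprod I (\<lambda>i. carrier (A i))"
      using matrixD(3)[OF m] unfolding vprod_def by blast
    ultimately show ?thesis
      using algebra_prod[OF matrixD(2)[OF m]] by (simp add: matrix_def)
  qed
  ultimately show ?thesis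
    using is_logicD(1-3)[OF is_logic_P] unfolding P_eq by (intro induced_Mod) auto
qed


subsection \<open>The product is a lower bound\<close>

text \<open>The translation of the \<open>i\<close>-th language into the product language that lets a symbol act in coordinate
  \<open>i\<close> and the first projection in all others.  It is a section of \<open>entry i\<close>.\<close>

definition sig :: "'v \<Rightarrow> 'v sym \<Rightarrow> 'v fm"
  where "sig i s = basic (tuple_sym (\<lambda>k. if k = i then basic s else Var (vnat 1)) (snd s))"

lemma sig_in:
  assumes "i \<in> I" "s \<in> lang (l i)"
  shows "tuple_sym (\<lambda>k. if k = i then basic s else Var (vnat 1)) (snd s) \<in> PL"
proof (rule tuple_sym_in)
  show n: "1 \<le> snd s" using is_logicD(1)[OF logics[OF assms(1)]] assms(2) by (simp add: language_def)
  show "(if k = i then basic s else Var (vnat 1)) \<in> Fm (lang (l k)) (vars_upto (snd s))" for k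
    using basic_Fm[OF assms(2)] n by (auto simp: vars_upto_def)
qed

lemma translation_sig: "i \<in> I \<Longrightarrow> translation (sig i) (lang (l i)) PL"
  unfolding translation_def sig_def using basic_Fm[OF sig_in] by auto

lemma alg_eq_sig:
  assumes "i \<in> I"
  shows "alg_eq (lang (l i)) (trans_alg (trans_alg A (entry i)) (sig i)) A"
  unfolding alg_eq_def
proof (intro conjI ballI impI)
  fix s as assume "s \<in> lang (l i)" "as \<in> lists (carrier (trans_alg (trans_alg A (entry i)) (sig i)))"
    "length as = snd s"
  then show "oper (trans_alg (trans_alg A (entry i)) (sig i)) s as = oper A s as"
    using assms by (simp add: sig_def term_fun_basic entry_tuple_sym)
qed simp

lemma proj_tr:
  assumes i: "i \<in> I" and A: "\<And>i. i \<in> I \<Longrightarrow> algebra (lang (l i)) (A i)" and t: "t \<in> Fm (lang (l i)) X"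
    and w: "\<And>x. x \<in> X \<Longrightarrow> w x \<in> vprod I (\<lambda>i. carrier (A i))"
  shows "vapp (eval (prod_alg I A) w (tr (sig i) t)) i = eval (A i) (\<lambda>x. vapp (w x) i) t"
proof -
  have w': "vapp (w x) i \<in> carrier (A i)" if "x \<in> X" for x using vapp_in[OF small_I w[OF that] i] .
  have "vapp (eval (prod_alg I A) w (tr (sig i) t)) i
      = eval (trans_alg (A i) (entry i)) (\<lambda>x. vapp (w x) i) (tr (sig i) t)"
    using i A w by (intro proj_eval[OF _ _ tr_closed[OF translation_sig t]])
  also have "\<dots> = eval (trans_alg (trans_alg (A i) (entry i)) (sig i)) (\<lambda>x. vapp (w x) i) t"
    by (rule eval_tr[OF translation_sig[OF i] t])
  also have "\<dots> = eval (A i) (\<lambda>x. vapp (w x) i) t"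
    by (rule alg_eq_eval[OF t alg_eq_sym[OF alg_eq_sig[OF i]] A[OF i] w'])
  finally show ?thesis .
qed

text \<open>For a reduced model \<open>B\<close> of the \<open>j\<close>-th factor, \<open>B\<close> read in the product language is isomorphic to the
  product of \<open>B\<close> with trivial matrices at all other places.  Other models are strict preimages of
  reduced ones.\<close>

lemma factor_Mod:
  assumes j: "j \<in> I" and A: "(A, G) \<in> Mod (l j)"
  shows "(trans_alg A (entry j), G) \<in> Mod P"
proof -
  note t = translation_entry[OF j]
  obtain q B H where B: "(B, H) \<in> Mod_eqv (l j)" and q: "q \<in> homs (lang (l j)) A B"
    and G: "G = {a \<in> carrier A. q a \<in> H}"
    by (rule Suszko_reduction[OF logics[OF j] A])
  note mB = Mod_eqv_matrix[OF B] and mA = Mod_matrix[OF A]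
  \<comment> \<open>the matrix \<open>(B, H)\<close> at place \<open>j\<close> and trivial ones elsewhere\<close>
  define C where "C i = (if i = j then B else triv_alg (vset {}))" for i
  define K where "K i = (if i = j then H else {vset {} :: 'v})" for i
  have CK: "(C i, K i) \<in> Mod_eqv (l i)" if "i \<in> I" for i
    using B triv_Mod_eqv[OF logics[OF that]] by (simp add: C_def K_def)
  define k where "k b = vlam I (\<lambda>i. if i = j then b else (vset {} :: 'v))" for b
  have hom: "k \<in> homs PL (trans_alg B (entry j)) (prod_alg I C)"
  proof (rule homsI)
    show "k b \<in> carrier (prod_alg I C)" if "b \<in> carrier (trans_alg B (entry j))" for b
      using that by (auto simp: k_def vlam_in_vprod[OF small_I] C_def)
    fix s as assume s: "s \<in> PL" "length as = snd s" "set as \<subseteq> carrier (trans_alg B (entry j))"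
    have "term_fun (C i) (entry i s) (map (\<lambda>a. vapp a i) (map k as)) = vset {}" if i: "i \<in> I" "i \<noteq> j" for i
    proof -
      have "term_fun (triv_alg (vset {})) (entry i s) (map (\<lambda>a. vapp a i) (map k as)) \<in> carrier (triv_alg (vset {}))"
        using translation_Fm[OF translation_entry[OF i(1)] s(1)] algebra_triv
        by (rule term_fun_closed) (use s i in \<open>auto simp: k_def vapp_vlam[OF small_I]\<close>)
      then show ?thesis using i by (simp add: C_def)
    qed
    moreover have "map (\<lambda>a. vapp a j) (map k as) = as"
      using j by (simp add: k_def vapp_vlam[OF small_I] map_idI)
    ultimately show "k (oper (trans_alg B (entry j)) s as) = oper (prod_alg I C) s (map k as)"
      by (auto simp: k_def C_def intro!: vlam_cong)
  qed
  have "(trans_alg B (entry j), {b \<in> carrier (trans_alg B (entry j)). k b \<in> vprod I K}) \<in> Mod P"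
    using hom algebra_trans[OF t matrixD(2)[OF mB]] matrixD(1)[OF mB] product_Mod[OF CK]
    by (intro Mod_vimage[OF is_logic_P]) auto
  moreover have "{b \<in> carrier (trans_alg B (entry j)). k b \<in> vprod I K} = H"
    using j matrixD(3)[OF mB] by (auto simp: k_def vlam_in_vprod[OF small_I] K_def)
  ultimately have "(trans_alg B (entry j), H) \<in> Mod P" by simp
  then have "(trans_alg A (entry j), {a \<in> carrier (trans_alg A (entry j)). q a \<in> H}) \<in> Mod P"
    using homs_trans[OF t matrixD(2)[OF mA] q] algebra_trans[OF t matrixD(2)[OF mA]] matrixD(1)[OF mA]
    by (intro Mod_vimage[OF is_logic_P]) auto
  then show ?thesis unfolding G by simp
qed

text \<open>The translation \<open>entry j\<close> preserves reducedness: each filter of the factor is one of the product, and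
  since \<open>sig j\<close> recovers the operations of the factor, reading an algebra in the product language
  creates no new congruences.\<close>

lemma product_lower:
  assumes "j \<in> I"
  shows "interpretable P (l j)"
proof -
  have "interpretation_of (entry j) P (l j)"
    using translation_entry[OF assms] translation_sig[OF assms] factor_Mod[OF assms] alg_eq_sig[OF assms]
    by (intro interpretation_ofI_inverse[of _ _ _ "sig j"]) simp_all
  then show ?thesis unfolding interpretable_def by blast
qed


subsection \<open>The product is the greatest lower bound\<close>

text \<open>The operation that takes coordinate \<open>i\<close> from its first argument and the others from the second.\<close>

definition D :: "'v \<Rightarrow> 'v sym"
  where "D i = tuple_sym (\<lambda>k. if k = i then Var (vnat 1) else Var (vnat 2)) 2"

lemma D_in: "D i \<in> PL"
  unfolding D_def by (rule tuple_sym_in) (auto simp: vars_upto_def)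

lemma snd_D [simp]: "snd (D i) = 2"
  by (simp add: D_def)

lemma D_Fm [simp]: "App (D i) [\<phi>, \<psi>] \<in> Fm PL X \<longleftrightarrow> \<phi> \<in> Fm PL X \<and> \<psi> \<in> Fm PL X"
  by (simp add: Fm_App_iff D_in)

lemma vapp_D:
  assumes "k \<in> I"
  shows "vapp (oper (prod_alg I A) (D i) [x, y]) k = (if k = i then vapp x k else vapp y k)"
  using assms by (simp add: vapp_vlam[OF small_I] D_def entry_tuple_sym term_fun_def)

lemma oper_entry_D:
  assumes "i \<in> I"
  shows "oper (trans_alg A (entry i)) (D i) [x, y] = x"
  using assms by (simp add: D_def entry_tuple_sym term_fun_def)

declare prod_simps(2) [simp del] trans_alg_simps(2) [simp del]

text \<open>An identity valid in all products of algebras stays valid in any context, so that its sides are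
  interderivable in the product logic.\<close>

lemma prod_identity:
  assumes A: "(A, F) \<in> Mod_eqv P" and Fm: "\<phi> \<in> Fm PL Y" "\<psi> \<in> Fm PL Y"
    and v: "\<And>y. y \<in> Y \<Longrightarrow> v y \<in> carrier A"
    and valid: "\<And>B w. (\<And>i. i \<in> I \<Longrightarrow> algebra (lang (l i)) (B i)) \<Longrightarrow>
      (\<And>y. w y \<in> vprod I (\<lambda>i. carrier (B i))) \<Longrightarrow> eval (prod_alg I B) w \<phi> = eval (prod_alg I B) w \<psi>"
  shows "eval A v \<phi> = eval A v \<psi>"
proof (rule Mod_eqv_identity[OF is_logic_P A _ _ v])
  show "\<phi> \<in> Fm (lang P) Y" "\<psi> \<in> Fm (lang P) Y" using Fm by simp_all
  fix Z \<delta> \<gamma> \<chi> z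
  assume \<delta>: "\<And>y :: 'v. \<delta> y \<in> Fm (lang P) (elts (nvars P))"
    and \<gamma>: "\<And>y :: 'v. \<gamma> y \<in> Fm (lang P) (elts (nvars P))"
    and \<chi>: "\<chi> \<in> Fm (lang P) Z"
  note in_Fm = context_closed[OF _ \<delta> \<gamma> \<chi>, unfolded P_simps]
  have eq: "eval B h (subst (\<gamma>(z := subst \<delta> \<phi>)) \<chi>) = eval B h (subst (\<gamma>(z := subst \<delta> \<psi>)) \<chi>)"
    if B: "(B, H) \<in> PM" and h: "\<And>x. x \<in> elts \<kappa> \<Longrightarrow> h x \<in> carrier B" for B H h
  proof -
    obtain C K where C: "B = prod_alg I C" "\<And>i. i \<in> I \<Longrightarrow> algebra (lang (l i)) (C i)"
      using PM_cases[OF B] by metis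
    have "eval B h (\<delta> y) \<in> vprod I (\<lambda>i. carrier (C i))" for y
      using eval_closed[OF \<delta>, of B h y] h algebra_prod[OF C(2)] C(1) by simp
    then have "eval B h (subst \<delta> \<phi>) = eval B h (subst \<delta> \<psi>)"
      unfolding eval_subst C(1) using valid C by simp
    then show ?thesis
      unfolding eval_subst[where t = \<chi>] by (intro eval_cong_vars) simp
  qed
  show "entails P {subst (\<gamma>(z := subst \<delta> \<phi>)) \<chi>} (subst (\<gamma>(z := subst \<delta> \<psi>)) \<chi>) \<and>
      entails P {subst (\<gamma>(z := subst \<delta> \<psi>)) \<chi>} (subst (\<gamma>(z := subst \<delta> \<phi>)) \<chi>)"
    unfolding P_eq
  proof (intro conjI entails_inducedI)
    show "eval B h (subst (\<gamma>(z := subst \<delta> \<psi>)) \<chi>) \<in> H"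
      if B: "(B, H) \<in> PM" and h: "\<And>x. x \<in> elts \<kappa> \<Longrightarrow> h x \<in> carrier B"
        and prem: "\<And>\<gamma>'. \<gamma>' \<in> {subst (\<gamma>(z := subst \<delta> \<phi>)) \<chi>} \<Longrightarrow> eval B h \<gamma>' \<in> H" for B H h
      using prem eq[OF B h] by simp
    show "eval B h (subst (\<gamma>(z := subst \<delta> \<phi>)) \<chi>) \<in> H"
      if B: "(B, H) \<in> PM" and h: "\<And>x. x \<in> elts \<kappa> \<Longrightarrow> h x \<in> carrier B"
        and prem: "\<And>\<gamma>'. \<gamma>' \<in> {subst (\<gamma>(z := subst \<delta> \<psi>)) \<chi>} \<Longrightarrow> eval B h \<gamma>' \<in> H" for B H h
      using prem eq[OF B h] by simp
  qed (use in_Fm Fm in auto)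
qed

text \<open>An identity that is valid in coordinate \<open>i\<close> only becomes valid in products once both sides are
  inserted into \<open>D i\<close>.  The elements of \<open>A\<close> are the variables, with the identity as valuation.\<close>

lemma coord_identity:
  assumes A: "(A, F) \<in> Mod_eqv P" and i: "i \<in> I" and Fm: "\<phi> \<in> Fm PL (carrier A)" "\<psi> \<in> Fm PL (carrier A)"
    and c: "c \<in> carrier A"
    and valid: "\<And>B w. (\<And>i. i \<in> I \<Longrightarrow> algebra (lang (l i)) (B i)) \<Longrightarrow>
      (\<And>y. w y \<in> vprod I (\<lambda>i. carrier (B i))) \<Longrightarrow>
      vapp (eval (prod_alg I B) w \<phi>) i = vapp (eval (prod_alg I B) w \<psi>) i"
  shows "oper A (D i) [eval A id \<phi>, c] = oper A (D i) [eval A id \<psi>, c]"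
proof -
  have "eval A id (App (D i) [\<phi>, Var c]) = eval A id (App (D i) [\<psi>, Var c])"
  proof (rule prod_identity[OF A])
    show "App (D i) [\<phi>, Var c] \<in> Fm PL (carrier A)" "App (D i) [\<psi>, Var c] \<in> Fm PL (carrier A)"
      using Fm c by simp_all
    fix B :: "'v \<Rightarrow> ('v, 'v) alg" and w :: "'v \<Rightarrow> 'v"
    assume B: "\<And>i. i \<in> I \<Longrightarrow> algebra (lang (l i)) (B i)" "\<And>y. w y \<in> vprod I (\<lambda>i. carrier (B i))"
    note cl = eval_closed[OF _ algebra_prod[OF B(1)], where v = w]
    show "eval (prod_alg I B) w (App (D i) [\<phi>, Var c]) = eval (prod_alg I B) w (App (D i) [\<psi>, Var c])"
    proof (rule vprod_eqI[OF small_I])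
      show "eval (prod_alg I B) w (App (D i) [\<phi>, Var c]) \<in> vprod I (\<lambda>i. carrier (B i))"
        using cl[of "App (D i) [\<phi>, Var c]" "carrier A"] B Fm c by simp
      show "eval (prod_alg I B) w (App (D i) [\<psi>, Var c]) \<in> vprod I (\<lambda>i. carrier (B i))"
        using cl[of "App (D i) [\<psi>, Var c]" "carrier A"] B Fm c by simp
      show "vapp (eval (prod_alg I B) w (App (D i) [\<phi>, Var c])) k =
          vapp (eval (prod_alg I B) w (App (D i) [\<psi>, Var c])) k" if "k \<in> I" for k
        using valid[OF B] that by (auto simp: vapp_D)
    qed
  qed simp
  then show ?thesis by simp
qed

lemma D_D:
  assumes A: "(A, F) \<in> Mod_eqv P" and i: "i \<in> I" and "a \<in> carrier A" "c \<in> carrier A" "e \<in> carrier A"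
  shows "oper A (D i) [oper A (D i) [a, c], e] = oper A (D i) [a, e]"
proof -
  have "oper A (D i) [eval A id (App (D i) [Var a, Var c]), e] = oper A (D i) [eval A id (Var a), e]"
    using assms by (intro coord_identity[OF A i]) (simp_all add: vapp_D)
  then show ?thesis by simp
qed

text \<open>The \<open>i\<close>-th factor of a reduced model of the product: if \<open>A\<close> is a genuine product, this is a copy of
  the \<open>i\<close>-th algebra, made up of the elements that agree with \<open>c\<close> outside of coordinate \<open>i\<close>.  The map
  \<open>\<lambda>a. oper A (D i) [a, c]\<close> is a retraction onto it and plays the role of the \<open>i\<close>-th projection.\<close>

definition factor :: "('v, 'v) alg \<Rightarrow> 'v \<Rightarrow> 'v \<Rightarrow> ('v, 'v) alg"
  where "factor A c i = \<lparr>carrier = (\<lambda>a. oper A (D i) [a, c]) ` carrier A,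
    oper = (\<lambda>s as. oper A (D i) [term_fun A (sig i s) as, c])\<rparr>"

context
  fixes A :: "('v, 'v) alg" and F :: "'v set" and c :: 'v and i :: 'v
  assumes A: "(A, F) \<in> Mod_eqv P" and c: "c \<in> carrier A" and i: "i \<in> I"
begin

abbreviation "pr \<equiv> \<lambda>a. oper A (D i) [a, c]"
abbreviation "Ai \<equiv> factor A c i"

lemma algebra_A: "algebra PL A"
  using matrixD(2)[OF Mod_eqv_matrix[OF A]] by simp

lemma D_closed: "a \<in> carrier A \<Longrightarrow> b \<in> carrier A \<Longrightarrow> oper A (D i) [a, b] \<in> carrier A"
  by (rule algebra_oper[OF algebra_A D_in]) auto

lemma factor_carrier: "carrier Ai = pr ` carrier A"
  by (simp add: factor_def)

lemma factor_sub: "carrier Ai \<subseteq> carrier A"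
  unfolding factor_carrier using D_closed c by auto

lemma pr_fixed: "a \<in> carrier Ai \<Longrightarrow> pr a = a"
  unfolding factor_carrier using D_D[OF A i _ c c] by auto

lemma pr_hom_sig: "pr \<in> homs (lang (l i)) (trans_alg A (sig i)) Ai"
proof (rule homsI)
  show "pr a \<in> carrier Ai" if "a \<in> carrier (trans_alg A (sig i))" for a
    using that by (simp add: factor_carrier)
  fix s as assume s: "s \<in> lang (l i)" and len: "length as = snd s"
    and as: "set as \<subseteq> carrier (trans_alg A (sig i))"
  define S where "S = tuple_sym (\<lambda>k. if k = i then basic s else Var (vnat 1)) (snd s)"
  have S: "S \<in> PL" "snd S = snd s" "sig i s = basic S"
    using sig_in[OF i s] by (simp_all add: S_def sig_def)
  let ?\<phi> = "App S (map Var as)" and ?\<psi> = "App S (map (\<lambda>a. App (D i) [Var a, Var c]) as)"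
  have Fm: "?\<phi> \<in> Fm PL (carrier A)" "?\<psi> \<in> Fm PL (carrier A)"
    using S len as c by (auto simp: Fm_App_iff D_in)
  have "oper A (D i) [eval A id ?\<phi>, c] = oper A (D i) [eval A id ?\<psi>, c]"
  proof (rule coord_identity[OF A i Fm c])
    fix B :: "'v \<Rightarrow> ('v, 'v) alg" and w :: "'v \<Rightarrow> 'v"
    assume B: "\<And>i. i \<in> I \<Longrightarrow> algebra (lang (l i)) (B i)" "\<And>y. w y \<in> vprod I (\<lambda>i. carrier (B i))"
    have p: "vapp (eval (prod_alg I B) w t) i = eval (trans_alg (B i) (entry i)) (\<lambda>x. vapp (w x) i) t"
      if "t \<in> Fm PL (carrier A)" for t
      by (rule proj_eval[OF i B(1) that B(2)])
    show "vapp (eval (prod_alg I B) w ?\<phi>) i = vapp (eval (prod_alg I B) w ?\<psi>) i"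
      unfolding p[OF Fm(1)] p[OF Fm(2)]
      by (simp add: comp_def oper_entry_D[OF i])
  qed
  then have "pr (oper A S as) = pr (oper A S (map pr as))"
    by (simp add: comp_def)
  then show "pr (oper (trans_alg A (sig i)) s as) = oper Ai s (map pr as)"
    using S len by (simp add: factor_def trans_alg_simps(2) term_fun_basic)
qed

lemma algebra_A_sig: "algebra (lang (l i)) (trans_alg A (sig i))"
  by (rule algebra_trans[OF translation_sig[OF i] algebra_A])

lemma algebra_factor: "algebra (lang (l i)) Ai"
proof (rule algebraI)
  show "carrier Ai \<noteq> {}" using c by (auto simp: factor_carrier)
  fix s as assume s: "s \<in> lang (l i)" and len: "length as = snd s" and as: "set as \<subseteq> carrier Ai"
  have *: "map pr as = as" using as pr_fixed by (auto intro!: map_idI)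
  have sub: "set as \<subseteq> carrier (trans_alg A (sig i))" using as factor_sub by auto
  from homs_oper[OF pr_hom_sig s len this] homs_in[OF pr_hom_sig algebra_oper[OF algebra_A_sig s len sub]]
  show "oper Ai s as \<in> carrier Ai" using * by simp
qed

lemma pr_eval_tr:
  assumes "t \<in> Fm (lang (l i)) X" "\<And>x. x \<in> X \<Longrightarrow> v x \<in> carrier A"
  shows "pr (eval A v (tr (sig i) t)) = eval Ai (\<lambda>x. pr (v x)) t"
  unfolding eval_tr[OF translation_sig[OF i] assms(1)]
  using hom_eval[OF assms(1) pr_hom_sig algebra_A_sig] assms(2) by simp

text \<open>In coordinate \<open>i\<close>, a symbol of the product acts as its \<open>i\<close>-th term does, and \<open>sig i\<close> expresses that
  term by symbols of the product.\<close>

lemma pr_hom: "pr \<in> homs PL A (trans_alg Ai (entry i))"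
proof (rule homsI)
  show "pr a \<in> carrier (trans_alg Ai (entry i))" if "a \<in> carrier A" for a
    using that by (simp add: factor_carrier)
  fix s as assume s: "s \<in> PL" and len: "length as = snd s" and as: "set as \<subseteq> carrier A"
  let ?t = "entry i s"
  have t: "?t \<in> Fm (lang (l i)) (vars_upto (snd s))" by (rule translation_Fm[OF translation_entry[OF i] s])
  have arg: "arg as x \<in> carrier A" if "x \<in> vars_upto (snd s)" for x
    using arg_in[OF that len] as by blast
  let ?\<phi> = "App s (map Var as)" and ?\<psi> = "subst (\<lambda>x. Var (arg as x)) (tr (sig i) ?t)"
  have Fm: "?\<phi> \<in> Fm PL (carrier A)" "?\<psi> \<in> Fm PL (carrier A)"
    using s len as arg by (auto simp: Fm_App_iff intro!: subst_closed[OF tr_closed[OF translation_sig[OF i] t]])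
  have "oper A (D i) [eval A id ?\<phi>, c] = oper A (D i) [eval A id ?\<psi>, c]"
  proof (rule coord_identity[OF A i Fm c])
    fix B :: "'v \<Rightarrow> ('v, 'v) alg" and w :: "'v \<Rightarrow> 'v"
    assume B: "\<And>i. i \<in> I \<Longrightarrow> algebra (lang (l i)) (B i)" "\<And>y. w y \<in> vprod I (\<lambda>i. carrier (B i))"
    have p: "vapp (eval (prod_alg I B) w t) i = eval (trans_alg (B i) (entry i)) (\<lambda>x. vapp (w x) i) t"
      if "t \<in> Fm PL (carrier A)" for t
      by (rule proj_eval[OF i B(1) that B(2)])
    have "vapp (eval (prod_alg I B) w ?\<psi>) i = eval (B i) (\<lambda>x. vapp (w (arg as x)) i) ?t"
      using proj_tr[OF i B(1) t, where w = "\<lambda>x. w (arg as x)"] B(2) by (simp add: eval_subst)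
    also have "\<dots> = term_fun (B i) ?t (map (\<lambda>a. vapp (w a) i) as)"
      unfolding term_fun_eq by (rule eval_arg_map[OF t len, symmetric])
    also have "\<dots> = vapp (eval (prod_alg I B) w ?\<phi>) i"
      unfolding p[OF Fm(1)] by (simp add: comp_def trans_alg_simps(2))
    finally show "vapp (eval (prod_alg I B) w ?\<phi>) i = vapp (eval (prod_alg I B) w ?\<psi>) i" ..
  qed
  then have "pr (oper A s as) = pr (eval A (arg as) (tr (sig i) ?t))"
    by (simp add: comp_def eval_subst)
  also have "\<dots> = eval Ai (\<lambda>x. pr (arg as x)) ?t" by (rule pr_eval_tr[OF t arg])
  also have "\<dots> = oper (trans_alg Ai (entry i)) s (map pr as)"
    unfolding trans_alg_simps term_fun_eq by (rule eval_arg_map[OF t len, symmetric])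
  finally show "pr (oper A s as) = oper (trans_alg Ai (entry i)) s (map pr as)" .
qed

text \<open>An inference \<open>\<Gamma> \<turnstile> \<phi>\<close> of the \<open>i\<close>-th factor yields the inference from \<open>z\<close> and all \<open>D i (\<gamma>, z)\<close> to
  \<open>D i (\<phi>, z)\<close> in the product: coordinate \<open>i\<close> is taken care of by \<open>\<Gamma> \<turnstile> \<phi>\<close>, the others by \<open>z\<close>.  It
  needs one variable more than \<open>\<Gamma> \<turnstile> \<phi>\<close>; the product has enough variables, as it has infinitely many
  and no fewer than the factor.\<close>

lemma factor_filter:
  assumes G: "(A, G) \<in> Mod P" and e: "e \<in> G"
  shows "(Ai, {a \<in> carrier Ai. oper A (D i) [a, e] \<in> G}) \<in> Mod (l i)"
proof (rule ModI[OF logics[OF i]])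
  let ?Gi = "{a \<in> carrier Ai. oper A (D i) [a, e] \<in> G}"
  let ?k = "elts (nvars (l i))"
  have e_in: "e \<in> carrier A" using matrixD(3)[OF Mod_matrix[OF G]] e by blast
  have "small (carrier Ai)"
    using small_image matrixD(1)[OF Mod_eqv_matrix[OF A]] unfolding factor_carrier by blast
  then show "matrix (lang (l i)) (Ai, ?Gi)" using algebra_factor by (auto simp: matrix_def)
  fix \<Gamma> \<phi> w
  assume ent: "entails (l i) \<Gamma> \<phi>" and w: "\<And>x. x \<in> ?k \<Longrightarrow> w x \<in> carrier Ai"
    and \<Gamma>: "\<And>\<gamma>. \<gamma> \<in> \<Gamma> \<Longrightarrow> eval Ai w \<gamma> \<in> ?Gi"
  note Fm\<Gamma> = is_logicD(4)[OF logics[OF i] ent] and Fm\<phi> = is_logicD(5)[OF logics[OF i] ent]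
  have wA: "w x \<in> carrier A" if "x \<in> ?k" for x using w[OF that] factor_sub by blast
  have iff: "eval Ai w t \<in> ?Gi \<longleftrightarrow> oper A (D i) [eval A w (tr (sig i) t), e] \<in> G"
    if t: "t \<in> Fm (lang (l i)) ?k" for t
  proof -
    have "eval Ai w t = eval Ai (\<lambda>x. pr (w x)) t"
      by (rule eval_cong[OF t]) (simp add: pr_fixed w)
    also have "\<dots> = pr (eval A w (tr (sig i) t))"
      using pr_eval_tr[OF t wA] by simp
    finally have eq: "eval Ai w t = pr (eval A w (tr (sig i) t))" .
    have u: "eval A w (tr (sig i) t) \<in> carrier A"
      using wA by (rule eval_closed[OF tr_closed[OF translation_sig[OF i] t] algebra_A])
    have "eval Ai w t \<in> carrier Ai" by (rule eval_closed[OF t algebra_factor w])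
    then show ?thesis using D_D[OF A i u c e_in] unfolding eq by simp
  qed
  obtain z where z: "z \<notin> ?k" using ex_not_in_small[OF small_elts] by blast
  let ?X = "insert z ?k"
  let ?f = "\<lambda>t. App (D i) [tr (sig i) t, Var z]"
  have ev: "eval B (u(z := b)) (tr (sig i) t) = eval B u (tr (sig i) t)"
    if "t \<in> Fm (lang (l i)) ?k" for B :: "('v, 'v) alg" and u b t
    by (rule eval_cong[OF tr_closed[OF translation_sig[OF i] that]]) (use z in auto)
  have FmX: "?f t \<in> Fm PL ?X" if "t \<in> Fm (lang (l i)) ?k" for t
    using tr_closed[OF translation_sig[OF i] that] by (auto intro: Fm_mono)
  have "eval A (w(z := e)) (?f \<phi>) \<in> G"
  proof (rule induced_Mod_eval[OF G[unfolded P_eq], where X = ?X and \<Gamma> = "insert (Var z) (?f ` \<Gamma>)"])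
    have "?X \<lesssim> insert z (elts \<kappa>)"
      using prod_nvars_ge[where \<kappa> = "\<lambda>i. nvars (l i)", OF small_I Cardinal_nvars i] by (intro subset_imp_lepoll) auto
    also have "\<dots> \<lesssim> elts \<kappa>" by (rule infinite_insert_lepoll[OF infinite_\<kappa>])
    finally show "?X \<lesssim> elts \<kappa>" .
    show "insert (Var z) (?f ` \<Gamma>) \<subseteq> Fm PL ?X" using FmX Fm\<Gamma> by auto
    show "?f \<phi> \<in> Fm PL ?X" by (rule FmX[OF Fm\<phi>])
    show "(w(z := e)) x \<in> carrier A" if "x \<in> ?X" for x using that wA e_in by auto
    show "eval A (w(z := e)) \<gamma> \<in> G" if "\<gamma> \<in> insert (Var z) (?f ` \<Gamma>)" for \<gamma>
    proof -
      have "eval A (w(z := e)) (?f \<gamma>') \<in> G" if \<gamma>': "\<gamma>' \<in> \<Gamma>" for \<gamma>'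
      proof -
        have t: "\<gamma>' \<in> Fm (lang (l i)) ?k" using Fm\<Gamma> \<gamma>' by blast
        show ?thesis using iff[OF t] \<Gamma>[OF \<gamma>'] ev[OF t] by simp
      qed
      then show ?thesis using that e by auto
    qed
    fix B H u
    assume "(B, H) \<in> PM" and u: "\<And>x. x \<in> ?X \<Longrightarrow> u x \<in> carrier B"
      and prem: "\<And>\<gamma>. \<gamma> \<in> insert (Var z) (?f ` \<Gamma>) \<Longrightarrow> eval B u \<gamma> \<in> H"
    from this(1) obtain C K where B: "B = prod_alg I C" and H: "H = vprod I K"
      and CK: "\<And>i. i \<in> I \<Longrightarrow> (C i, K i) \<in> Mod_eqv (l i)" and alg: "\<And>i. i \<in> I \<Longrightarrow> algebra (lang (l i)) (C i)"
      by (rule PM_cases) blast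
    have u': "u x \<in> vprod I (\<lambda>i. carrier (C i))" if "x \<in> ?X" for x using u[OF that] by (simp add: B)
    have coord: "vapp (eval B u (?f t)) k = (if k = i then eval (C i) (\<lambda>x. vapp (u x) i) t else vapp (u z) k)"
      if t: "t \<in> Fm (lang (l i)) ?k" and k: "k \<in> I" for t k
    proof -
      have "vapp (eval (prod_alg I C) u (tr (sig i) t)) i = eval (C i) (\<lambda>x. vapp (u x) i) t"
        by (rule proj_tr[OF i alg t]) (use u' in blast)+
      then show ?thesis using k unfolding B by (simp add: vapp_D)
    qed
    have mem: "eval B u (?f t) \<in> H \<longleftrightarrow> (\<forall>k\<in>I. vapp (eval B u (?f t)) k \<in> K k)"
      if t: "t \<in> Fm (lang (l i)) ?k" for t
    proof -
      have "eval B u (?f t) \<in> vprod I (\<lambda>i. carrier (C i))"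
        unfolding B prod_simps(1)[symmetric]
        by (rule eval_closed[OF FmX[OF t] algebra_prod[OF alg]]) (use u' in simp_all)
      then show ?thesis unfolding H by (rule vprod_iff[OF small_I])
    qed
    have "eval (C i) (\<lambda>x. vapp (u x) i) \<phi> \<in> K i"
    proof (rule ModD[OF Mod_eqv_Mod[OF CK[OF i]] ent])
      show "vapp (u x) i \<in> carrier (C i)" if "x \<in> ?k" for x
        using vapp_in[OF small_I u' i] that by blast
      show "eval (C i) (\<lambda>x. vapp (u x) i) \<gamma> \<in> K i" if "\<gamma> \<in> \<Gamma>" for \<gamma>
      proof -
        have t: "\<gamma> \<in> Fm (lang (l i)) ?k" using Fm\<Gamma> that by blast
        have "vapp (eval B u (?f \<gamma>)) i \<in> K i" using prem[of "?f \<gamma>"] that mem[OF t] i by blast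
        then show ?thesis using coord[OF t i] by simp
      qed
    qed
    moreover have "u z \<in> vprod I K" using prem[of "Var z"] H by simp
    then have "vapp (u z) k \<in> K k" if "k \<in> I" for k using vapp_in[OF small_I _ that] by blast
    ultimately show "eval B u (?f \<phi>) \<in> H" unfolding mem[OF Fm\<phi>] using coord[OF Fm\<phi>] by simp
  qed
  then show "eval Ai w \<phi> \<in> ?Gi" using iff[OF Fm\<phi>] ev[OF Fm\<phi>] by simp
qed

end

text \<open>In a product of matrices, \<open>D i (a, e)\<close> with \<open>e\<close> in the filter lies in the filter if and only if
  coordinate \<open>i\<close> of \<open>a\<close> does.  The two directions are inferences in the variables \<open>a\<close> and \<open>e\<close>, one
  of them with a premise for each \<open>i\<close>.\<close>

lemma filter_decomposition:
  assumes G: "(A, G) \<in> Mod P" and a: "a \<in> carrier A" and e: "e \<in> G"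
  shows "a \<in> G \<longleftrightarrow> (\<forall>i\<in>I. oper A (D i) [a, e] \<in> G)"
proof
  have e_in: "e \<in> carrier A" using matrixD(3)[OF Mod_matrix[OF G]] e by blast
  let ?X = "{a, e}"
  have X: "?X \<lesssim> elts \<kappa>" by (rule finite_lepoll_infinite[OF infinite_\<kappa>]) simp
  have D_prod: "oper (prod_alg I C) (D i) [x, y] \<in> vprod I K \<longleftrightarrow>
      (\<forall>k\<in>I. (if k = i then vapp x k else vapp y k) \<in> K k)"
    if alg: "\<And>i. i \<in> I \<Longrightarrow> algebra (lang (l i)) (C i)" and xy: "x \<in> vprod I (\<lambda>i. carrier (C i))"
      "y \<in> vprod I (\<lambda>i. carrier (C i))" for C :: "'v \<Rightarrow> ('v, 'v) alg" and K x y i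
  proof -
    have "oper (prod_alg I C) (D i) [x, y] \<in> carrier (prod_alg I C)"
      by (rule algebra_oper[OF algebra_prod[OF alg] D_in]) (use xy in auto)
    then show ?thesis using vprod_iff[OF small_I, of _ "\<lambda>i. carrier (C i)" K] vapp_D by simp
  qed
  assume aG: "a \<in> G"
  show "\<forall>i\<in>I. oper A (D i) [a, e] \<in> G"
  proof
    fix i assume i: "i \<in> I"
    have "eval A id (App (D i) [Var a, Var e]) \<in> G"
    proof (rule induced_Mod_eval[OF G[unfolded P_eq] X, where \<Gamma> = "{Var a, Var e}"])
      fix B H u
      assume "(B, H) \<in> PM" and u: "\<And>x. x \<in> ?X \<Longrightarrow> u x \<in> carrier B"
        and prem: "\<And>\<gamma>. \<gamma> \<in> {Var a, Var e} \<Longrightarrow> eval B u \<gamma> \<in> H"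
      from this(1) obtain C K where B: "B = prod_alg I C" and H: "H = vprod I K"
        and alg: "\<And>i. i \<in> I \<Longrightarrow> algebra (lang (l i)) (C i)"
        by (rule PM_cases) blast
      have "u a \<in> vprod I K" "u e \<in> vprod I K" using prem[of "Var a"] prem[of "Var e"] H by simp_all
      then show "eval B u (App (D i) [Var a, Var e]) \<in> H"
        using iffD2[OF D_prod[where C = C and K = K and x = "u a" and y = "u e" and i = i]] alg u B H
          vapp_in[OF small_I] by simp
    qed (use a e_in aG e in auto)
    then show "oper A (D i) [a, e] \<in> G" by simp
  qed
next
  have e_in: "e \<in> carrier A" using matrixD(3)[OF Mod_matrix[OF G]] e by blast
  let ?X = "{a, e}"
  have X: "?X \<lesssim> elts \<kappa>" by (rule finite_lepoll_infinite[OF infinite_\<kappa>]) simp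
  assume aG: "\<forall>i\<in>I. oper A (D i) [a, e] \<in> G"
  have "eval A id (Var a) \<in> G"
  proof (rule induced_Mod_eval[OF G[unfolded P_eq] X, where \<Gamma> = "(\<lambda>i. App (D i) [Var a, Var e]) ` I"])
    fix B H u
    assume "(B, H) \<in> PM" and u: "\<And>x. x \<in> ?X \<Longrightarrow> u x \<in> carrier B"
      and prem: "\<And>\<gamma>. \<gamma> \<in> (\<lambda>i. App (D i) [Var a, Var e]) ` I \<Longrightarrow> eval B u \<gamma> \<in> H"
    from this(1) obtain C K where B: "B = prod_alg I C" and H: "H = vprod I K"
      and alg: "\<And>i. i \<in> I \<Longrightarrow> algebra (lang (l i)) (C i)"
      by (rule PM_cases) blast
    have "vapp (u a) i \<in> K i" if i: "i \<in> I" for i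
    proof -
      have "oper B (D i) [u a, u e] \<in> vprod I K" using prem[of "App (D i) [Var a, Var e]"] i H by simp
      then have "vapp (oper B (D i) [u a, u e]) i \<in> K i" by (rule vapp_in[OF small_I _ i])
      then show ?thesis using vapp_D[OF i, of C i] B by simp
    qed
    moreover have "u a \<in> vprod I (\<lambda>i. carrier (C i))" using u[of a] B by simp
    ultimately show "eval B u (Var a) \<in> H"
      using vprod_iff[OF small_I, of "u a" "\<lambda>i. carrier (C i)" K] H by simp
  qed (use a e_in aG in auto)
  then show "a \<in> G" by simp
qed

text \<open>The homomorphism \<open>r i\<close> is the retraction onto the \<open>i\<close>-th factor followed by the Suszko reduction of
  the filter induced there.\<close>

lemma decomposition:
  assumes A: "(A, F) \<in> Mod_eqv P" and G: "(A, G) \<in> Mod P" "G \<noteq> {}"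
  obtains r B H where "\<And>i. i \<in> I \<Longrightarrow> (B i, H i) \<in> Mod_eqv (l i)"
    "\<And>i. i \<in> I \<Longrightarrow> r i \<in> homs PL A (trans_alg (B i) (entry i))"
    "\<And>i. i \<in> I \<Longrightarrow> r i ` carrier A = carrier (B i)"
    "G = {a \<in> carrier A. \<forall>i\<in>I. r i a \<in> H i}"
proof -
  obtain e where e: "e \<in> G" using G(2) by blast
  have e_in: "e \<in> carrier A" using matrixD(3)[OF Mod_matrix[OF G(1)]] e by blast
  have "\<exists>r B H. (B, H) \<in> Mod_eqv (l i) \<and> r \<in> homs PL A (trans_alg B (entry i)) \<and>
      r ` carrier A = carrier B \<and> (\<forall>a\<in>carrier A. r a \<in> H \<longleftrightarrow> oper A (D i) [a, e] \<in> G)" if i: "i \<in> I" for i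
  proof -
    let ?p = "\<lambda>a. oper A (D i) [a, e]"
    let ?Gi = "{a \<in> carrier (factor A e i). oper A (D i) [a, e] \<in> G}"
    note f = factor_filter[OF A e_in i G(1) e]
    obtain q B H where B: "(B, H) \<in> Mod_eqv (l i)" and q: "q \<in> homs (lang (l i)) (factor A e i) B"
      "q ` carrier (factor A e i) = carrier B" and H: "?Gi = {a \<in> carrier (factor A e i). q a \<in> H}"
      by (rule Suszko_reduction[OF logics[OF i] f])
    have "(\<lambda>a. q (?p a)) \<in> homs PL A (trans_alg B (entry i))"
      by (rule homs_comp[OF pr_hom[OF A e_in i] homs_trans[OF translation_entry[OF i] algebra_factor[OF A e_in i] q(1)]
            algebra_A[OF A e_in i]])
    moreover have "(\<lambda>a. q (?p a)) ` carrier A = carrier B"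
      using q(2) factor_carrier[OF A e_in i] by (simp add: image_image)
    moreover have "q (?p a) \<in> H \<longleftrightarrow> ?p a \<in> G" if a: "a \<in> carrier A" for a
    proof -
      have "?p a \<in> carrier (factor A e i)" using a factor_carrier[OF A e_in i] by simp
      then have "q (?p a) \<in> H \<longleftrightarrow> ?p (?p a) \<in> G" using H by blast
      then show ?thesis using D_D[OF A i a e_in e_in] by simp
    qed
    ultimately show ?thesis using B by blast
  qed
  then obtain r B H where *: "\<forall>i\<in>I. (B i, H i) \<in> Mod_eqv (l i) \<and> r i \<in> homs PL A (trans_alg (B i) (entry i)) \<and>
      r i ` carrier A = carrier (B i) \<and> (\<forall>a\<in>carrier A. r i a \<in> H i \<longleftrightarrow> oper A (D i) [a, e] \<in> G)"
    by metis
  have "G = {a \<in> carrier A. \<forall>i\<in>I. r i a \<in> H i}"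
    using matrixD(3)[OF Mod_matrix[OF G(1)]] filter_decomposition[OF G(1) _ e] * by blast
  then show thesis using that[of B H r] * by blast
qed

text \<open>If every factor had a theorem, then, with all variables identified, these theorems would make up a
  unary symbol whose values lie in every filter.\<close>

lemma no_theorems_factor:
  assumes A: "(A, {}) \<in> Mod P"
  shows "\<exists>i\<in>I. (triv_alg (vset {}), {}) \<in> Mod (l i)"
proof (rule ccontr)
  assume n: "\<not> ?thesis"
  have "\<exists>\<phi>. entails (l i) {} \<phi>" if i: "i \<in> I" for i
  proof (rule ccontr)
    assume no: "\<nexists>\<phi>. entails (l i) {} \<phi>"
    have "(triv_alg (vset {}), {}) \<in> Mod (l i)"
    proof (rule ModI[OF logics[OF i]])
      show "matrix (lang (l i)) (triv_alg (vset {}), {})" by (simp add: matrix_def algebra_triv)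
      fix \<Gamma> \<phi> v
      assume "entails (l i) \<Gamma> \<phi>" "\<And>\<gamma>. \<gamma> \<in> \<Gamma> \<Longrightarrow> eval (triv_alg (vset {} :: 'v)) v \<gamma> \<in> {}"
      moreover from this(2) have "\<Gamma> = {}" by blast
      ultimately show "eval (triv_alg (vset {})) v \<phi> \<in> {}" using no by blast
    qed
    then show False using n i by blast
  qed
  then obtain \<phi> where \<phi>: "\<And>i. i \<in> I \<Longrightarrow> entails (l i) {} (\<phi> i)" by metis
  define \<psi> where "\<psi> i = subst (\<lambda>_. Var (vnat 1)) (\<phi> i)" for i
  have \<psi>: "\<psi> i \<in> Fm (lang (l i)) (vars_upto 1)" if "i \<in> I" for i
    unfolding \<psi>_def by (rule subst_closed[OF is_logicD(5)[OF logics[OF that] \<phi>[OF that]]]) (simp add: vars_upto_def)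
  obtain a where a: "a \<in> carrier A" using matrixD(2)[OF Mod_matrix[OF A]] by (auto simp: algebra_def)
  let ?X = "{a}"
  have X: "?X \<lesssim> elts \<kappa>" by (rule finite_lepoll_infinite[OF infinite_\<kappa>]) simp
  have S: "tuple_sym \<psi> 1 \<in> PL" by (rule tuple_sym_in) (use \<psi> in auto)
  have "eval A id (App (tuple_sym \<psi> 1) [Var a]) \<in> {}"
  proof (rule induced_Mod_eval[OF A[unfolded P_eq] X, where \<Gamma> = "{}"])
    fix B H u
    assume "(B, H) \<in> PM" and u: "\<And>x. x \<in> ?X \<Longrightarrow> u x \<in> carrier B"
    from this(1) obtain C K where B: "B = prod_alg I C" and H: "H = vprod I K"
      and CK: "\<And>i. i \<in> I \<Longrightarrow> (C i, K i) \<in> Mod_eqv (l i)"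
      by (rule PM_cases) blast
    have "term_fun (C i) (\<psi> i) [vapp (u a) i] \<in> K i" if i: "i \<in> I" for i
    proof -
      have "u a \<in> vprod I (\<lambda>i. carrier (C i))" using u B by simp
      then have "vapp (u a) i \<in> carrier (C i)" by (rule vapp_in[OF small_I _ i])
      then have "eval (C i) (\<lambda>_. vapp (u a) i) (\<phi> i) \<in> K i"
        by (intro ModD[OF Mod_eqv_Mod[OF CK[OF i]] \<phi>[OF i]]) simp_all
      then show ?thesis by (simp add: term_fun_eq \<psi>_def eval_subst)
    qed
    then show "eval B u (App (tuple_sym \<psi> 1) [Var a]) \<in> H"
      by (simp add: B H prod_simps(2) vlam_in_vprod[OF small_I] entry_tuple_sym)
  qed (use a S in \<open>auto simp: Fm_App_iff\<close>)
  then show False by simp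
qed

text \<open>The interpretations \<open>\<tau> i\<close> into the factors are combined to the one that sends \<open>s\<close> to the symbol
  \<open>\<langle>\<tau> i s : i \<in> I\<rangle>\<close>.  By the decomposition, the filter of a reduced model of the
  product is an intersection of preimages of filters of models of \<open>l'\<close>, hence a filter of \<open>l'\<close>.
  Applied to each larger filter \<open>G\<close>, the decomposition shows that a pair in the Suszko congruence with
  respect to \<open>l'\<close> is identified in all components of \<open>G\<close>, and hence by the Leibniz congruence of
  \<open>G\<close>.  An empty filter does not decompose, but it has the full Leibniz congruence, and it exists only
  if some factor, and with it \<open>l'\<close>, has no theorems.\<close>

lemma product_greatest:
  assumes l': "is_logic l'" and le: "\<And>i. i \<in> I \<Longrightarrow> interpretable l' (l i)"
  shows "interpretable l' P"
proof -
  obtain \<tau> where \<tau>: "\<And>i. i \<in> I \<Longrightarrow> interpretation_of (\<tau> i) l' (l i)"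
    using le unfolding interpretable_def by metis
  define T where "T s = basic (tuple_sym (\<lambda>i. \<tau> i s) (snd s))" for s
  have tuple_sym_T: "tuple_sym (\<lambda>i. \<tau> i s) (snd s) \<in> PL" if s: "s \<in> lang l'" for s
  proof (rule tuple_sym_in)
    show "1 \<le> snd s" using is_logicD(1)[OF l'] s by (simp add: language_def)
    show "\<tau> i s \<in> Fm (lang (l i)) (vars_upto (snd s))" if "i \<in> I" for i
      by (rule translation_Fm[OF interpretation_ofD(1)[OF \<tau>[OF that]] s])
  qed
  have T: "translation T (lang l') PL"
    unfolding translation_def T_def using basic_Fm[OF tuple_sym_T] by simp
  have alg_eq_T: "alg_eq (lang l') (trans_alg (trans_alg B (entry i)) T) (trans_alg B (\<tau> i))" if "i \<in> I" for B i
    using that by (simp add: alg_eq_def T_def term_fun_basic entry_tuple_sym trans_alg_simps(2))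
  have "interpretation_of T l' P"
  proof (rule interpretation_ofI)
    show "translation T (lang l') (lang P)" using T by simp
    fix A F assume A: "(A, F) \<in> Mod_eqv P"
    note mA = Mod_eqv_matrix[OF A, unfolded P_simps]
    have alg: "algebra PL A" and algT: "algebra (lang l') (trans_alg A T)"
      using matrixD(2)[OF mA] algebra_trans[OF T] by blast+
    have mAT: "matrix (lang l') (trans_alg A T, F)" by (rule matrix_trans[OF T mA])
    have homT: "r \<in> homs (lang l') (trans_alg A T) (trans_alg B (\<tau> i))"
      if "i \<in> I" "r \<in> homs PL A (trans_alg B (entry i))" for r B i
      by (rule homs_alg_eq[OF homs_trans[OF T alg that(2)] alg_eq_T[OF that(1)]])
    have Mod_F: "(trans_alg A T, F) \<in> Mod l'"
    proof (cases "F = {}")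
      case True
      then obtain i where i: "i \<in> I" "(triv_alg (vset {}), {}) \<in> Mod (l i)"
        using no_theorems_factor Mod_eqv_Mod[OF A] by blast
      have B: "(trans_alg (triv_alg (vset {})) (\<tau> i), {}) \<in> Mod l'"
        by (rule interpretation_Mod[OF l' logics[OF i(1)] \<tau>[OF i(1)] i(2)])
      have "(\<lambda>_. vset {}) \<in> homs (lang l') (trans_alg A T) (trans_alg (triv_alg (vset {})) (\<tau> i))"
      proof (rule homsI)
        fix s as assume s: "s \<in> lang l'" "length as = snd s"
        have "oper (trans_alg (triv_alg (vset {} :: 'v)) (\<tau> i)) s (map (\<lambda>_. vset {}) as) \<in> {vset {}}"
          using algebra_oper[OF matrixD(2)[OF Mod_matrix[OF B]] s(1), of "map (\<lambda>_. vset {}) as"] s(2) by auto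
        then show "vset {} = oper (trans_alg (triv_alg (vset {} :: 'v)) (\<tau> i)) s (map (\<lambda>_. vset {}) as)" by simp
      qed simp
      from Mod_vimage[OF l' matrixD(1)[OF mAT] algT this B] show ?thesis using True by simp
    next
      case False
      obtain r B H where BH: "\<And>i. i \<in> I \<Longrightarrow> (B i, H i) \<in> Mod_eqv (l i)"
          and r: "\<And>i. i \<in> I \<Longrightarrow> r i \<in> homs PL A (trans_alg (B i) (entry i))"
          and "F = {a \<in> carrier A. \<forall>i\<in>I. r i a \<in> H i}"
        by (rule decomposition[OF A Mod_eqv_Mod[OF A] False]) blast
      then have F: "F = {a \<in> carrier (trans_alg A T). \<forall>i\<in>I. r i a \<in> H i}" by simp
      have "(trans_alg (B i) (\<tau> i), H i) \<in> Mod l'" if "i \<in> I" for i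
        by (rule Mod_eqv_Mod[OF interpretation_ofD(2)[OF \<tau>[OF that] BH[OF that]]])
      then show ?thesis
        using Mod_vimage_family[OF l', where h = r and H = H and I = I and B = "\<lambda>i. trans_alg (B i) (\<tau> i)"]
          mAT homT[OF _ r] unfolding F by blast
    qed
    show "(trans_alg A T, F) \<in> Mod_eqv l'"
    proof (rule Mod_eqvI[OF Mod_F])
      fix a b assume "a \<in> carrier (trans_alg A T)" "b \<in> carrier (trans_alg A T)"
        and ab: "(a, b) \<in> Suszko l' (trans_alg A T) F"
      then have in_A: "a \<in> carrier A" "b \<in> carrier A" by simp_all
      have "(a, b) \<in> Leibniz PL A G" if G: "(A, G) \<in> Mod P" "F \<subseteq> G" for G
      proof (cases "G = {}")
        case True
        have "congruence PL A (carrier A \<times> carrier A)"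
          by (rule congruence_unaryI[OF _ alg])
            (use algebra_oper[OF alg] in \<open>auto simp: equiv_def refl_on_def sym_def trans_def\<close>)
        then have "carrier A \<times> carrier A \<subseteq> Leibniz PL A G"
          using Mod_matrix[OF G(1)] True by (intro Leibniz_greatest) (auto simp: compatible_def)
        then show ?thesis using in_A by blast
      next
        case False
        obtain r B H where BH: "\<And>i. i \<in> I \<Longrightarrow> (B i, H i) \<in> Mod_eqv (l i)"
            and r: "\<And>i. i \<in> I \<Longrightarrow> r i \<in> homs PL A (trans_alg (B i) (entry i))"
            and onto: "\<And>i. i \<in> I \<Longrightarrow> r i ` carrier A = carrier (B i)"
            and GH: "G = {a \<in> carrier A. \<forall>i\<in>I. r i a \<in> H i}"
          by (rule decomposition[OF A G(1) False]) blast
        have eq: "r i a = r i b" if i: "i \<in> I" for i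
        proof -
          have B: "(trans_alg (B i) (\<tau> i), H i) \<in> Mod_eqv l'"
            by (rule interpretation_ofD(2)[OF \<tau>[OF i] BH[OF i]])
          have "(r i a, r i b) \<in> Suszko l' (trans_alg (B i) (\<tau> i)) (H i)"
            using G(2) i in_A onto[OF i] unfolding GH
            by (intro Suszko_vimage[OF l' mAT homT[OF i r[OF i]] _ Mod_eqv_matrix[OF B] _ ab]) auto
          then show ?thesis by (rule Mod_eqvD[OF B])
        qed
        let ?ker = "\<lambda>i. {(a, b) \<in> carrier A \<times> carrier A. (r i a, r i b) \<in> Id_on (carrier (trans_alg (B i) (entry i)))}"
        let ?\<theta> = "\<Inter> (?ker ` I)"
        have "congruence PL A ?\<theta>"
        proof (rule congruence_Inter)
          fix \<theta> assume "\<theta> \<in> ?ker ` I"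
          then obtain i where i: "i \<in> I" and \<theta>: "\<theta> = ?ker i" by blast
          have "algebra PL (trans_alg (B i) (entry i))"
            by (rule algebra_trans[OF translation_entry[OF i] matrixD(2)[OF Mod_eqv_matrix[OF BH[OF i]]]])
          then show "congruence PL A \<theta>"
            unfolding \<theta> by (intro congruence_vimage[OF r[OF i] alg] congruence_Id)
        qed (use I_nonempty in blast)
        moreover have "compatible ?\<theta> G"
          using I_nonempty unfolding compatible_def GH by auto
        ultimately have "?\<theta> \<subseteq> Leibniz PL A G"
          using Mod_matrix[OF G(1)] by (intro Leibniz_greatest) auto
        moreover have "(a, b) \<in> ?\<theta>"
          using eq in_A onto by auto
        ultimately show ?thesis by blast
      qed
      then have "(a, b) \<in> Suszko P A F" unfolding Suszko_iff by simp
      then show "a = b" by (rule Mod_eqvD[OF A])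
    qed
  qed
  then show ?thesis unfolding interpretable_def by blast
qed

end


subsection \<open>The empty product\<close>

lemma inconsistent_eq: "inconsistent_logic = induced_logic {} omega {}"
  by (simp add: inconsistent_logic_def induced_logic_def)

lemma is_logic_inconsistent: "is_logic inconsistent_logic"
  unfolding inconsistent_eq
  by (rule is_logic_induced[OF _ Cardinal_omega infinite_omega]) (simp add: language_def)

text \<open>The only reduced models of the inconsistent logic are the trivial ones, which reduced models of any
  logic include.  All symbols can be translated by a variable, as their arities are positive.\<close>

lemma interpretable_inconsistent:
  assumes l: "is_logic l"
  shows "interpretable l inconsistent_logic"
proof -
  have t: "translation (\<lambda>_. Var (vnat 1)) (lang l) {}"
    using is_logicD(1)[OF l] by (auto simp: translation_def language_def vars_upto_def)
  have "interpretation_of (\<lambda>_. Var (vnat 1)) l inconsistent_logic"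
  proof (rule interpretation_ofI)
    show "translation (\<lambda>_. Var (vnat 1)) (lang l) (lang inconsistent_logic)"
      using t by (simp add: inconsistent_eq)
    fix A F assume A: "(A, F) \<in> Mod_eqv (inconsistent_logic :: 'a logic)"
    note mA = Mod_eqv_matrix[OF A, unfolded inconsistent_eq induced_simps]
    have full: "G = carrier A" if G: "(A, G) \<in> Mod inconsistent_logic" for G
    proof -
      have "a \<in> G" if a: "a \<in> carrier A" for a
      proof -
        have "vnat 0 \<in> elts (omega :: 'a)" by (simp add: elts_omega)
        then have "entails inconsistent_logic {} (Var (vnat 0 :: 'a))"
          by (simp add: inconsistent_logic_def)
        from ModD[OF G this, of "\<lambda>_. a"] show ?thesis using a by simp
      qed
      then show ?thesis using matrixD(3)[OF Mod_matrix[OF G]] by blast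
    qed
    have "a = b" if ab: "a \<in> carrier A" "b \<in> carrier A" for a b
    proof (rule Mod_eqvD[OF A])
      show "(a, b) \<in> Suszko inconsistent_logic A F"
        unfolding Suszko_iff
      proof (intro allI impI)
        fix G assume G: "(A, G) \<in> Mod inconsistent_logic"
        have "congruence {} A (carrier A \<times> carrier A)"
          by (auto simp: congruence_def equiv_def refl_on_def sym_def trans_def)
        then have "carrier A \<times> carrier A \<subseteq> Leibniz {} A G"
          using Leibniz_greatest[OF Mod_matrix[OF G]] full[OF G]
          by (simp add: inconsistent_eq compatible_def)
        then show "(a, b) \<in> Leibniz (lang inconsistent_logic) A G"
          using ab by (auto simp: inconsistent_eq)
      qed
    qed
    then obtain a where a: "carrier A = {a}"
      using matrixD(2)[OF mA] unfolding algebra_def by blast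
    have "alg_eq (lang l) (triv_alg a) (trans_alg A (\<lambda>_. Var (vnat 1)))"
      unfolding alg_eq_def
    proof (intro conjI ballI impI)
      fix s as assume s: "s \<in> lang l" "as \<in> lists (carrier (triv_alg a))" "length as = snd s"
      have "oper (trans_alg A (\<lambda>_. Var (vnat 1))) s as \<in> carrier (trans_alg A (\<lambda>_. Var (vnat 1)))"
        by (rule algebra_oper[OF algebra_trans[OF t matrixD(2)[OF mA]] s(1,3)])
          (use s(2) a in \<open>simp add: lists_eq_set\<close>)
      then show "oper (triv_alg a) s as = oper (trans_alg A (\<lambda>_. Var (vnat 1))) s as"
        using a by simp
    qed (simp add: a)
    moreover have "F = {a}" using full[OF Mod_eqv_Mod[OF A]] a by simp
    ultimately show "(trans_alg A (\<lambda>_. Var (vnat 1)), F) \<in> Mod_eqv l"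
      using Mod_eqv_alg_eq[OF l _ triv_Mod_eqv[OF l]] by simp
  qed
  then show ?thesis unfolding interpretable_def by blast
qed

lemma
  fixes I :: "'v::zfc set"
  assumes "small I" "\<And>i. i \<in> I \<Longrightarrow> is_logic (l i)"
  shows is_logic_nonindexed_product: "is_logic (nonindexed_product I l)"
    and nonindexed_product_lower: "i \<in> I \<Longrightarrow> interpretable (nonindexed_product I l) (l i)"
    and nonindexed_product_greatest:
      "is_logic l' \<Longrightarrow> (\<And>i. i \<in> I \<Longrightarrow> interpretable l' (l i)) \<Longrightarrow> interpretable l' (nonindexed_product I l)"
proof -
  have empty: "nonindexed_product {} l = inconsistent_logic"
    by (simp add: nonindexed_product_def)
  have prod: "product I l" if "I \<noteq> {}"
    using assms that by unfold_locales
  show "is_logic (nonindexed_product I l)"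
    using product.is_logic_P[OF prod] is_logic_inconsistent empty by (cases "I = {}") simp_all
  show "interpretable (nonindexed_product I l) (l i)" if "i \<in> I"
    using product.product_lower[OF prod] that by blast
  show "interpretable l' (nonindexed_product I l)"
    if "is_logic l'" "\<And>i. i \<in> I \<Longrightarrow> interpretable l' (l i)"
    using product.product_greatest[OF prod that] interpretable_inconsistent[OF that(1)] empty
    by (cases "I = {}") simp_all
qed


section \<open>Interpretability through compatible expansions\<close>

lemma is_logic_reflexive:
  assumes "is_logic l" "\<Gamma> \<subseteq> FmL l" "\<gamma> \<in> \<Gamma>" shows "entails l \<Gamma> \<gamma>"
proof -
  have "\<forall>\<Gamma> \<gamma>. \<Gamma> \<subseteq> FmL l \<and> \<gamma> \<in> \<Gamma> \<longrightarrow> entails l \<Gamma> \<gamma>"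
    using assms(1) unfolding is_logic_def by (elim conjE)
  then show ?thesis using assms(2,3) by blast
qed

lemma is_logic_cut:
  assumes "is_logic l" "\<Gamma> \<subseteq> FmL l" "\<And>\<delta>. \<delta> \<in> \<Delta> \<Longrightarrow> entails l \<Gamma> \<delta>" "entails l \<Delta> \<phi>"
  shows "entails l \<Gamma> \<phi>"
proof -
  have "\<forall>\<Gamma> \<Delta> \<phi>. \<Gamma> \<subseteq> FmL l \<and> (\<forall>\<delta>\<in>\<Delta>. entails l \<Gamma> \<delta>) \<and> entails l \<Delta> \<phi> \<longrightarrow> entails l \<Gamma> \<phi>"
    using assms(1) unfolding is_logic_def by (elim conjE)
  from this[rule_format, of \<Gamma> \<Delta> \<phi>] show ?thesis using assms(2-4) by blast
qed

lemma is_logic_subst: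
  assumes "is_logic l" "\<And>x. x \<in> elts (nvars l) \<Longrightarrow> \<theta> x \<in> FmL l" "entails l \<Gamma> \<phi>"
  shows "entails l (subst \<theta> ` \<Gamma>) (subst \<theta> \<phi>)"
proof -
  have inv: "\<forall>\<Gamma> \<phi>. \<forall>\<sigma> \<in> homs (lang l) (fmL_alg l) (fmL_alg l). entails l \<Gamma> \<phi> \<longrightarrow> entails l (\<sigma> ` \<Gamma>) (\<sigma> \<phi>)"
    using assms(1) unfolding is_logic_def by (elim conjE)
  have "subst \<theta> \<in> homs (lang l) (fmL_alg l) (fmL_alg l)"
    unfolding fmL_alg_def
    by (rule homsI) (use assms(2) in \<open>auto simp: FmL_def intro: subst_closed\<close>)
  from inv[rule_format, OF this assms(3)] show ?thesis .
qed

lemma subst_basic: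
  assumes "length ts = snd s" shows "subst (arg ts) (basic s) = App s ts"
  using map_arg_upto[OF assms] by (simp add: basic_def comp_def del: upt_Suc)

text \<open>The factorization of an interpretation.  To make the languages disjoint, the symbols of \<open>l'\<close> are
  tagged with an element \<open>z\<close> that tags no symbol of \<open>l\<close>.\<close>

locale expansion =
  fixes l l' :: "'v::zfc logic" and \<tau> :: "'v sym \<Rightarrow> 'v fm" and z :: 'v
  assumes l: "is_logic l" and l': "is_logic l'" and \<tau>: "interpretation_of \<tau> l l'"
    and z: "\<And>a n. (vpair z a, n) \<notin> lang l"
begin

definition ren :: "'v sym \<Rightarrow> 'v sym" where "ren s = (vpair z (fst s), snd s)"
definition unren :: "'v sym \<Rightarrow> 'v sym" where "unren s = (inv (vpair z) (fst s), snd s)"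
definition E :: "'v sym set" where "E = lang l \<union> ren ` lang l'"
definition \<rho> :: "'v sym \<Rightarrow> 'v fm" where "\<rho> s = (if s \<in> lang l then \<tau> s else basic (unren s))"
definition \<sigma> :: "'v sym \<Rightarrow> 'v fm" where "\<sigma> s = basic (ren s)"

abbreviation "V \<equiv> elts (nvars l')"

text \<open>A formula of the expansion means what its translation back into \<open>l'\<close> means.  Inferences are
  then governed by \<open>l'\<close> directly, with no detour through a class of matrices.\<close>

definition l'' :: "'v logic"
  where "l'' = \<lparr>lang = E, nvars = nvars l', entails = (\<lambda>\<Gamma> \<phi>. \<Gamma> \<subseteq> Fm E V \<and> \<phi> \<in> Fm E V \<and>
    entails l' (tr \<rho> ` \<Gamma>) (tr \<rho> \<phi>))\<rparr>"

lemma l''_simps [simp]: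
  "lang l'' = E" "nvars l'' = nvars l'" "FmL l'' = Fm E V" "fmL_alg l'' = fm_alg E V"
  "entails l'' \<Gamma> \<phi> \<longleftrightarrow> \<Gamma> \<subseteq> Fm E V \<and> \<phi> \<in> Fm E V \<and> entails l' (tr \<rho> ` \<Gamma>) (tr \<rho> \<phi>)"
  by (simp_all add: l''_def FmL_def fmL_alg_def)

lemma snd_ren [simp]: "snd (ren s) = snd s"
  by (simp add: ren_def)

lemma unren_ren [simp]: "unren (ren s) = s"
proof -
  have "inj (vpair z)" by (rule injI) simp
  then show ?thesis by (simp add: unren_def ren_def)
qed

lemma ren_notin: "ren s \<notin> lang l"
  using z by (simp add: ren_def)

lemma \<rho>_ren [simp]: "\<rho> (ren s) = basic s"
  by (simp add: \<rho>_def ren_notin)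

lemma translation_\<rho>: "translation \<rho> E (lang l')"
  unfolding translation_def
proof
  fix s assume "s \<in> E"
  then consider "s \<in> lang l" | s' where "s' \<in> lang l'" "s = ren s'" unfolding E_def by blast
  then show "\<rho> s \<in> Fm (lang l') (vars_upto (snd s))"
  proof cases
    case 1
    then show ?thesis using translation_Fm[OF interpretation_ofD(1)[OF \<tau>]] by (simp add: \<rho>_def)
  next
    case 2
    then show ?thesis using basic_Fm by simp
  qed
qed

lemma translation_\<sigma>: "translation \<sigma> (lang l') E"
  unfolding translation_def \<sigma>_def using basic_Fm[of "ren _" E] by (simp add: E_def)

lemma tr_\<rho>_\<sigma>: "t \<in> Fm (lang l') X \<Longrightarrow> tr \<rho> (tr \<sigma> t) = t"
  by (induction rule: Fm.induct) (auto simp: \<sigma>_def subst_basic intro!: map_idI)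

lemma alg_eq_\<rho>_\<sigma>: "alg_eq (lang l') (trans_alg (trans_alg A \<rho>) \<sigma>) A"
  by (simp add: alg_eq_def \<sigma>_def term_fun_basic)

lemma language_E: "language E"
  unfolding language_def
proof (intro conjI ballI)
  have "fst ` E = fst ` lang l \<union> vpair z ` (fst ` lang l')"
    by (force simp: E_def ren_def image_iff)
  then show "small (fst ` E)"
    using is_logicD(1)[OF l] is_logicD(1)[OF l'] by (simp add: language_def small_Un small_image)
  show "1 \<le> snd s" if "s \<in> E" for s
    using that is_logicD(1)[OF l] is_logicD(1)[OF l'] by (auto simp: E_def language_def)
qed

lemma is_logic_l'': "is_logic l''"
  unfolding is_logic_def l''_simps
proof (intro conjI allI impI ballI; (elim conjE)?)
  show "language E" by (rule language_E)
  show "Cardinal (nvars l')" "infinite V" by (rule is_logicD[OF l'])+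
  have tr_Fm: "tr \<rho> t \<in> Fm (lang l') V" if "t \<in> Fm E V" for t
    by (rule tr_closed[OF translation_\<rho> that])
  show "entails l' (tr \<rho> ` \<Gamma>) (tr \<rho> \<gamma>)" "\<gamma> \<in> Fm E V" if "\<Gamma> \<subseteq> Fm E V" "\<gamma> \<in> \<Gamma>" for \<Gamma> \<gamma>
    using that tr_Fm by (auto intro!: is_logic_reflexive[OF l'] simp: FmL_def)
  show "entails l' (tr \<rho> ` \<Gamma>) (tr \<rho> \<phi>)"
    if "\<Gamma> \<subseteq> Fm E V" "\<forall>\<delta>\<in>\<Delta>. \<Gamma> \<subseteq> Fm E V \<and> \<delta> \<in> Fm E V \<and> entails l' (tr \<rho> ` \<Gamma>) (tr \<rho> \<delta>)"
      "entails l' (tr \<rho> ` \<Delta>) (tr \<rho> \<phi>)" for \<Gamma> \<Delta> \<phi>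
    by (rule is_logic_cut[OF l' _ _ that(3)]) (use that tr_Fm in \<open>auto simp: FmL_def\<close>)
  fix \<Gamma> \<phi> \<sigma>' assume \<sigma>': "\<sigma>' \<in> homs E (fm_alg E V) (fm_alg E V)"
    and \<Gamma>: "\<Gamma> \<subseteq> Fm E V" "\<phi> \<in> Fm E V" and e: "entails l' (tr \<rho> ` \<Gamma>) (tr \<rho> \<phi>)"
  define \<theta> where "\<theta> x = tr \<rho> (\<sigma>' (Var x))" for x
  have \<sigma>'_Fm: "\<sigma>' t \<in> Fm E V" if "t \<in> Fm E V" for t
    using homs_in[OF \<sigma>'] that by simp
  then show "\<sigma>' ` \<Gamma> \<subseteq> Fm E V" "\<sigma>' \<phi> \<in> Fm E V" using \<Gamma> by auto
  have eq: "tr \<rho> (\<sigma>' t) = subst \<theta> (tr \<rho> t)" if t: "t \<in> Fm E V" for t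
    using hom_fm_eq_eval[OF \<sigma>' t] tr_subst[OF translation_\<rho> t] by (simp add: subst_eq_eval \<theta>_def[abs_def])
  have "entails l' (subst \<theta> ` tr \<rho> ` \<Gamma>) (subst \<theta> (tr \<rho> \<phi>))"
    by (rule is_logic_subst[OF l' _ e]) (simp add: \<theta>_def FmL_def tr_Fm \<sigma>'_Fm)
  moreover have "subst \<theta> ` tr \<rho> ` \<Gamma> = tr \<rho> ` \<sigma>' ` \<Gamma>"
    unfolding image_image using eq \<Gamma> by (intro image_cong) auto
  ultimately show "entails l' (tr \<rho> ` \<sigma>' ` \<Gamma>) (tr \<rho> (\<sigma>' \<phi>))"
    using eq[OF \<Gamma>(2)] by simp
qed auto

lemma Mod_\<rho>:
  assumes A: "(A, G) \<in> Mod l'" shows "(trans_alg A \<rho>, G) \<in> Mod l''"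
proof (rule ModI[OF is_logic_l''])
  show "matrix (lang l'') (trans_alg A \<rho>, G)" using matrix_trans[OF translation_\<rho> Mod_matrix[OF A]] by simp
  fix \<Gamma> \<phi> v
  assume e: "entails l'' \<Gamma> \<phi>" and v: "\<And>x. x \<in> elts (nvars l'') \<Longrightarrow> v x \<in> carrier (trans_alg A \<rho>)"
    and \<Gamma>: "\<And>\<gamma>. \<gamma> \<in> \<Gamma> \<Longrightarrow> eval (trans_alg A \<rho>) v \<gamma> \<in> G"
  have eq: "eval (trans_alg A \<rho>) v t = eval A v (tr \<rho> t)" if "t \<in> Fm E V" for t
    by (rule eval_tr[OF translation_\<rho> that, symmetric])
  have "eval A v (tr \<rho> \<phi>) \<in> G"
  proof (rule ModD[OF A, of "tr \<rho> ` \<Gamma>"])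
    show "entails l' (tr \<rho> ` \<Gamma>) (tr \<rho> \<phi>)" using e by simp
    show "v x \<in> carrier A" if "x \<in> V" for x using v that by simp
    show "eval A v \<gamma> \<in> G" if \<gamma>: "\<gamma> \<in> tr \<rho> ` \<Gamma>" for \<gamma>
    proof -
      obtain t where t: "t \<in> \<Gamma>" "\<gamma> = tr \<rho> t" using \<gamma> by blast
      then have "t \<in> Fm E V" using e by auto
      from eq[OF this] show ?thesis using \<Gamma>[OF t(1)] t(2) by simp
    qed
  qed
  then show "eval (trans_alg A \<rho>) v \<phi> \<in> G" using eq e by simp
qed

lemma Mod_\<sigma>:
  assumes A: "(A, G) \<in> Mod l''" shows "(trans_alg A \<sigma>, G) \<in> Mod l'"
proof (rule ModI[OF l'])
  show "matrix (lang l') (trans_alg A \<sigma>, G)"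
    using matrix_trans[OF translation_\<sigma>] Mod_matrix[OF A] by simp
  fix \<Gamma> \<phi> v
  assume e: "entails l' \<Gamma> \<phi>" and v: "\<And>x. x \<in> V \<Longrightarrow> v x \<in> carrier (trans_alg A \<sigma>)"
    and \<Gamma>: "\<And>\<gamma>. \<gamma> \<in> \<Gamma> \<Longrightarrow> eval (trans_alg A \<sigma>) v \<gamma> \<in> G"
  note Fm\<Gamma> = is_logicD(4)[OF l' e] and Fm\<phi> = is_logicD(5)[OF l' e]
  have eq: "eval (trans_alg A \<sigma>) v t = eval A v (tr \<sigma> t)" if "t \<in> Fm (lang l') V" for t
    by (rule eval_tr[OF translation_\<sigma> that, symmetric])
  have "tr \<rho> ` tr \<sigma> ` \<Gamma> = \<Gamma>"
    unfolding image_image using tr_\<rho>_\<sigma> Fm\<Gamma> by (force simp: image_iff)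
  then have "entails l'' (tr \<sigma> ` \<Gamma>) (tr \<sigma> \<phi>)"
    using e tr_\<rho>_\<sigma>[OF Fm\<phi>] tr_closed[OF translation_\<sigma>] Fm\<phi> Fm\<Gamma> by auto
  then have "eval A v (tr \<sigma> \<phi>) \<in> G"
  proof (rule ModD[OF A])
    show "v x \<in> carrier A" if "x \<in> elts (nvars l'')" for x using v that by simp
    show "eval A v \<gamma> \<in> G" if "\<gamma> \<in> tr \<sigma> ` \<Gamma>" for \<gamma>
      using that \<Gamma> eq Fm\<Gamma> by (auto simp: subset_iff)
  qed
  then show "eval (trans_alg A \<sigma>) v \<phi> \<in> G" using eq[OF Fm\<phi>] by simp
qed

text \<open>In the reduced models of the expansion, each symbol of \<open>l\<close> coincides with its \<open>\<tau>\<close>-translation: both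
  sides have the same translation under \<open>\<rho>\<close>, so they are interderivable in any context.\<close>

lemma alg_eq_\<sigma>_\<rho>:
  assumes A: "(A, F) \<in> Mod_eqv l''"
  shows "alg_eq E (trans_alg (trans_alg A \<sigma>) \<rho>) A"
  unfolding alg_eq_def
proof (intro conjI ballI impI)
  fix s as assume s: "s \<in> E" and "as \<in> lists (carrier (trans_alg (trans_alg A \<sigma>) \<rho>))" and len: "length as = snd s"
  then have as: "set as \<subseteq> carrier A" by (simp add: lists_eq_set)
  let ?n = "vars_upto (snd s)"
  have \<rho>s: "\<rho> s \<in> Fm (lang l') ?n" by (rule translation_Fm[OF translation_\<rho> s])
  have arg: "arg as x \<in> carrier A" if "x \<in> ?n" for x using arg_in[OF that len] as by blast
  let ?\<phi> = "App s (map Var as)" and ?\<psi> = "subst (\<lambda>x. Var (arg as x)) (tr \<sigma> (\<rho> s))"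
  have Fm: "?\<phi> \<in> Fm E (carrier A)" "?\<psi> \<in> Fm E (carrier A)"
    using s len as arg by (auto simp: Fm_App_iff intro!: subst_closed[OF tr_closed[OF translation_\<sigma> \<rho>s]])
  have tr_eq: "tr \<rho> ?\<phi> = tr \<rho> ?\<psi>"
  proof -
    have "tr \<rho> ?\<phi> = subst (\<lambda>x. Var (arg as x)) (\<rho> s)"
      by (simp add: comp_def, rule subst_cong[OF \<rho>s]) (rule arg_map[OF _ len])
    also have "\<dots> = tr \<rho> ?\<psi>"
      using tr_subst[OF translation_\<rho> tr_closed[OF translation_\<sigma> \<rho>s]] tr_\<rho>_\<sigma>[OF \<rho>s] by simp
    finally show ?thesis .
  qed
  have "eval A id ?\<phi> = eval A id ?\<psi>"
  proof (rule Mod_eqv_identity[OF is_logic_l'' A])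
    show "?\<phi> \<in> Fm (lang l'') (carrier A)" "?\<psi> \<in> Fm (lang l'') (carrier A)" using Fm by simp_all
    show "id y \<in> carrier A" if "y \<in> carrier A" for y using that by simp
    fix Z \<delta> \<gamma> \<chi> z
    assume \<delta>: "\<And>y :: 'v. \<delta> y \<in> Fm (lang l'') (elts (nvars l''))"
      and \<gamma>: "\<And>y :: 'v. \<gamma> y \<in> Fm (lang l'') (elts (nvars l''))"
      and \<chi>: "\<chi> \<in> Fm (lang l'') Z"
    let ?c = "\<lambda>\<xi>. subst (\<gamma>(z := subst \<delta> \<xi>)) \<chi>"
    note in_Fm = context_closed[OF _ \<delta> \<gamma> \<chi>, unfolded l''_simps]
    have "tr \<rho> (subst \<delta> ?\<phi>) = tr \<rho> (subst \<delta> ?\<psi>)"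
      using tr_subst[OF translation_\<rho> Fm(1)] tr_subst[OF translation_\<rho> Fm(2)] tr_eq by simp
    moreover have "tr \<rho> (?c \<xi>) = subst (\<lambda>x. if x = z then tr \<rho> (subst \<delta> \<xi>) else tr \<rho> (\<gamma> x)) (tr \<rho> \<chi>)" for \<xi>
      using tr_subst[OF translation_\<rho>, of \<chi> Z] \<chi> by (simp add: if_distrib[of "tr \<rho>"] fun_upd_def)
    ultimately have "tr \<rho> (?c ?\<phi>) = tr \<rho> (?c ?\<psi>)" by (simp only:)
    moreover have "entails l' {tr \<rho> t} (tr \<rho> t)" if "t \<in> Fm E V" for t
      using tr_closed[OF translation_\<rho> that] by (intro is_logic_reflexive[OF l']) (auto simp: FmL_def)
    ultimately show "entails l'' {?c ?\<phi>} (?c ?\<psi>) \<and> entails l'' {?c ?\<psi>} (?c ?\<phi>)"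
      using in_Fm[OF Fm(1)] in_Fm[OF Fm(2)] by (simp del: tr.simps subst.simps)
  qed
  moreover have "eval A id ?\<phi> = oper A s as" by (simp add: comp_def)
  moreover have "eval A id ?\<psi> = oper (trans_alg (trans_alg A \<sigma>) \<rho>) s as"
    using eval_tr[OF translation_\<sigma> \<rho>s] by (simp add: eval_subst term_fun_eq)
  ultimately show "oper (trans_alg (trans_alg A \<sigma>) \<rho>) s as = oper A s as" by simp
qed simp

lemma interpretation_\<rho>: "interpretation_of \<rho> l'' l'"
  using translation_\<rho> translation_\<sigma> Mod_\<rho> alg_eq_\<rho>_\<sigma>
  by (intro interpretation_ofI_inverse[of _ _ _ \<sigma>]) simp_all

lemma interpretation_\<sigma>: "interpretation_of \<sigma> l' l''"
  using translation_\<rho> translation_\<sigma> Mod_\<sigma> alg_eq_\<sigma>_\<rho>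
  by (intro interpretation_ofI_inverse[of _ _ _ \<rho>]) simp_all

lemma term_equivalent_l'': "term_equivalent l'' l'"
  unfolding term_equivalent_def
proof (intro exI conjI)
  show "interpretation_of \<rho> l'' l'" "interpretation_of \<sigma> l' l''"
    by (rule interpretation_\<rho> interpretation_\<sigma>)+
qed (use alg_eq_\<sigma>_\<rho> alg_eq_\<rho>_\<sigma> in auto)

lemma compatible_expansion_l'': "compatible_expansion l l''"
  unfolding compatible_expansion_def
proof (intro conjI)
  show "lang l \<subseteq> lang l''" by (simp add: E_def)
  have "(A, F) \<in> Mod_eqv l" if A: "(A, F) \<in> Mod_eqv l''" for A F
  proof (rule Mod_eqv_alg_eq[OF l])
    show "(trans_alg (trans_alg A \<sigma>) \<tau>, F) \<in> Mod_eqv l"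
      by (rule interpretation_ofD(2)[OF \<tau> interpretation_ofD(2)[OF interpretation_\<sigma> A]])
    show "alg_eq (lang l) (trans_alg (trans_alg A \<sigma>) \<tau>) A"
      unfolding alg_eq_def
    proof (intro conjI ballI impI)
      fix s as assume s: "s \<in> lang l" and as: "as \<in> lists (carrier (trans_alg (trans_alg A \<sigma>) \<tau>))" "length as = snd s"
      have "oper (trans_alg (trans_alg A \<sigma>) \<rho>) s as = oper A s as"
        using alg_eq_\<sigma>_\<rho>[OF A] s as unfolding alg_eq_def by (simp add: E_def)
      then show "oper (trans_alg (trans_alg A \<sigma>) \<tau>) s as = oper A s as"
        using s by (simp add: \<rho>_def)
    qed simp
  qed
  then show "\<forall>(A, F)\<in>Mod_eqv l''. (A, F) \<in> Mod_eqv l" by blast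
qed

end

lemma interpretable_imp_expansion:
  assumes "is_logic l" "is_logic l'" "interpretable l l'"
  obtains k where "is_logic k" "compatible_expansion l k" "term_equivalent k l'"
proof -
  obtain \<tau> where \<tau>: "interpretation_of \<tau> l l'" using assms(3) unfolding interpretable_def by blast
  \<comment> \<open>the first component of a pair; only a set of elements occurs as first components in \<open>l\<close>\<close>
  define p :: "'a \<Rightarrow> 'a" where "p x = (SOME a. \<exists>b. x = vpair a b)" for x
  have p: "p (vpair a b) = a" for a b
  proof -
    have "\<exists>b'. vpair a b = vpair (p (vpair a b)) b'"
      unfolding p_def by (rule someI_ex) blast
    then show ?thesis by simp
  qed
  have "small (p ` fst ` lang l)"
    using is_logicD(1)[OF assms(1)] by (intro small_image) (simp add: language_def)
  then obtain z where z: "z \<notin> p ` fst ` lang l" using ex_not_in_small by blast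
  have "(vpair z a, n) \<notin> lang l" for a n
  proof
    assume "(vpair z a, n) \<in> lang l"
    then have "p (fst (vpair z a, n)) \<in> p ` fst ` lang l" by blast
    then show False using z p by simp
  qed
  then interpret expansion l l' \<tau> z
    using assms \<tau> by unfold_locales
  show thesis
    by (rule that[OF is_logic_l'' compatible_expansion_l'' term_equivalent_l''])
qed


section \<open>Codes of logics\<close>

text \<open>Logics are coded by sets so that those coded in a given level of the hierarchy form a set.\<close>

definition logic_code :: "'v::zfc logic \<Rightarrow> 'v"
  where "logic_code l = vpair (vset ((\<lambda>s. vpair (fst s) (vnat (snd s))) ` lang l)) (vpair (nvars l)
    (vset ((\<lambda>(\<Gamma>, \<phi>). vpair (vset (fm_code ` \<Gamma>)) (fm_code \<phi>)) ` {(\<Gamma>, \<phi>). entails l \<Gamma> \<phi>})))"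

lemma small_fm_code_subset:
  assumes "is_logic l" "\<Gamma> \<subseteq> FmL l" shows "small (fm_code ` \<Gamma>)"
proof -
  have "small (fm_code ` FmL l)"
    unfolding FmL_def using is_logicD(1)[OF assms(1)] by (intro small_Fm) (simp_all add: language_def)
  then show ?thesis using image_mono[OF assms(2)] by (rule small_subset)
qed

lemma inj_logic_code: "inj_on logic_code {l :: 'v::zfc logic. is_logic l}"
proof (rule inj_onI)
  fix l l' :: "'v logic"
  assume "l \<in> {l. is_logic l}" "l' \<in> {l. is_logic l}" and eq: "logic_code l = logic_code l'"
  then have l: "is_logic l" and l': "is_logic l'" by simp_all
  let ?s = "\<lambda>s :: 'v sym. vpair (fst s) (vnat (snd s)) :: 'v"
  let ?r = "\<lambda>(\<Gamma>, \<phi>). vpair (vset (fm_code ` \<Gamma>)) (fm_code \<phi>) :: 'v"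
  let ?E = "\<lambda>l. {(\<Gamma>, \<phi>). entails l \<Gamma> \<phi>}"
  have inj_s: "inj ?s" by (rule injI) (simp add: prod_eq_iff)
  have small_s: "small (?s ` lang k)" if k: "is_logic k" for k
  proof -
    have "small {vpair x y | x y. x \<in> fst ` lang k \<and> y \<in> elts omega}"
      using is_logicD(1)[OF k] by (intro small_vpairs) (simp_all add: language_def)
    then show ?thesis by (rule small_subset) (auto simp: elts_omega)
  qed
  have small_r: "small (?r ` ?E k)" if k: "is_logic k" for k
  proof -
    have "small {vpair x y | x y. x \<in> vset ` Pow (fm_code ` FmL k) \<and> y \<in> fm_code ` FmL k}"
      using small_fm_code_subset[OF k order.refl] by (intro small_vpairs small_vset_Pow)
    then show ?thesis
    proof (rule small_subset)
      show "?r ` ?E k \<subseteq> {vpair x y | x y. x \<in> vset ` Pow (fm_code ` FmL k) \<and> y \<in> fm_code ` FmL k}"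
      proof
        fix x assume "x \<in> ?r ` ?E k"
        then obtain \<Gamma> \<phi> where e: "entails k \<Gamma> \<phi>" and x: "x = vpair (vset (fm_code ` \<Gamma>)) (fm_code \<phi>)" by auto
        have "\<Gamma> \<subseteq> FmL k" "\<phi> \<in> FmL k" using is_logicD(4,5)[OF k e] by (simp_all add: FmL_def)
        then show "x \<in> {vpair x y | x y. x \<in> vset ` Pow (fm_code ` FmL k) \<and> y \<in> fm_code ` FmL k}"
          unfolding x by blast
      qed
    qed
  qed
  have eqs: "vset (?s ` lang l) = vset (?s ` lang l')" "nvars l = nvars l'"
    "vset (?r ` ?E l) = vset (?r ` ?E l')"
    using eq by (simp_all add: logic_code_def)
  have "?s ` lang l = ?s ` lang l'" by (rule vset_inj[OF small_s[OF l] small_s[OF l'] eqs(1)])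
  then have lang: "lang l = lang l'" by (simp add: inj_image_eq_iff[OF inj_s])
  have r: "?r ` ?E l = ?r ` ?E l'" by (rule vset_inj[OF small_r[OF l] small_r[OF l'] eqs(3)])
  have FmL: "FmL l = FmL l'" using lang eqs(2) by (simp add: FmL_def)
  have imp: "entails k' \<Gamma> \<phi>"
    if k: "is_logic k" "is_logic k'" "FmL k = FmL k'" "?r ` ?E k = ?r ` ?E k'" and e: "entails k \<Gamma> \<phi>" for k k' \<Gamma> \<phi>
  proof -
    have "?r (\<Gamma>, \<phi>) \<in> ?r ` ?E k'" unfolding k(4)[symmetric] by (rule imageI) (simp add: e)
    then obtain \<Gamma>' \<phi>' where e': "entails k' \<Gamma>' \<phi>'"
      and eq': "vset (fm_code ` \<Gamma>) = vset (fm_code ` \<Gamma>')" "fm_code \<phi> = fm_code \<phi>'" by auto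
    have "small (fm_code ` \<Gamma>)"
      by (rule small_fm_code_subset[OF k(1)]) (simp add: FmL_def is_logicD(4)[OF k(1) e])
    moreover have "small (fm_code ` \<Gamma>')"
      by (rule small_fm_code_subset[OF k(2)]) (simp add: FmL_def is_logicD(4)[OF k(2) e'])
    ultimately have "fm_code ` \<Gamma> = fm_code ` \<Gamma>'" using eq'(1) by (rule vset_inj)
    then show ?thesis using e' eq'(2) by (simp add: inj_image_eq_iff[OF inj_fm_code] inj_eq[OF inj_fm_code])
  qed
  have "entails l = entails l'"
    by (intro ext iffI) (blast intro: imp[OF l l' FmL r] imp[OF l' l FmL[symmetric] r[symmetric]])+
  then show "l = l'" using lang eqs(2) by simp
qed


section \<open>Leibniz classes\<close>

definition closed_interpretable :: "'v::zfc logic set \<Rightarrow> bool"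
  where "closed_interpretable K \<longleftrightarrow> (\<forall>l\<in>K. \<forall>l'. is_logic l' \<and> interpretable l l' \<longrightarrow> l' \<in> K)"

lemma closed_interpretableD:
  "closed_interpretable K \<Longrightarrow> l \<in> K \<Longrightarrow> is_logic l' \<Longrightarrow> interpretable l l' \<Longrightarrow> l' \<in> K"
  unfolding closed_interpretable_def by blast

lemma closed_nonindexed_productsD:
  fixes I :: "'v::zfc set"
  shows "closed_nonindexed_products K \<Longrightarrow> small I \<Longrightarrow> l ` I \<subseteq> K \<Longrightarrow> nonindexed_product I l \<in> K"
  unfolding closed_nonindexed_products_def by blast

lemma closed_interpretable_iff:
  assumes K: "K \<subseteq> {l. is_logic l}"
  shows "closed_interpretable K \<longleftrightarrow> closed_term_equivalence K \<and> closed_compatible_expansions K"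
proof
  assume c: "closed_interpretable K"
  have "interpretable l l'" if "term_equivalent l l'" for l l'
    using that unfolding term_equivalent_def interpretable_def by blast
  then have "closed_term_equivalence K"
    unfolding closed_term_equivalence_def using closed_interpretableD[OF c] by blast
  moreover have "interpretable l l'" if "l \<in> K" "compatible_expansion l l'" for l l'
    using compatible_expansion_interpretable K that by blast
  then have "closed_compatible_expansions K"
    unfolding closed_compatible_expansions_def using closed_interpretableD[OF c] by blast
  ultimately show "closed_term_equivalence K \<and> closed_compatible_expansions K" ..
next
  assume c: "closed_term_equivalence K \<and> closed_compatible_expansions K"
  show "closed_interpretable K"
    unfolding closed_interpretable_def
  proof (intro ballI allI impI; elim conjE)
    fix l l' assume l: "l \<in> K" and l': "is_logic l'" "interpretable l l'"
    have "is_logic l" using l K by blast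
    then obtain k where k: "is_logic k" "compatible_expansion l k" "term_equivalent k l'"
      by (rule interpretable_imp_expansion[OF _ l'])
    have "k \<in> K" using c l k(1,2) unfolding closed_compatible_expansions_def by blast
    then show "l' \<in> K" using c l'(1) k(3) unfolding closed_term_equivalence_def by blast
  qed
qed

text \<open>The descent of \<open>\<Phi>\<close> along the ordinals is what makes set-sized families bounded: \<open>\<Phi>\<close> at the supremum
  of their witnesses is interpretable in all members.\<close>

lemma Leibniz_class_imp_closed:
  assumes "Leibniz_class (K :: 'v::zfc logic set)"
  shows "closed_interpretable K \<and> closed_nonindexed_products K"
proof -
  obtain \<Phi> where \<Phi>: "Leibniz_condition \<Phi>" and K: "K = Log_of \<Phi>"
    using assms unfolding Leibniz_class_def by blast
  have \<Phi>_logic: "is_logic (\<Phi> a)" if "Ord a" for a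
    using \<Phi> that unfolding Leibniz_condition_def by blast
  have \<Phi>_mono: "interpretable (\<Phi> b) (\<Phi> a)" if "Ord a" "Ord b" "elts a \<subseteq> elts b" for a b
    using \<Phi> that unfolding Leibniz_condition_def by blast
  have KI: "l \<in> K" if "is_logic l" "Ord a" "interpretable (\<Phi> a) l" for l a
    using that unfolding K Log_of_def by blast
  have KD: "is_logic l" "\<exists>a. Ord a \<and> interpretable (\<Phi> a) l" if "l \<in> K" for l
    using that unfolding K Log_of_def by blast+
  have "closed_interpretable K"
    unfolding closed_interpretable_def
  proof (intro ballI allI impI; elim conjE)
    fix l l' assume l: "l \<in> K" and l': "is_logic l'" "interpretable l l'"
    obtain a where a: "Ord a" "interpretable (\<Phi> a) l" using KD(2)[OF l] by blast
    show "l' \<in> K"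
      by (rule KI[OF l'(1) a(1) interpretable_trans[OF \<Phi>_logic[OF a(1)] a(2) l'(2)]])
  qed
  moreover have "closed_nonindexed_products K"
    unfolding closed_nonindexed_products_def
  proof (intro allI impI; elim conjE)
    fix I :: "'v set" and l :: "'v \<Rightarrow> 'v logic"
    assume I: "small I" and l: "l ` I \<subseteq> K"
    have lI: "l i \<in> K" if "i \<in> I" for i using l that by blast
    have logic: "is_logic (l i)" if "i \<in> I" for i by (rule KD(1)[OF lI[OF that]])
    obtain \<alpha> where \<alpha>: "\<And>i. i \<in> I \<Longrightarrow> Ord (\<alpha> i)" "\<And>i. i \<in> I \<Longrightarrow> interpretable (\<Phi> (\<alpha> i)) (l i)"
      using KD(2)[OF lI] by metis
      \<comment> \<open>the supremum of the witnesses; for \<open>I = {}\<close> this is the ordinal \<open>0\<close>\<close>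
  define b where "b = vset (\<Union>i\<in>I. elts (\<alpha> i))"
    have b: "Ord b" "elts b = (\<Union>i\<in>I. elts (\<alpha> i))"
      unfolding b_def by (rule Ord_union[OF I \<alpha>(1)]; assumption)+
    have *: "interpretable (\<Phi> b) (l i)" if i: "i \<in> I" for i
    proof (rule interpretable_trans[OF \<Phi>_logic[OF b(1)] \<Phi>_mono[OF \<alpha>(1)[OF i] b(1)] \<alpha>(2)[OF i]])
      show "elts (\<alpha> i) \<subseteq> elts b" using b(2) i by blast
    qed
    have "interpretable (\<Phi> b) (nonindexed_product I l)"
      by (rule nonindexed_product_greatest[OF I logic \<Phi>_logic[OF b(1)] *])
    from KI[OF is_logic_nonindexed_product[OF I logic] b(1) this]
    show "nonindexed_product I l \<in> K" by blast
  qed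
  ultimately show ?thesis ..
qed

text \<open>The products of the ever larger sets of members of \<open>K\<close> in the levels of the cumulative hierarchy
  descend, every member of \<open>K\<close> lies above one of them, and all of them belong to \<open>K\<close>.\<close>

lemma closed_imp_Leibniz_class:
  fixes K :: "'v::zfc logic set"
  assumes K: "K \<subseteq> {l. is_logic l}"
    and up: "closed_interpretable K" and pr: "closed_nonindexed_products K"
  shows "Leibniz_class K"
proof -
  define I where "I a = stage a \<inter> logic_code ` K" for a :: 'v
  define f where "f = inv_into K logic_code"
  have inj: "inj_on logic_code K" by (rule inj_on_subset[OF inj_logic_code K])
  have small_I: "small (I a)" for a
    unfolding I_def by (rule small_subset[OF small_stage]) blast
  have f: "f i \<in> K" if "i \<in> I a" for i a
    using that unfolding f_def I_def by (auto intro: inv_into_into)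
  have logic: "is_logic (f i)" if "i \<in> I a" for i a using f[OF that] K by blast
  define \<Phi> where "\<Phi> a = nonindexed_product (I a) f" for a
  have \<Phi>K: "\<Phi> a \<in> K" for a
    unfolding \<Phi>_def by (rule closed_nonindexed_productsD[OF pr small_I]) (use f in blast)
  have \<Phi>_logic: "is_logic (\<Phi> a)" for a using \<Phi>K K by blast
  have lower: "interpretable (\<Phi> a) (f i)" if "i \<in> I a" for a i
    unfolding \<Phi>_def by (rule nonindexed_product_lower[OF small_I logic that])
  have "Leibniz_condition \<Phi>"
    unfolding Leibniz_condition_def
  proof (intro conjI allI impI \<Phi>_logic; elim conjE)
    fix a b :: 'v assume "elts a \<subseteq> elts b"
    then have "I a \<subseteq> I b" using stage_mono unfolding I_def by blast
    then have *: "interpretable (\<Phi> b) (f i)" if "i \<in> I a" for i using lower that by blast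
    show "interpretable (\<Phi> b) (\<Phi> a)"
      unfolding \<Phi>_def[of a] by (rule nonindexed_product_greatest[OF small_I logic \<Phi>_logic *])
  qed
  moreover have "K = Log_of \<Phi>"
  proof
    show "K \<subseteq> Log_of \<Phi>"
    proof
      fix l assume l: "l \<in> K"
      obtain a where a: "Ord a" "logic_code l \<in> stage a" using ex_stage by blast
      then have "interpretable (\<Phi> a) (f (logic_code l))" using l by (intro lower) (simp add: I_def)
      then show "l \<in> Log_of \<Phi>"
        using a(1) l K by (auto simp: Log_of_def f_def inv_into_f_f[OF inj l])
    qed
    show "Log_of \<Phi> \<subseteq> K"
      using closed_interpretableD[OF up \<Phi>K] unfolding Log_of_def by blast
  qed
  ultimately show ?thesis unfolding Leibniz_class_def by blast
qed


section \<open>Set-complete filters\<close>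

lemma carrier_Log: "carrier Log = equi_class ` {l. is_logic l}"
  by (simp add: Log_def)

lemma mem_equi_class: "is_logic l \<Longrightarrow> l \<in> equi_class l"
  using interpretable_refl by (auto simp: equi_class_def)

text \<open>Interpretability of some representatives is interpretability of all.\<close>

lemma le_Log_iff:
  assumes "is_logic l" "is_logic l'"
  shows "equi_class l \<sqsubseteq>\<^bsub>Log\<^esub> equi_class l' \<longleftrightarrow> interpretable l l'"
proof
  assume "equi_class l \<sqsubseteq>\<^bsub>Log\<^esub> equi_class l'"
  then obtain k k' where k: "k \<in> equi_class l" "k' \<in> equi_class l'" "interpretable k k'"
    by (auto simp: Log_def)
  then have "is_logic k" "interpretable l k" "interpretable k' l'" by (auto simp: equi_class_def)
  then show "interpretable l l'"
    using interpretable_trans[OF assms(1)] k(3) by blast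
next
  assume "interpretable l l'"
  then show "equi_class l \<sqsubseteq>\<^bsub>Log\<^esub> equi_class l'"
    using mem_equi_class[OF assms(1)] mem_equi_class[OF assms(2)] by (auto simp: Log_def)
qed

lemma nonindexed_product_is_glb:
  fixes I :: "'v::zfc set"
  assumes I: "small I" and l: "\<And>i. i \<in> I \<Longrightarrow> is_logic (l i)"
  shows "is_glb Log (equi_class (nonindexed_product I l)) ((\<lambda>i. equi_class (l i)) ` I)"
proof -
  let ?P = "nonindexed_product I l"
  have P: "is_logic ?P" by (rule is_logic_nonindexed_product[OF I l])
  have lower: "equi_class k \<in> Lower Log ((\<lambda>i. equi_class (l i)) ` I) \<longleftrightarrow> (\<forall>i\<in>I. interpretable k (l i))"
    if k: "is_logic k" for k
  proof -
    have "equi_class (l i) \<in> carrier Log" if "i \<in> I" for i using l[OF that] by (simp add: carrier_Log)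
    moreover have "equi_class k \<in> carrier Log" using k by (simp add: carrier_Log)
    moreover have "equi_class k \<sqsubseteq>\<^bsub>Log\<^esub> equi_class (l i) \<longleftrightarrow> interpretable k (l i)" if "i \<in> I" for i
      by (rule le_Log_iff[OF k l[OF that]])
    ultimately show ?thesis unfolding Lower_def by blast
  qed
  show ?thesis
    unfolding greatest_def
  proof (intro conjI ballI)
    show "Lower Log ((\<lambda>i. equi_class (l i)) ` I) \<subseteq> carrier Log" by (auto simp: Lower_def)
    show "equi_class ?P \<in> Lower Log ((\<lambda>i. equi_class (l i)) ` I)"
      unfolding lower[OF P] by (intro ballI nonindexed_product_lower[OF I l])
    fix Q assume Q: "Q \<in> Lower Log ((\<lambda>i. equi_class (l i)) ` I)"
    then obtain k where k: "is_logic k" "Q = equi_class k" by (auto simp: Lower_def carrier_Log)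
    then show "Q \<sqsubseteq>\<^bsub>Log\<^esub> equi_class ?P"
      using Q lower[OF k(1)] nonindexed_product_greatest[OF I l k(1)] le_Log_iff[OF k(1) P] by simp
  qed
qed

text \<open>A set-complete filter contains some infimum of each set of its members, hence also the class of the product, which
  is above that infimum.  The second conjunct recovers \<open>K\<close> from its classes.\<close>

lemma set_complete_filter_iff:
  fixes K :: "'v::zfc logic set"
  assumes K: "K \<subseteq> {l. is_logic l}"
  shows "set_complete_filter (equi_class ` K) \<and> K = {l. is_logic l \<and> equi_class l \<in> equi_class ` K}
    \<longleftrightarrow> closed_interpretable K \<and> closed_nonindexed_products K" (is "?filter \<longleftrightarrow> ?closed")
proof
  assume filter: ?filter
  then have up: "Q \<in> equi_class ` K" if "P \<in> equi_class ` K" "Q \<in> carrier Log" "P \<sqsubseteq>\<^bsub>Log\<^esub> Q" for P Q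
    using that unfolding set_complete_filter_def by blast
  have inf: "\<exists>P\<in>equi_class ` K. is_glb Log P (f ` I)" if "small I" "f ` I \<subseteq> equi_class ` K" for f and I :: "'v set"
    using filter that unfolding set_complete_filter_def by blast
  have memI: "l \<in> K" if "is_logic l" "equi_class l \<in> equi_class ` K" for l
    using filter that by blast
  have "closed_interpretable K"
    unfolding closed_interpretable_def
  proof (intro ballI allI impI; elim conjE)
    fix l l' assume l: "l \<in> K" and l': "is_logic l'" "interpretable l l'"
    have logic: "is_logic l" using l K by blast
    have "equi_class l' \<in> carrier Log" using l'(1) by (simp add: carrier_Log)
    from up[OF imageI[OF l] this] have "equi_class l' \<in> equi_class ` K"
      using le_Log_iff[OF logic l'(1)] l'(2) by simp
    then show "l' \<in> K" by (rule memI[OF l'(1)])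
  qed
  moreover have "closed_nonindexed_products K"
    unfolding closed_nonindexed_products_def
  proof (intro allI impI; elim conjE)
    fix I :: "'v set" and l :: "'v \<Rightarrow> 'v logic"
    assume I: "small I" and l: "l ` I \<subseteq> K"
    let ?P = "nonindexed_product I l" and ?f = "\<lambda>i. equi_class (l i)"
    have logic: "is_logic (l i)" if "i \<in> I" for i using l K that by blast
    have P: "is_logic ?P" by (rule is_logic_nonindexed_product[OF I logic])
    have "?f ` I \<subseteq> equi_class ` K" using l by blast
    from inf[OF I this] obtain Q where Q: "Q \<in> equi_class ` K" "is_glb Log Q (?f ` I)" by (rule bexE)
    have glb: "is_glb Log (equi_class ?P) (?f ` I)"
      by (rule nonindexed_product_is_glb[OF I logic])
    have "Q \<in> Lower Log (?f ` I)" using Q(2) by (simp add: greatest_def)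
    then have "Q \<sqsubseteq>\<^bsub>Log\<^esub> equi_class ?P"
      using glb by (simp add: greatest_def)
    moreover have "equi_class ?P \<in> carrier Log" using P by (simp add: carrier_Log)
    ultimately have "equi_class ?P \<in> equi_class ` K" using up[OF Q(1)] by blast
    then show "?P \<in> K" by (rule memI[OF P])
  qed
  ultimately show ?closed ..
next
  assume closed: ?closed
  note up = closed_interpretableD[OF conjunct1[OF closed]]
  note pr = closed_nonindexed_productsD[OF conjunct2[OF closed]]
  have "nonindexed_product ({} :: 'v set) (\<lambda>_. inconsistent_logic) \<in> K" by (rule pr) simp_all
  then have ne: "equi_class ` K \<noteq> {}" by blast
  have up': "Q \<in> equi_class ` K" if P: "P \<in> equi_class ` K" and Q: "Q \<in> carrier Log" and le: "P \<sqsubseteq>\<^bsub>Log\<^esub> Q" for P Q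
  proof -
    obtain l l' where l: "l \<in> K" "P = equi_class l" and l': "is_logic l'" "Q = equi_class l'"
      using P Q by (auto simp: carrier_Log)
    then have "interpretable l l'" using le le_Log_iff[of l l'] K by blast
    then have "l' \<in> K" by (rule up[OF l(1) l'(1)])
    then show ?thesis using l'(2) by blast
  qed
  have inf: "\<exists>P\<in>equi_class ` K. is_glb Log P (f ` I)" if I: "small I" and f: "f ` I \<subseteq> equi_class ` K"
    for f and I :: "'v set"
  proof -
    have "\<forall>i\<in>I. \<exists>l. l \<in> K \<and> f i = equi_class l" using f by blast
    then obtain l where l: "\<And>i. i \<in> I \<Longrightarrow> l i \<in> K \<and> f i = equi_class (l i)" by metis
    have "is_glb Log (equi_class (nonindexed_product I l)) ((\<lambda>i. equi_class (l i)) ` I)"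
      by (rule nonindexed_product_is_glb[OF I]) (use l K in blast)
    moreover have "(\<lambda>i. equi_class (l i)) ` I = f ` I" using l by (intro image_cong) auto
    moreover have "nonindexed_product I l \<in> K" by (rule pr[OF I]) (use l in blast)
    ultimately show ?thesis by auto
  qed
  have "l \<in> K" if l: "is_logic l" "equi_class l \<in> equi_class ` K" for l
  proof -
    obtain k where k: "k \<in> K" "equi_class l = equi_class k" using l(2) by blast
    then have "l \<in> equi_class k" using mem_equi_class[OF l(1)] by simp
    then have "interpretable k l" by (simp add: equi_class_def)
    then show ?thesis by (rule up[OF k(1) l(1)])
  qed
  then have "K = {l. is_logic l \<and> equi_class l \<in> equi_class ` K}" using K by blast
  moreover have "set_complete_filter (equi_class ` K)"
    unfolding set_complete_filter_def
  proof (intro conjI ballI allI impI; (elim conjE)?)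
    show "equi_class ` K \<subseteq> carrier Log" using K by (auto simp: carrier_Log)
    show "equi_class ` K \<noteq> {}" by (rule ne)
  qed (rule up' inf; assumption)+
  ultimately show ?filter by blast
qed

theorem theorem2p2:
  fixes K :: "'v::zfc logic set"
  assumes "K \<subseteq> {l. is_logic l}"
  shows "(Leibniz_class K \<longleftrightarrow>
            closed_term_equivalence K \<and> closed_compatible_expansions K \<and> closed_nonindexed_products K)
       \<and> (closed_term_equivalence K \<and> closed_compatible_expansions K \<and> closed_nonindexed_products K \<longleftrightarrow>
            set_complete_filter (equi_class ` K) \<and>
            K = {l. is_logic l \<and> equi_class l \<in> equi_class ` K})"
proof -
  have "Leibniz_class K \<longleftrightarrow> closed_interpretable K \<and> closed_nonindexed_products K"
    using Leibniz_class_imp_closed closed_imp_Leibniz_class[OF assms] by blast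
  then show ?thesis
    using closed_interpretable_iff[OF assms] set_complete_filter_iff[OF assms] by argo
qed

end
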